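(* Let $\langle\mathcal W_0,\mathcal W_1\rangle$ denote the subalgebra of $\mathcal A_q$ generated by $\mathcal W_0,\mathcal W_1$, and let $\mathcal Z$ denote the subalgebra of $\mathcal A_q$ generated by $\{\mathcal Z_n\}_{n=1}^\infty$. The multiplication map $$\langle\mathcal W_0,\mathcal W_1\rangle\otimes\mathcal Z\to\mathcal A_q,\qquad w\otimes z\mapsto wz$$ is an algebra isomorphism.
   Context: Conventions: $\mathbb N=\{0,1,2,\ldots\}$; $\mathbb F$ is a field; $q\in\mathbb F$ is nonzero and not a root of unity; all algebras are associative, unital, over $\mathbb F$; tensor products are over $\mathbb F$. Write $[X,Y]=XY-YX$, $[X,Y]_q=qXY-q^{-1}YX$, $[2]_q=q+q^{-1}$. The algebra $\mathcal A_q$ is defined by generators (called alternating) $\{\mathcal W_{-k}\}_{k\in\mathbb N}$, $\{\mathcal W_{k+1}\}_{k\in\mathbb N}$, $\{\mathcal G_{k+1}\}_{k\in\mathbb N}$, $\{\mathcal{\tilde G}_{k+1}\}_{k\in\mathbb N}$ and the following relations for $k,\ell\in\mathbb N$, where $\rho=-(q^2-q^{-2})^2$: $[\mathcal W_0,\mathcal W_{k+1}]=[\mathcal W_{-k},\mathcal W_1]=(\mathcal{\tilde G}_{k+1}-\mathcal G_{k+1})/(q+q^{-1})$; $[\mathcal W_0,\mathcal G_{k+1}]_q=[\mathcal{\tilde G}_{k+1},\mathcal W_0]_q=\rho\mathcal W_{-k-1}-\rho\mathcal W_{k+1}$; $[\mathcal G_{k+1},\mathcal W_1]_q=[\mathcal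 W_1,\mathcal{\tilde G}_{k+1}]_q=\rho\mathcal W_{k+2}-\rho\mathcal W_{-k}$; $[\mathcal W_{-k},\mathcal W_{-\ell}]=0$, $[\mathcal W_{k+1},\mathcal W_{\ell+1}]=0$; $[\mathcal W_{-k},\mathcal W_{\ell+1}]+[\mathcal W_{k+1},\mathcal W_{-\ell}]=0$; $[\mathcal W_{-k},\mathcal G_{\ell+1}]+[\mathcal G_{k+1},\mathcal W_{-\ell}]=0$; $[\mathcal W_{-k},\mathcal{\tilde G}_{\ell+1}]+[\mathcal{\tilde G}_{k+1},\mathcal W_{-\ell}]=0$; $[\mathcal W_{k+1},\mathcal G_{\ell+1}]+[\mathcal G_{k+1},\mathcal W_{\ell+1}]=0$; $[\mathcal W_{k+1},\mathcal{\tilde G}_{\ell+1}]+[\mathcal{\tilde G}_{k+1},\mathcal W_{\ell+1}]=0$; $[\mathcal G_{k+1},\mathcal G_{\ell+1}]=0$, $[\mathcal{\tilde G}_{k+1},\mathcal{\tilde G}_{\ell+1}]=0$; $[\mathcal{\tilde G}_{k+1},\mathcal G_{\ell+1}]+[\mathcal G_{k+1},\mathcal{\tilde G}_{\ell+1}]=0$. Set $\mathcal G_0=\mathcal{\tilde G}_0=-(q-q^{-1})[2]_q^2$. For an indeterminate $t$ define the formal generating functions $\mathcal W^-(t)=\sum_{n\in\mathbb N}\mathcal W_{-n}t^n$, $\mathcal W^+(t)=\sum_{n\in\mathbb N}\mathcal W_{n+1}t^n$, $\mathcal G(t)=\sum_{n\in\mathbb N}\mathcal G_nt^n$, $\mathcal{\tilde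 G}(t)=\sum_{n\in\mathbb N}\mathcal{\tilde G}_nt^n$. Let $S=\frac{q+q^{-1}}{q^{-1}t+qt^{-1}}$ and $T=\frac{q+q^{-1}}{qt+q^{-1}t^{-1}}$, viewed as power series in $t$: $S=(q+q^{-1})\sum_{\ell\in\mathbb N}(-1)^\ell q^{-2\ell-1}t^{2\ell+1}$, $T=(q+q^{-1})\sum_{\ell\in\mathbb N}(-1)^\ell q^{2\ell+1}t^{2\ell+1}$. Define $$\mathcal Z(t)=t^{-1}ST\mathcal W^-(S)\mathcal W^+(T)+tST\mathcal W^+(S)\mathcal W^-(T)-q^2ST\mathcal W^-(S)\mathcal W^-(T)-q^{-2}ST\mathcal W^+(S)\mathcal W^+(T)+(q^2-q^{-2})^{-2}\mathcal G(S)\mathcal{\tilde G}(T),$$ and define $\mathcal Z_n\in\mathcal A_q$ $(n\in\mathbb N)$ by $\mathcal Z(t)=\sum_{n\in\mathbb N}\mathcal Z_n[2]_q^nt^n$. *)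

theory Defs
  imports
    "HOL-Library.Poly_Mapping"
    "HOL-Computational_Algebra.Formal_Power_Series"
    "HOL-Algebra.QuotRing"
    "HOL-Algebra.Subrings"
begin

section \<open>Algebras over a field\<close>

text \<open>
  An algebra over a field given by a type \<open>'f :: field\<close> is represented by the record
  type \<open>('f, 'a) module\<close> of HOL-Algebra: a ring together with a scalar multiplication.
  Multiplication is not assumed to be commutative.
\<close>

locale F_algebra = ring A for A :: "('f::field, 'a) module" (structure) +
  assumes smult_closed: "x \<in> carrier A \<Longrightarrow> c \<odot> x \<in> carrier A"
    and smult_l_distr: "x \<in> carrier A \<Longrightarrow> (c + d) \<odot> x = c \<odot> x \<oplus> d \<odot> x"
    and smult_r_distr: "x \<in> carrier A \<Longrightarrow> y \<in> carrier A \<Longrightarrow> c \<odot> (x \<oplus> y) = c \<odot> x \<oplus> c \<odot> y"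
    and smult_assoc1: "x \<in> carrier A \<Longrightarrow> (c * d) \<odot> x = c \<odot> (d \<odot> x)"
    and smult_one: "x \<in> carrier A \<Longrightarrow> 1 \<odot> x = x"
    and smult_assoc2: "x \<in> carrier A \<Longrightarrow> y \<in> carrier A \<Longrightarrow> c \<odot> x \<otimes> y = c \<odot> (x \<otimes> y)"
    and smult_assoc3: "x \<in> carrier A \<Longrightarrow> y \<in> carrier A \<Longrightarrow> x \<otimes> (c \<odot> y) = c \<odot> (x \<otimes> y)"

definition alg_iso :: "('f::field, 'a) module \<Rightarrow> ('f, 'b) module \<Rightarrow> ('a \<Rightarrow> 'b) set" where
  "alg_iso A B =
     {h \<in> ring_iso A B. \<forall>c. \<forall>x\<in>carrier A. h (c \<odot>\<^bsub>A\<^esub> x) = c \<odot>\<^bsub>B\<^esub> h x}"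

definition subalg :: "('f::field, 'a) module \<Rightarrow> 'a set \<Rightarrow> bool" where
  "subalg A B \<longleftrightarrow> subring B A \<and> (\<forall>c. \<forall>x\<in>B. c \<odot>\<^bsub>A\<^esub> x \<in> B)"

definition subalg_generated :: "('f::field, 'a) module \<Rightarrow> 'a set \<Rightarrow> ('f, 'a) module" where
  "subalg_generated A S = A\<lparr>carrier := subalg A hull S\<rparr>"

text \<open>The quotient of \<open>A\<close> by \<open>I\<close>, as the set of cosets of \<open>I\<close>.\<close>

definition alg_quot :: "('f::field, 'a) module \<Rightarrow> 'a set \<Rightarrow> ('f, 'a set) module" where
  "alg_quot A I =
     \<lparr>carrier = carrier (A Quot I), mult = mult (A Quot I), one = one (A Quot I),
      zero = zero (A Quot I), add = add (A Quot I),
      smult = (\<lambda>c X. \<Union>x\<in>X. I +>\<^bsub>A\<^esub> (c \<odot>\<^bsub>A\<^esub> x))\<rparr>"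

lemma (in F_algebra) smult_coset:
  assumes "ideal I A" and x: "x \<in> carrier A"
  shows "c \<odot>\<^bsub>alg_quot A I\<^esub> (I +> x) = I +> (c \<odot> x)"
proof -
  interpret I: ideal I A by fact
  have *: "I +> (c \<odot> y) = I +> (c \<odot> x)" if y_in: "y \<in> I +> x" for y
  proof -
    obtain i where i: "i \<in> I" and y: "y = i \<oplus> x"
      using y_in by (auto simp: a_r_coset_def')
    have "c \<odot> i = (c \<odot> \<one>) \<otimes> i"
      using i by (simp add: smult_assoc2)
    then have "c \<odot> i \<in> I"
      using i by (simp add: I.I_l_closed smult_closed)
    then have "c \<odot> y \<in> I +> (c \<odot> x)"
      using i x by (auto simp: y smult_r_distr a_r_coset_def')
    then show ?thesis
      using x by (simp add: I.a_repr_independence' smult_closed)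
  qed
  have "x \<in> I +> x"
    using x by (rule I.a_rcos_self)
  then have "(\<Union>y\<in>I +> x. I +> (c \<odot> y)) = I +> (c \<odot> x)"
    by (intro SUP_eq_const *) auto
  then show ?thesis
    by (simp add: alg_quot_def)
qed

lemma (in F_algebra) F_algebra_alg_quot:
  assumes "ideal I A"
  shows "F_algebra (alg_quot A I)"
proof -
  interpret I: ideal I A by fact
  interpret Q: ring "A Quot I"
    by (rule I.quotient_is_ring)
  have sel: "carrier (alg_quot A I) = carrier (A Quot I)" "mult (alg_quot A I) = mult (A Quot I)"
      "one (alg_quot A I) = one (A Quot I)" "add (alg_quot A I) = add (A Quot I)"
      "zero (alg_quot A I) = zero (A Quot I)"
    by (simp_all add: alg_quot_def)
  have "\<exists>Y\<in>carrier (A Quot I). Y \<oplus>\<^bsub>A Quot I\<^esub> X = \<zero>\<^bsub>A Quot I\<^esub>"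
    if "X \<in> carrier (A Quot I)" for X
    using that by (intro bexI[of _ "\<ominus>\<^bsub>A Quot I\<^esub> X"] Q.l_neg Q.a_inv_closed)
  then have ring: "ring (alg_quot A I)"
    by (intro ringI abelian_groupI monoidI; simp only: sel)
      (simp_all add: Q.m_assoc Q.l_distr Q.r_distr Q.a_ac)
  have carrier: "carrier (alg_quot A I) = (\<lambda>x. I +> x) ` carrier A"
    by (auto simp: alg_quot_def FactRing_def A_RCOSETS_def')
  have ops: "(I +> x) \<oplus>\<^bsub>alg_quot A I\<^esub> (I +> y) = I +> (x \<oplus> y)"
      "(I +> x) \<otimes>\<^bsub>alg_quot A I\<^esub> (I +> y) = I +> (x \<otimes> y)"
    if "x \<in> carrier A" "y \<in> carrier A" for x y
    using that by (simp_all add: alg_quot_def FactRing_def I.a_rcos_sum I.rcoset_mult_add)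
  have "F_algebra_axioms (alg_quot A I)"
    by (unfold_locales; unfold carrier; elim imageE; hypsubst)
      (simp_all add: smult_coset[OF assms] ops smult_closed smult_l_distr smult_r_distr
        smult_assoc1 smult_one smult_assoc2 smult_assoc3)
  with ring show ?thesis
    by (rule F_algebra.intro)
qed

section \<open>Finitely supported functions as a vector space\<close>

definition scale :: "'f::field \<Rightarrow> ('k \<Rightarrow>\<^sub>0 'f) \<Rightarrow> ('k \<Rightarrow>\<^sub>0 'f)"  (infixr \<open>\<bullet>\<close> 75) where
  "c \<bullet> p = Poly_Mapping.map ((*) c) p"

lemma lookup_scale [simp]: "Poly_Mapping.lookup (c \<bullet> p) k = c * Poly_Mapping.lookup p k"
  by (simp add: scale_def Poly_Mapping.map.rep_eq when_def)

global_interpretation fsupp: vector_space "scale :: 'f::field \<Rightarrow> ('k \<Rightarrow>\<^sub>0 'f) \<Rightarrow> ('k \<Rightarrow>\<^sub>0 'f)"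
  by unfold_locales (auto intro!: poly_mapping_eqI simp: lookup_add algebra_simps)

section \<open>Tensor products of algebras\<close>

text \<open>
  The vector space with basis \<open>carrier A \<times> carrier B\<close>; the basis vector
  \<open>Poly_Mapping.single (a, b) 1\<close> is to become \<open>a \<otimes> b\<close>, and the product is the bilinear
  extension of \<open>(a, b) (a', b') = (a a', b b')\<close>.
\<close>

definition pair_alg ::
  "('f::field, 'a) module \<Rightarrow> ('f, 'b) module \<Rightarrow> ('f, ('a \<times> 'b) \<Rightarrow>\<^sub>0 'f) module" where
  "pair_alg A B =
     \<lparr>carrier = {p. Poly_Mapping.keys p \<subseteq> carrier A \<times> carrier B},
      mult = (\<lambda>p r. \<Sum>(a, b)\<in>Poly_Mapping.keys p. \<Sum>(a', b')\<in>Poly_Mapping.keys r.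
                Poly_Mapping.single (a \<otimes>\<^bsub>A\<^esub> a', b \<otimes>\<^bsub>B\<^esub> b') (Poly_Mapping.lookup p (a, b) * Poly_Mapping.lookup r (a', b'))),
      one = Poly_Mapping.single (\<one>\<^bsub>A\<^esub>, \<one>\<^bsub>B\<^esub>) 1,
      zero = 0, add = (+), smult = scale\<rparr>"

inductive_set bilinearity_relators ::
  "('f::field, 'a) module \<Rightarrow> ('f, 'b) module \<Rightarrow> (('a \<times> 'b) \<Rightarrow>\<^sub>0 'f) set"
  for A :: "('f, 'a) module" and B :: "('f, 'b) module" where
  add_left: "\<lbrakk>a \<in> carrier A; a' \<in> carrier A; b \<in> carrier B\<rbrakk> \<Longrightarrow>
     Poly_Mapping.single (a \<oplus>\<^bsub>A\<^esub> a', b) 1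
       - (Poly_Mapping.single (a, b) 1 + Poly_Mapping.single (a', b) 1) \<in> bilinearity_relators A B"
| add_right: "\<lbrakk>a \<in> carrier A; b \<in> carrier B; b' \<in> carrier B\<rbrakk> \<Longrightarrow>
     Poly_Mapping.single (a, b \<oplus>\<^bsub>B\<^esub> b') 1
       - (Poly_Mapping.single (a, b) 1 + Poly_Mapping.single (a, b') 1) \<in> bilinearity_relators A B"
| smult_left: "\<lbrakk>a \<in> carrier A; b \<in> carrier B\<rbrakk> \<Longrightarrow>
     Poly_Mapping.single (c \<odot>\<^bsub>A\<^esub> a, b) 1 - c \<bullet> Poly_Mapping.single (a, b) 1 \<in> bilinearity_relators A B"
| smult_right: "\<lbrakk>a \<in> carrier A; b \<in> carrier B\<rbrakk> \<Longrightarrow>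
     Poly_Mapping.single (a, c \<odot>\<^bsub>B\<^esub> b) 1 - c \<bullet> Poly_Mapping.single (a, b) 1 \<in> bilinearity_relators A B"

text \<open>
  The linear span of the bilinearity relators is a two-sided ideal of \<open>pair_alg A B\<close>, because the
  product of a relator with a basis vector is again a relator; so the product passes to the quotient.
\<close>

definition tensor_alg ::
  "('f::field, 'a) module \<Rightarrow> ('f, 'b) module \<Rightarrow> ('f, (('a \<times> 'b) \<Rightarrow>\<^sub>0 'f) set) module" where
  "tensor_alg A B = alg_quot (pair_alg A B) (fsupp.span (bilinearity_relators A B))"

definition pure_tensor ::
  "('f::field, 'a) module \<Rightarrow> ('f, 'b) module \<Rightarrow> 'a \<Rightarrow> 'b \<Rightarrow> (('a \<times> 'b) \<Rightarrow>\<^sub>0 'f) set" where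
  "pure_tensor A B a b =
     fsupp.span (bilinearity_relators A B) +>\<^bsub>pair_alg A B\<^esub> Poly_Mapping.single (a, b) 1"

section \<open>Free algebras and presentations\<close>

text \<open>
  The free algebra on \<open>'g\<close> is the monoid algebra of the free monoid on \<open>'g\<close>. The latter is written
  additively (and \<open>0\<close> is the empty word), since that is what the convolution product on
  \<open>'k \<Rightarrow>\<^sub>0 'f\<close> expects of \<open>'k\<close>.
\<close>

datatype 'g fmon = FMon "'g list"

instantiation fmon :: (type) monoid_add
begin

definition zero_fmon :: "'a fmon" where "0 = FMon []"

fun plus_fmon :: "'a fmon \<Rightarrow> 'a fmon \<Rightarrow> 'a fmon" where
  "FMon u + FMon v = FMon (u @ v)"

instance
proof
  fix a b c :: "'a fmon"
  show "a + b + c = a + (b + c)" by (cases a; cases b; cases c) simp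
  show "0 + a = a" "a + 0 = a" by (cases a; simp add: zero_fmon_def)+
qed

end

type_synonym ('g, 'f) free_alg = "'g fmon \<Rightarrow>\<^sub>0 'f"

definition gen :: "'g \<Rightarrow> ('g, 'f::field) free_alg" where
  "gen g = Poly_Mapping.single (FMon [g]) 1"

definition free_algebra :: "('f::field, ('g, 'f) free_alg) module" where
  "free_algebra = \<lparr>carrier = UNIV, mult = (*), one = 1, zero = 0, add = (+), smult = scale\<rparr>"

lemma scale_eq_mult: "c \<bullet> x = Poly_Mapping.single 0 c * x"
  for x :: "('g, 'f::field) free_alg"
  by (simp add: scale_def mult_map_scale_conv_mult)

lemma mult_single_zero_commute: "x * Poly_Mapping.single 0 c = Poly_Mapping.single 0 c * x"
  for x :: "('g, 'f::field) free_alg"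
proof (induction x rule: update_induct)
  case const
  then show ?case by simp
next
  case (update f a b)
  have "Poly_Mapping.update a b f = f + Poly_Mapping.single a b"
    using update(1) by (intro poly_mapping_eqI)
      (auto simp: Poly_Mapping.lookup_update lookup_add lookup_single in_keys_iff when_def)
  then show ?case
    using update(3) by (simp add: ring_distribs mult_single mult.commute)
qed

lemma F_algebra_free_algebra: "F_algebra (free_algebra :: ('f::field, ('g, 'f) free_alg) module)"
proof -
  have "\<exists>y. y + x = 0 \<and> x + y = 0" for x :: "('g, 'f) free_alg"
    by (rule exI[of _ "- x"]) simp
  then have "ring (free_algebra :: ('f, ('g, 'f) free_alg) module)"
    by unfold_locales (auto simp: free_algebra_def algebra_simps Units_def)
  moreover have scale_mult_left: "c \<bullet> x * y = c \<bullet> (x * y)" for x y :: "('g, 'f) free_alg" and c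
    by (simp only: scale_eq_mult mult.assoc)
  moreover have "x * (c \<bullet> y) = c \<bullet> (x * y)" for x y :: "('g, 'f) free_alg" and c
    by (metis scale_eq_mult mult.assoc mult_single_zero_commute)
  ultimately show ?thesis
    by (intro F_algebra.intro F_algebra_axioms.intro)
      (simp_all add: free_algebra_def fsupp.scale_left_distrib fsupp.scale_right_distrib
        scale_mult_left)
qed

definition relator_ideal ::
  "(('g, 'f::field) free_alg \<Rightarrow> ('g, 'f) free_alg \<Rightarrow> bool) \<Rightarrow> ('g, 'f) free_alg set" where
  "relator_ideal r = Idl\<^bsub>free_algebra\<^esub> {x - y | x y. r x y}"

definition presented_algebra ::
  "(('g, 'f::field) free_alg \<Rightarrow> ('g, 'f) free_alg \<Rightarrow> bool) \<Rightarrow> ('f, ('g, 'f) free_alg set) module" where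
  "presented_algebra r = alg_quot free_algebra (relator_ideal r)"

section \<open>The algebra \<open>\<A>\<^sub>q\<close>\<close>

text \<open>
  Every integer is either \<open>- k\<close> or \<open>k + 1\<close> for a unique natural number \<open>k\<close>, so the generators
  \<open>W\<^sub>-\<^sub>k\<close> and \<open>W\<^sub>k\<^sub>+\<^sub>1\<close> together are indexed by the integers. \<open>GenG k\<close> and \<open>GenGt k\<close> stand for the
  generators with index \<open>k + 1\<close>; the index \<open>0\<close> denotes a scalar, see below.
\<close>

datatype alt_gen = GenW int | GenG nat | GenGt nat

type_synonym 'f alt_free = "(alt_gen, 'f) free_alg"

definition q2 :: "'f::field \<Rightarrow> 'f" where
  "q2 q = q + inverse q"

definition comm :: "'f::field alt_free \<Rightarrow> 'f alt_free \<Rightarrow> 'f alt_free" where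
  "comm x y = x * y - y * x"

definition qcomm :: "'f::field \<Rightarrow> 'f alt_free \<Rightarrow> 'f alt_free \<Rightarrow> 'f alt_free" where
  "qcomm q x y = q \<bullet> (x * y) - inverse q \<bullet> (y * x)"

definition rho :: "'f::field \<Rightarrow> 'f" where
  "rho q = - ((q\<^sup>2 - inverse q ^ 2)\<^sup>2)"

definition W :: "int \<Rightarrow> 'f::field alt_free" where
  "W i = gen (GenW i)"

definition G :: "'f::field \<Rightarrow> nat \<Rightarrow> 'f alt_free" where
  "G q n = (case n of 0 \<Rightarrow> (- (q - inverse q) * (q2 q)\<^sup>2) \<bullet> 1 | Suc k \<Rightarrow> gen (GenG k))"

definition Gt :: "'f::field \<Rightarrow> nat \<Rightarrow> 'f alt_free" where
  "Gt q n = (case n of 0 \<Rightarrow> (- (q - inverse q) * (q2 q)\<^sup>2) \<bullet> 1 | Suc k \<Rightarrow> gen (GenGt k))"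

inductive alt_rel :: "'f::field \<Rightarrow> 'f alt_free \<Rightarrow> 'f alt_free \<Rightarrow> bool" for q :: 'f where
  "alt_rel q (comm (W 0) (W (int k + 1))) (inverse (q2 q) \<bullet> (Gt q (k+1) - G q (k+1)))"
| "alt_rel q (comm (W (- int k)) (W 1)) (inverse (q2 q) \<bullet> (Gt q (k+1) - G q (k+1)))"
| "alt_rel q (qcomm q (W 0) (G q (k+1))) (rho q \<bullet> W (- int k - 1) - rho q \<bullet> W (int k + 1))"
| "alt_rel q (qcomm q (Gt q (k+1)) (W 0)) (rho q \<bullet> W (- int k - 1) - rho q \<bullet> W (int k + 1))"
| "alt_rel q (qcomm q (G q (k+1)) (W 1)) (rho q \<bullet> W (int k + 2) - rho q \<bullet> W (- int k))"
| "alt_rel q (qcomm q (W 1) (Gt q (k+1))) (rho q \<bullet> W (int k + 2) - rho q \<bullet> W (- int k))"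
| "alt_rel q (comm (W (- int k)) (W (- int l))) 0"
| "alt_rel q (comm (W (int k + 1)) (W (int l + 1))) 0"
| "alt_rel q (comm (W (- int k)) (W (int l + 1)) + comm (W (int k + 1)) (W (- int l))) 0"
| "alt_rel q (comm (W (- int k)) (G q (l+1)) + comm (G q (k+1)) (W (- int l))) 0"
| "alt_rel q (comm (W (- int k)) (Gt q (l+1)) + comm (Gt q (k+1)) (W (- int l))) 0"
| "alt_rel q (comm (W (int k + 1)) (G q (l+1)) + comm (G q (k+1)) (W (int l + 1))) 0"
| "alt_rel q (comm (W (int k + 1)) (Gt q (l+1)) + comm (Gt q (k+1)) (W (int l + 1))) 0"
| "alt_rel q (comm (G q (k+1)) (G q (l+1))) 0"
| "alt_rel q (comm (Gt q (k+1)) (Gt q (l+1))) 0"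
| "alt_rel q (comm (Gt q (k+1)) (G q (l+1)) + comm (G q (k+1)) (Gt q (l+1))) 0"

definition Aq :: "'f::field \<Rightarrow> ('f, 'f alt_free set) module" where
  "Aq q = presented_algebra (alt_rel q)"

lemma F_algebra_Aq: "F_algebra (Aq q)"
proof -
  interpret F_algebra "free_algebra :: ('a, 'a alt_free) module"
    by (rule F_algebra_free_algebra)
  show ?thesis
    unfolding Aq_def presented_algebra_def relator_ideal_def
    by (intro F_algebra_alg_quot genideal_ideal) (simp add: free_algebra_def)
qed

definition to_Aq :: "'f::field \<Rightarrow> 'f alt_free \<Rightarrow> 'f alt_free set" where
  "to_Aq q x = relator_ideal (alt_rel q) +>\<^bsub>free_algebra\<^esub> x"

section \<open>The elements \<open>\<Z>\<^sub>n\<close>\<close>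

text \<open>
  The generating functions are written with coefficients in the free algebra; \<open>\<Z>\<^sub>n\<close> is then the
  image in \<open>\<A>\<^sub>q\<close> of the resulting coefficient. As the projection is an algebra homomorphism and
  each coefficient of the series below is a finite expression in the generators, this is the same
  as calculating in \<open>\<A>\<^sub>q[[t]]\<close>.
\<close>

definition S_series :: "'f::field \<Rightarrow> 'f fps" where
  "S_series q = Abs_fps (\<lambda>n. if odd n then q2 q * ((-1) ^ (n div 2) * inverse q ^ n) else 0)"

definition T_series :: "'f::field \<Rightarrow> 'f fps" where
  "T_series q = Abs_fps (\<lambda>n. if odd n then q2 q * ((-1) ^ (n div 2) * q ^ n) else 0)"

lemma S_series_eq:
  assumes "q \<noteq> 0"
  shows "(fps_const (inverse q) * fps_X\<^sup>2 + fps_const q) * S_series q = fps_const (q2 q) * fps_X"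
proof (rule fps_ext)
  fix n :: nat
  have "n = 0 \<or> n = 1 \<or> (\<exists>m. n = m + 2)"
    by presburger
  then consider "n = 0" | "n = 1" | m where "n = m + 2"
    by blast
  then show "fps_nth ((fps_const (inverse q) * fps_X\<^sup>2 + fps_const q) * S_series q) n
      = fps_nth (fps_const (q2 q) * fps_X) n"
    using assms
    by cases (simp_all add: S_series_def ring_distribs mult.assoc fps_X_power_mult_nth)
qed

lemma T_series_eq:
  assumes "q \<noteq> 0"
  shows "(fps_const q * fps_X\<^sup>2 + fps_const (inverse q)) * T_series q = fps_const (q2 q) * fps_X"
proof (rule fps_ext)
  fix n :: nat
  have "n = 0 \<or> n = 1 \<or> (\<exists>m. n = m + 2)"
    by presburger
  then consider "n = 0" | "n = 1" | m where "n = m + 2"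
    by blast
  then show "fps_nth ((fps_const q * fps_X\<^sup>2 + fps_const (inverse q)) * T_series q) n
      = fps_nth (fps_const (q2 q) * fps_X) n"
    using assms
    by cases (simp_all add: T_series_def ring_distribs mult.assoc fps_X_power_mult_nth)
qed

definition scalar_fps :: "'f::field fps \<Rightarrow> 'f alt_free fps" where
  "scalar_fps f = Abs_fps (\<lambda>n. fps_nth f n \<bullet> 1)"

definition Wminus_series :: "'f::field alt_free fps" where
  "Wminus_series = Abs_fps (\<lambda>n. W (- int n))"

definition Wplus_series :: "'f::field alt_free fps" where
  "Wplus_series = Abs_fps (\<lambda>n. W (int n + 1))"

definition G_series :: "'f::field \<Rightarrow> 'f alt_free fps" where
  "G_series q = Abs_fps (G q)"

definition Gt_series :: "'f::field \<Rightarrow> 'f alt_free fps" where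
  "Gt_series q = Abs_fps (Gt q)"

text \<open>
  \<open>S\<close> and \<open>T\<close> have no constant term. Hence the compositions are legitimate, and
  \<open>fps_shift 1 (S * T)\<close> is \<open>t\<^sup>-\<^sup>1 S T\<close>.
\<close>

definition Z_series :: "'f::field \<Rightarrow> 'f alt_free fps" where
  "Z_series q =
     (let S = scalar_fps (S_series q); T = scalar_fps (T_series q);
          sc = (\<lambda>c. fps_const (c \<bullet> (1 :: 'f alt_free)))
      in fps_shift 1 (S * T) * (Wminus_series oo S) * (Wplus_series oo T)
         + fps_X * S * T * (Wplus_series oo S) * (Wminus_series oo T)
         - sc (q\<^sup>2) * S * T * (Wminus_series oo S) * (Wminus_series oo T)
         - sc (inverse q ^ 2) * S * T * (Wplus_series oo S) * (Wplus_series oo T)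
         + sc (inverse ((q\<^sup>2 - inverse q ^ 2)\<^sup>2)) * (G_series q oo S) * (Gt_series q oo T))"

definition Z_elem :: "'f::field \<Rightarrow> nat \<Rightarrow> 'f alt_free set" where
  "Z_elem q n = to_Aq q (inverse (q2 q ^ n) \<bullet> fps_nth (Z_series q) n)"

definition W01_alg :: "'f::field \<Rightarrow> ('f, 'f alt_free set) module" where
  "W01_alg q = subalg_generated (Aq q) {to_Aq q (W 0), to_Aq q (W 1)}"

definition Z_alg :: "'f::field \<Rightarrow> ('f, 'f alt_free set) module" where
  "Z_alg q = subalg_generated (Aq q) {Z_elem q n | n. n \<ge> 1}"

end

theory Submission
  imports Defs "HOL-Computational_Algebra.Formal_Laurent_Series"
begin

text \<open>
  Let \<open>W\<^sup>-(t)\<close>, \<open>W\<^sup>+(t)\<close>, \<open>G(t)\<close>, \<open>Gt(t)\<close> be the generating functions (the currents), and write \<open>w\<close>, \<open>v\<close>,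
  \<open>g\<close>, \<open>h\<close> for them. Three things have to be shown: the elements \<open>Z\<^sub>n\<close> are central, so that the
  multiplication map is an algebra homomorphism; together with \<open>W\<^sub>0\<close> and \<open>W\<^sub>1\<close> they generate, so that it is
  surjective; and it is injective.

  \<^emph>\<open>Injectivity.\<close> Every defining relation is bilinear in the currents, or linear in the currents with
  \<open>W\<^sub>0\<close> and \<open>W\<^sub>1\<close> as coefficients. Hence all four currents may be multiplied by the same scalar series
  \<open>\<phi>(t)\<close> with \<open>\<phi>(0) = 1\<close>: this defines an endomorphism that fixes \<open>W\<^sub>0\<close> and \<open>W\<^sub>1\<close> and multiplies
  \<open>Z(t)\<close> by \<open>\<phi>(S) \<phi>(T)\<close>. For \<open>\<phi>(t) = 1 + c t\<^sup>n\<close> it fixes \<open>Z\<^sub>1\<close>, ..., \<open>Z\<^sub>n\<^sub>-\<^sub>1\<close> and translates \<open>Z\<^sub>n\<close> by a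
  nonzero multiple of the scalar \<open>c\<close> (\<open>\<sigma>_Z\<close>). As \<open>q\<close> is not a root of unity, there are infinitely many
  such \<open>c\<close>, and a polynomial in \<open>Z\<^sub>n\<close> with coefficients fixed by all these endomorphisms vanishes only if
  its coefficients do (\<open>transcendental\<close>). By induction on \<open>n\<close>, elements of \<open>\<langle>W\<^sub>0, W\<^sub>1\<rangle>\<close> that are linearly
  independent over the field stay independent over the subalgebra generated by the \<open>Z\<^sub>n\<close>
  (\<open>independent_over_ZA\<close>). This is injectivity, since every tensor is a sum \<open>\<Sum> \<beta>\<^sub>i \<otimes> \<zeta>\<^sub>i\<close> with linearly
  independent \<open>\<beta>\<^sub>i\<close> (\<open>\<mu>_kernel\<close>).

  \<^emph>\<open>Surjectivity.\<close> Up to letters of smaller index, \<open>Z\<^sub>n\<close> is a multiple of \<open>q\<^sup>-\<^sup>n G\<^sub>n + q\<^sup>n Gt\<^sub>n\<close>, whereas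
  \<open>Gt\<^sub>n - G\<^sub>n\<close> is a multiple of \<open>[W\<^sub>0, W\<^sub>n]\<close>. As \<open>q\<^sup>n + q\<^sup>-\<^sup>n \<noteq> 0\<close>, this gives \<open>G\<^sub>n\<close> and \<open>Gt\<^sub>n\<close>, and then
  the relations of \<open>W\<^sub>0\<close>, \<open>W\<^sub>1\<close> with \<open>G\<^sub>n\<close> give \<open>W\<^sub>-\<^sub>n\<close> and \<open>W\<^sub>n\<^sub>+\<^sub>1\<close> (\<open>W01_Z_generate\<close>).

  \<^emph>\<open>Centrality.\<close> Moving \<open>W\<^sub>0\<close> or \<open>W\<^sub>1\<close> through the bilinear relations at two parameters yields exchange
  relations such as \<open>bracket_w_g\<close>, \<open>bracket_w_v\<close> and \<open>bracket_h_g\<close>. The series \<open>Z(t)\<close> is the quantum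
  determinant of the matrix of currents: at the parameters \<open>S\<close> and \<open>T\<close> the exchange relations degenerate,
  and \<open>Z(t)\<close> is a product of two combinations of \<open>w\<close> and \<open>v\<close> plus a multiple of \<open>g(S) h(T)\<close>. A
  calculation shows that it commutes with \<open>W\<^sub>0\<close>, \<open>W\<^sub>1\<close> and with \<open>g(r)\<close> for every parameter \<open>r\<close>
  (\<open>W0_Z\<close>, \<open>W1_Z\<close>, \<open>g_Z\<close>), and these elements generate.

  The calculations take place in a ring that is a type. The algebra depends on the value \<open>q\<close>, so it is
  not a type by itself; but the direct product of the algebras for all values of \<open>q\<close> is one
  (\<open>Aq_prod\<close>), and it contains each of them as a direct factor. Parameters are Laurent series over the
  field, and the currents at a parameter are Laurent series over the product ring, which is an
  algebra over the field of parameters; so one may divide by differences of parameters.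
\<close>

unbundle fps_syntax

section \<open>Exchange relations of the currents\<close>

text \<open>
  An associative unital algebra over a field whose underlying set is a whole type.
\<close>

locale typed_algebra = vector_space scale
  for scale :: "'k::field \<Rightarrow> 'r::ring_1 \<Rightarrow> 'r"  (infixr \<open>*s\<close> 75) +
  assumes mult_scale_left [simp]: "(c *s x) * y = c *s (x * y)"
    and mult_scale_right [simp]: "x * (c *s y) = c *s (x * y)"
begin
lemmas expand = scale_left_distrib scale_right_distrib scale_left_diff_distrib scale_right_diff_distrib ring_distribs mult.assoc
end

abbreviation bracket :: "'r::ring \<Rightarrow> 'r \<Rightarrow> 'r" where "bracket x y \<equiv> x * y - y * x"

text \<open>
  The currents \<open>w\<close>, \<open>v\<close>, \<open>g\<close>, \<open>h\<close> evaluated at parameters from a set \<open>P\<close> of scalars. The abbreviations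
  \<open>b\<close>, \<open>d\<close>, \<open>\<rho>\<close> of \<open>q + q\<^sup>-\<^sup>1\<close>, \<open>q - q\<^sup>-\<^sup>1\<close>, \<open>- (q\<^sup>2 - q\<^sup>-\<^sup>2)\<^sup>2\<close> are parameters of the locale, so that rewriting
  does not unfold them. The relations with \<open>W0\<close> and \<open>W1\<close> are oriented such that \<open>W0\<close> and \<open>W1\<close> move to
  the right.
\<close>

locale currents = typed_algebra scale
  for scale :: "'k::field \<Rightarrow> 'r::ring_1 \<Rightarrow> 'r"  (infixr \<open>*s\<close> 75) +
  fixes P :: "'k set" and q b d \<rho> :: 'k and W0 W1 :: 'r and w v g h :: "'k \<Rightarrow> 'r"
  assumes q: "q \<noteq> 0" and b0: "b \<noteq> 0" and d0: "d \<noteq> 0" and b: "b = q + 1 / q" and d: "d = q - 1 / q"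
    and \<rho>: "\<rho> = - ((b * d)\<^sup>2)" and P0: "0 \<notin> P"
    and W0_w: "s \<in> P \<Longrightarrow> W0 * w s = w s * W0"
    and W1_v: "s \<in> P \<Longrightarrow> W1 * v s = v s * W1"
    and W0_v: "s \<in> P \<Longrightarrow> W0 * v s = v s * W0 + (1 / (s * b)) *s (h s - g s)"
    and W1_w: "s \<in> P \<Longrightarrow> W1 * w s = w s * W1 + (1 / (s * b)) *s (g s - h s)"
    and W0_g: "s \<in> P \<Longrightarrow> W0 * g s = (1 / q\<^sup>2) *s (g s * W0) + (\<rho> / q) *s (w s - s *s v s)"
    and W0_h: "s \<in> P \<Longrightarrow> W0 * h s = q\<^sup>2 *s (h s * W0) - (\<rho> * q) *s (w s - s *s v s)"
    and W1_g: "s \<in> P \<Longrightarrow> W1 * g s = q\<^sup>2 *s (g s * W1) - (\<rho> * q) *s (v s - s *s w s)"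
    and W1_h: "s \<in> P \<Longrightarrow> W1 * h s = (1 / q\<^sup>2) *s (h s * W1) + (\<rho> / q) *s (v s - s *s w s)"
    and ww: "s \<in> P \<Longrightarrow> t \<in> P \<Longrightarrow> w s * w t = w t * w s"
    and vv: "s \<in> P \<Longrightarrow> t \<in> P \<Longrightarrow> v s * v t = v t * v s"
    and gg: "s \<in> P \<Longrightarrow> t \<in> P \<Longrightarrow> g s * g t = g t * g s"
    and hh: "s \<in> P \<Longrightarrow> t \<in> P \<Longrightarrow> h s * h t = h t * h s"
    and wv: "s \<in> P \<Longrightarrow> t \<in> P \<Longrightarrow> bracket (w s) (v t) = bracket (w t) (v s)"
    and hg: "s \<in> P \<Longrightarrow> t \<in> P \<Longrightarrow> bracket (h s) (g t) = bracket (h t) (g s)"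
    and wg: "s \<in> P \<Longrightarrow> t \<in> P \<Longrightarrow> s *s bracket (w s) (g t) = t *s bracket (w t) (g s)"
    and wh: "s \<in> P \<Longrightarrow> t \<in> P \<Longrightarrow> s *s bracket (w s) (h t) = t *s bracket (w t) (h s)"
    and vg: "s \<in> P \<Longrightarrow> t \<in> P \<Longrightarrow> s *s bracket (v s) (g t) = t *s bracket (v t) (g s)"
    and vh: "s \<in> P \<Longrightarrow> t \<in> P \<Longrightarrow> s *s bracket (v s) (h t) = t *s bracket (v t) (h s)"
begin

text \<open>
  The relations have an automorphism that exchanges \<open>W\<^sub>-\<^sub>k\<close> with \<open>W\<^sub>k\<^sub>+\<^sub>1\<close> and \<open>G\<^sub>k\<close> with \<open>Gt\<^sub>k\<close>. It halves
  the number of degenerate relations that have to be calculated.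
\<close>

lemma currents_swapped: "currents scale P q b d \<rho> W1 W0 v w h g"
  apply unfold_locales
  using q b0 d0 b d \<rho> P0 W0_w W1_v W0_v W1_w W0_g W0_h W1_g W1_h ww vv gg hh wv hg wg wh vg vh
                      apply (simp_all)
  apply (metis minus_diff_eq)+
  done

definition u where "u s = w s - s *s v s"
definition y where "y s = v s - s *s w s"

lemma \<rho>0: "\<rho> \<noteq> 0" using b0 d0 \<rho> by simp

lemma W0_gg: assumes "s \<in> P" "t \<in> P"
  shows "W0 * (g s * g t) = (1 / q^4) *s (g s * g t * W0) + (\<rho> / q^3) *s (g s * u t) + (\<rho> / q) *s (u s * g t)"
proof -
  have "W0 * (g s * g t) = (W0 * g s) * g t" by (simp add: mult.assoc)
  also have "\<dots> = (1 / q\<^sup>2) *s (g s * (W0 * g t)) + (\<rho> / q) *s (u s * g t)"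
    using assms by (simp add: W0_g u_def[symmetric] expand)
  also have "\<dots> = (1 / q^4) *s (g s * g t * W0) + (\<rho> / q^3) *s (g s * u t) + (\<rho> / q) *s (u s * g t)"
    using assms q by (simp add: W0_g u_def[symmetric] expand) (simp add: power_def numeral_eq_Suc mult_ac)
  finally show ?thesis .
qed

text \<open>
  As \<open>g s\<close> and \<open>g t\<close> commute, moving \<open>W0\<close> past both of them has the same result for either order. Here
  \<open>u s\<close> is the correction term of the relation between \<open>W0\<close> and \<open>g s\<close>, up to the factor \<open>\<rho>\<close>.
\<close>

lemma u_sym: assumes "s \<in> P" "t \<in> P"
  shows "q\<^sup>2 *s (u t * g s - u s * g t) = g s * u t - g t * u s"
proof -
  have "(\<rho> / q^3) *s (g s * u t) + (\<rho> / q) *s (u s * g t) = (\<rho> / q^3) *s (g t * u s) + (\<rho> / q) *s (u t * g s)"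
    using W0_gg[OF assms] W0_gg[OF assms(2,1)] gg[OF assms] by simp
  then have "(q^3/\<rho>) *s ((\<rho> / q^3) *s (g s * u t) + (\<rho> / q) *s (u s * g t)) = (q^3/\<rho>) *s ((\<rho> / q^3) *s (g t * u s) + (\<rho> / q) *s (u t * g s))" by simp
  then have "g s * u t + q\<^sup>2 *s (u s * g t) = g t * u s + q\<^sup>2 *s (u t * g s)"
    using q \<rho>0 by (simp add: expand) (simp add: power_def numeral_eq_Suc mult_ac)
  then show ?thesis by (simp add: expand algebra_simps)
qed

lemma W1_gg: assumes "s \<in> P" "t \<in> P"
  shows "W1 * (g s * g t) = q^4 *s (g s * g t * W1) - (\<rho> * q^3) *s (g s * y t) - (\<rho> * q) *s (y s * g t)"
proof -
  have "W1 * (g s * g t) = (W1 * g s) * g t" by (simp add: mult.assoc)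
  also have "\<dots> = q\<^sup>2 *s (g s * (W1 * g t)) - (\<rho> * q) *s (y s * g t)"
    using assms by (simp add: W1_g y_def[symmetric] expand)
  also have "\<dots> = q^4 *s (g s * g t * W1) - (\<rho> * q^3) *s (g s * y t) - (\<rho> * q) *s (y s * g t)"
    using assms q by (simp add: W1_g y_def[symmetric] expand) (simp add: power_def numeral_eq_Suc mult_ac)
  finally show ?thesis .
qed

text \<open>
  The same argument with \<open>W1\<close>, whose correction term is \<open>y\<close>.
\<close>

lemma y_sym: assumes "s \<in> P" "t \<in> P"
  shows "q\<^sup>2 *s (g s * y t - g t * y s) = y t * g s - y s * g t"
proof -
  have "(\<rho> * q^3) *s (g s * y t) + (\<rho> * q) *s (y s * g t) = (\<rho> * q^3) *s (g t * y s) + (\<rho> * q) *s (y t * g s)"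
    using W1_gg[OF assms] W1_gg[OF assms(2,1)] gg[OF assms] by (simp add: algebra_simps)
  then have "(1/(\<rho> * q)) *s ((\<rho> * q^3) *s (g s * y t) + (\<rho> * q) *s (y s * g t)) = (1/(\<rho> * q)) *s ((\<rho> * q^3) *s (g t * y s) + (\<rho> * q) *s (y t * g s))" by simp
  then have "q\<^sup>2 *s (g s * y t) + y s * g t = q\<^sup>2 *s (g t * y s) + y t * g s"
    using q \<rho>0 by (simp add: expand) (simp add: power_def numeral_eq_Suc mult_ac)
  then show ?thesis by (simp add: expand algebra_simps)
qed

lemma qd: "q * d = q\<^sup>2 - 1"
  using q by (simp add: d field_simps power2_eq_square)

lemma nonzero: "s \<in> P \<Longrightarrow> s \<noteq> 0" using P0 by auto

text \<open>
  In the difference of the two sides of \<open>u_sym\<close> the brackets of \<open>v\<close> with \<open>g\<close> cancel by \<open>vg\<close>, and the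
  brackets of \<open>w\<close> with \<open>g\<close> are proportional by \<open>wg\<close>; so the relation can be solved for them. The variant
  below has \<open>g\<close> on the left.
\<close>

lemma bracket_w_g:
  assumes "s \<in> P" "t \<in> P" "s \<noteq> t"
  shows "bracket (w s) (g t) = (q * d * t / (t - s)) *s (u t * g s - u s * g t)"
proof -
  have "(q\<^sup>2 - 1) *s (u t * g s - u s * g t) = bracket (u s) (g t) - bracket (u t) (g s)"
    using u_sym[OF assms(1,2)] by (simp add: scale_left_diff_distrib)
  also have "\<dots> = bracket (w s) (g t) - bracket (w t) (g s) - (s *s bracket (v s) (g t) - t *s bracket (v t) (g s))"
    by (simp add: u_def expand)
  also have "\<dots> = bracket (w s) (g t) - bracket (w t) (g s)"
    using vg[OF assms(1,2)] by simp
  also have "bracket (w t) (g s) = (s / t) *s bracket (w s) (g t)"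
  proof -
    have "(1 / t) *s t *s bracket (w t) (g s) = (1 / t) *s s *s bracket (w s) (g t)"
      using wg[OF assms(1,2)] by simp
    then show ?thesis using nonzero[OF assms(2)] by simp
  qed
  also have "bracket (w s) (g t) - (s / t) *s bracket (w s) (g t) = ((t - s) / t) *s bracket (w s) (g t)"
    using nonzero[OF assms(2)] by (simp add: diff_divide_distrib scale_left_diff_distrib)
  finally have "(t / (t - s)) *s (q\<^sup>2 - 1) *s (u t * g s - u s * g t) = (t / (t - s)) *s ((t - s) / t) *s bracket (w s) (g t)"
    by simp
  then show ?thesis using assms nonzero[OF assms(2)] by (simp add: qd[symmetric] mult_ac)
qed

lemma bracket_w_g':
  assumes "s \<in> P" "t \<in> P" "s \<noteq> t"
  shows "bracket (w s) (g t) = (d * t / (q * (t - s))) *s (g s * u t - g t * u s)"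
  unfolding bracket_w_g[OF assms] u_sym[OF assms(1,2), symmetric] using q by (simp add: power2_eq_square)

lemma bracket_v_g:
  assumes "s \<in> P" "t \<in> P" "s \<noteq> t"
  shows "bracket (v s) (g t) = (q * d * t / (s - t)) *s (g s * y t - g t * y s)"
proof -
  have "(q\<^sup>2 - 1) *s (g s * y t - g t * y s) = bracket (y t) (g s) - bracket (y s) (g t)"
    using y_sym[OF assms(1,2)] by (simp add: scale_left_diff_distrib)
  also have "\<dots> = bracket (v t) (g s) - bracket (v s) (g t) + (s *s bracket (w s) (g t) - t *s bracket (w t) (g s))"
    by (simp add: y_def expand)
  also have "\<dots> = bracket (v t) (g s) - bracket (v s) (g t)"
    using wg[OF assms(1,2)] by simp
  also have "bracket (v t) (g s) = (s / t) *s bracket (v s) (g t)"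
  proof -
    have "(1 / t) *s t *s bracket (v t) (g s) = (1 / t) *s s *s bracket (v s) (g t)"
      using vg[OF assms(1,2)] by simp
    then show ?thesis using nonzero[OF assms(2)] by simp
  qed
  also have "(s / t) *s bracket (v s) (g t) - bracket (v s) (g t) = ((s - t) / t) *s bracket (v s) (g t)"
    using nonzero[OF assms(2)] by (simp add: diff_divide_distrib scale_left_diff_distrib)
  finally have "(t / (s - t)) *s (q\<^sup>2 - 1) *s (g s * y t - g t * y s) = (t / (s - t)) *s ((s - t) / t) *s bracket (v s) (g t)"
    by simp
  then show ?thesis using assms nonzero[OF assms(2)] by (simp add: qd[symmetric] mult_ac)
qed

lemma bracket_v_g':
  assumes "s \<in> P" "t \<in> P" "s \<noteq> t"
  shows "bracket (v s) (g t) = (d * t / (q * (s - t))) *s (y t * g s - y s * g t)"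
  unfolding bracket_v_g[OF assms] y_sym[OF assms(1,2), symmetric] using q by (simp add: power2_eq_square)

lemma W1_wg: assumes "s \<in> P" "t \<in> P"
  shows "W1 * (s *s bracket (w s) (g t)) = q\<^sup>2 *s (s *s bracket (w s) (g t)) * W1
    - (\<rho> * q * s) *s bracket (w s) (y t) + (1 / b) *s ((g s - h s) * g t - q\<^sup>2 *s (g t * (g s - h s)))"
proof -
  have "W1 * (w s * g t) = (W1 * w s) * g t" by (simp add: mult.assoc)
  also have "\<dots> = w s * (W1 * g t) + (1 / (s * b)) *s ((g s - h s) * g t)"
    using assms by (simp add: W1_w expand)
  also have "\<dots> = q\<^sup>2 *s (w s * g t * W1) - (\<rho> * q) *s (w s * y t) + (1 / (s * b)) *s ((g s - h s) * g t)"
    using assms by (simp add: W1_g y_def[symmetric] expand)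
  finally have 1: "W1 * (w s * g t) = \<dots>" .
  have "W1 * (g t * w s) = (W1 * g t) * w s" by (simp add: mult.assoc)
  also have "\<dots> = q\<^sup>2 *s (g t * (W1 * w s)) - (\<rho> * q) *s (y t * w s)"
    using assms by (simp add: W1_g y_def[symmetric] expand)
  also have "\<dots> = q\<^sup>2 *s (g t * w s * W1) + (q\<^sup>2 / (s * b)) *s (g t * (g s - h s)) - (\<rho> * q) *s (y t * w s)"
    using assms by (simp add: W1_w expand)
  finally have 2: "W1 * (g t * w s) = \<dots>" .
  show ?thesis
    using nonzero[OF assms(1)] by (simp add: right_diff_distrib 1 2 expand) (simp add: algebra_simps)
qed

text \<open>
  This results from moving \<open>W1\<close> through the relation \<open>wg\<close>: modulo multiples of \<open>wg\<close> itself, what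
  remains of either side is a bracket of \<open>w\<close> with \<open>v\<close> and words in \<open>g\<close> and \<open>h\<close>.
\<close>

lemma bracket_w_v:
  assumes "s \<in> P" "t \<in> P" "s \<noteq> t"
  shows "bracket (w s) (v t) = (d / (\<rho> * b * (s - t))) *s (g t * h s - g s * h t)"
proof -
  define X where "X = bracket (w s) (v t)"
  have X': "bracket (w t) (v s) = X" using wv assms by (simp add: X_def)
  have aux: "x - A + B = x - A' + B' \<Longrightarrow> A - B = A' - B'" for x A B A' B' :: 'r
    by (simp add: algebra_simps)
  have "(\<rho> * q * s) *s bracket (w s) (y t) - (1 / b) *s ((g s - h s) * g t - q\<^sup>2 *s (g t * (g s - h s)))
      = (\<rho> * q * t) *s bracket (w t) (y s) - (1 / b) *s ((g t - h t) * g s - q\<^sup>2 *s (g s * (g t - h t)))"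
    by (rule aux[OF trans[OF W1_wg[OF assms(1,2), unfolded wg[OF assms(1,2)], symmetric] W1_wg[OF assms(2,1)]]])
  moreover have "bracket (w s) (y t) = X"
    using ww[OF assms(1,2)] by (simp add: X_def y_def expand)
  moreover have "bracket (w t) (y s) = X"
    using ww[OF assms(1,2)] by (simp add: X'[symmetric] y_def expand)
  ultimately have "(\<rho> * q * (s - t)) *s X = (1 / b) *s ((g s - h s) * g t - q\<^sup>2 *s (g t * (g s - h s)) - ((g t - h t) * g s - q\<^sup>2 *s (g s * (g t - h t))))"
    by (simp add: algebra_simps)
  also have "(g s - h s) * g t - q\<^sup>2 *s (g t * (g s - h s)) - ((g t - h t) * g s - q\<^sup>2 *s (g s * (g t - h t)))
     = (q\<^sup>2 - 1) *s (g t * h s - g s * h t) - (bracket (h s) (g t) - bracket (h t) (g s))"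
    using gg[OF assms(1,2)] by (simp add: algebra_simps)
  also have "\<dots> = (q\<^sup>2 - 1) *s (g t * h s - g s * h t)" using hg[OF assms(1,2)] by simp
  finally have "(1 / (\<rho> * q * (s - t))) *s (\<rho> * q * (s - t)) *s X = (1 / (\<rho> * q * (s - t))) *s (1 / b) *s (q\<^sup>2 - 1) *s (g t * h s - g s * h t)" by simp
  then show ?thesis unfolding X_def using \<rho>0 q assms(3) by (simp add: qd[symmetric] mult_ac)
qed

lemma bracket_u_y:
  assumes "s \<in> P" "t \<in> P"
  shows "bracket (u s) (y t) = (1 - s * t) *s bracket (w s) (v t)"
proof -
  have "bracket (u s) (y t) = bracket (w s) (v t) - (s * t) *s bracket (w t) (v s)
     - t *s bracket (w s) (w t) - s *s bracket (v s) (v t)"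
    by (simp add: u_def y_def algebra_simps)
  also have "\<dots> = bracket (w s) (v t) - (s * t) *s bracket (w s) (v t)"
    using wv[OF assms] ww[OF assms] vv[OF assms] by simp
  finally show ?thesis by (simp add: algebra_simps)
qed

lemma W1_ug: assumes "s \<in> P" "t \<in> P"
  shows "W1 * (u s * g t) = q\<^sup>2 *s (u s * g t * W1) - (\<rho> * q) *s (u s * y t) + (1 / (s * b)) *s ((g s - h s) * g t)"
    and "W1 * (g t * u s) = q\<^sup>2 *s (g t * u s * W1) + (q\<^sup>2 / (s * b)) *s (g t * (g s - h s)) - (\<rho> * q) *s (y t * u s)"
proof -
  have W1_u: "W1 * u s = u s * W1 + (1 / (s * b)) *s (g s - h s)"
    using assms by (simp add: u_def W1_w W1_v algebra_simps)
  have "W1 * (u s * g t) = (W1 * u s) * g t" by (simp add: mult.assoc)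
  also have "\<dots> = u s * (W1 * g t) + (1 / (s * b)) *s ((g s - h s) * g t)"
    using assms by (simp add: W1_u expand)
  also have "\<dots> = q\<^sup>2 *s (u s * g t * W1) - (\<rho> * q) *s (u s * y t) + (1 / (s * b)) *s ((g s - h s) * g t)"
    using assms by (simp add: W1_g y_def[symmetric] expand)
  finally show "W1 * (u s * g t) = \<dots>" .
  have "W1 * (g t * u s) = (W1 * g t) * u s" by (simp add: mult.assoc)
  also have "\<dots> = q\<^sup>2 *s (g t * (W1 * u s)) - (\<rho> * q) *s (y t * u s)"
    using assms by (simp add: W1_g y_def[symmetric] expand)
  also have "\<dots> = q\<^sup>2 *s (g t * u s * W1) + (q\<^sup>2 / (s * b)) *s (g t * (g s - h s)) - (\<rho> * q) *s (y t * u s)"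
    using assms by (simp add: W1_u expand)
  finally show "W1 * (g t * u s) = \<dots>" .
qed

text \<open>
  This results from moving \<open>W1\<close> through \<open>u_sym\<close>. It expresses the brackets of \<open>h\<close> with \<open>g\<close> by words in \<open>w\<close>
  and \<open>v\<close>, and completes the list of exchange relations.
\<close>

lemma bracket_h_g:
  assumes "s \<in> P" "t \<in> P" "s \<noteq> t"
  shows "u s * y t - y s * u t = ((s - t) / (\<rho> * b * d * s * t)) *s bracket (h t) (g s)
    + (1 - s * t) *s bracket (w s) (v t)"
proof -
  define H where "H = bracket (h t) (g s)"
  have H': "bracket (h s) (g t) = H" using hg assms by (simp add: H_def)
  have hs: "h s * g t = g t * h s + H" and ht: "h t * g s = g s * h t + H"
    by (simp add: H'[symmetric], simp add: H_def)
  have uy: "bracket (u t) (y s) = bracket (u s) (y t)"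
    using bracket_u_y[OF assms(1,2)] bracket_u_y[OF assms(2,1)] wv[OF assms(1,2)] by (simp add: mult.commute)
  have "W1 * (q\<^sup>2 *s (u t * g s - u s * g t)) = W1 * (g s * u t - g t * u s)"
    using u_sym[OF assms(1,2)] by simp
  then have "q\<^sup>2 *s ((1 / (t * b)) *s ((g t - h t) * g s) - (\<rho> * q) *s (u t * y s)
      - ((1 / (s * b)) *s ((g s - h s) * g t) - (\<rho> * q) *s (u s * y t)))
     + q\<^sup>2 *s (q\<^sup>2 *s (u t * g s - u s * g t) * W1)
    = (q\<^sup>2 / (t * b)) *s (g s * (g t - h t)) - (\<rho> * q) *s (y s * u t)
      - ((q\<^sup>2 / (s * b)) *s (g t * (g s - h s)) - (\<rho> * q) *s (y t * u s))
     + q\<^sup>2 *s ((g s * u t - g t * u s) * W1)"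
    using W1_ug[OF assms(1,2)] W1_ug[OF assms(2,1)] by (simp add: algebra_simps)
  then have "q\<^sup>2 *s ((1 / (t * b)) *s ((g t - h t) * g s) - (\<rho> * q) *s (u t * y s)
      - ((1 / (s * b)) *s ((g s - h s) * g t) - (\<rho> * q) *s (u s * y t)))
    = (q\<^sup>2 / (t * b)) *s (g s * (g t - h t)) - (\<rho> * q) *s (y s * u t)
      - ((q\<^sup>2 / (s * b)) *s (g t * (g s - h s)) - (\<rho> * q) *s (y t * u s))"
    using u_sym[OF assms(1,2)] by simp
  then have "(q\<^sup>2 / (s * b)) *s H - (q\<^sup>2 / (t * b)) *s H
      = (\<rho> * q * q\<^sup>2) *s (u t * y s - u s * y t) - (\<rho> * q) *s (y s * u t - y t * u s)"
    using gg[OF assms(1,2)] hs ht by (simp add: algebra_simps)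
  also have "y s * u t - y t * u s = u t * y s - u s * y t" using uy by (simp add: algebra_simps)
  finally have "(q\<^sup>2 / (s * b) - q\<^sup>2 / (t * b)) *s H = (\<rho> * q * (q * d)) *s (u t * y s - u s * y t)"
    unfolding qd by (simp add: algebra_simps)
  then have "(1 / (\<rho> * q * (q * d))) *s (q\<^sup>2 / (s * b) - q\<^sup>2 / (t * b)) *s H =
      (1 / (\<rho> * q * (q * d))) *s (\<rho> * q * (q * d)) *s (u t * y s - u s * y t)" by simp
  then have "u t * y s - u s * y t = ((1 / (\<rho> * q * (q * d))) * (q\<^sup>2 / (s * b) - q\<^sup>2 / (t * b))) *s H"
    using \<rho>0 q d0 by simp
  also have "(1 / (\<rho> * q * (q * d))) * (q\<^sup>2 / (s * b) - q\<^sup>2 / (t * b)) = - ((s - t) / (\<rho> * b * d * s * t))"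
    using \<rho>0 q d0 b0 nonzero[OF assms(1)] nonzero[OF assms(2)] by (simp add: field_simps power2_eq_square)
  finally have "u s * y t - u t * y s = ((s - t) / (\<rho> * b * d * s * t)) *s H" by (simp add: algebra_simps)
  moreover have "u t * y s - y s * u t = (1 - s * t) *s bracket (w s) (v t)"
    using uy bracket_u_y[OF assms(1,2)] by simp
  ultimately show ?thesis by (simp add: H_def[symmetric] algebra_simps)
qed

end

text \<open>
  The parameters \<open>S\<close> and \<open>T\<close> are \<open>(q + q\<^sup>-\<^sup>1) / (q\<^sup>-\<^sup>1 t + q t\<^sup>-\<^sup>1)\<close> and \<open>(q + q\<^sup>-\<^sup>1) / (q t + q\<^sup>-\<^sup>1 t\<^sup>-\<^sup>1)\<close>.
\<close>

locale determinant = currents +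
  fixes t S T
  assumes t0: "t \<noteq> 0" and t1: "t\<^sup>2 \<noteq> 1" and S: "S \<in> P" and T: "T \<in> P"
    and S_eq: "S * (t\<^sup>2 / q + q) = b * t" and T_eq: "T * (q * t\<^sup>2 + 1 / q) = b * t"
begin

text \<open>
  The terms of \<open>Z(t)\<close> in \<open>w\<close> and \<open>v\<close> form a product \<open>t P(S) Q(T)\<close>.
\<close>

definition PS where "PS = S *s ((1 / t) *s w S - (1 / q\<^sup>2) *s v S)"
definition QT where "QT = T *s ((1 / t) *s v T - q\<^sup>2 *s w T)"
definition Z where "Z = t *s (PS * QT) - (1 / \<rho>) *s (g S * h T)"
text \<open>
  This is \<open>- d S T / (q (S - T))\<close>, the coefficient in the exchange relations at \<open>S\<close> and \<open>T\<close>. In this form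
  it gives the coefficients of \<open>PS_g\<close> a common factor.
\<close>

definition \<alpha> where "\<alpha> = (q\<^sup>2 + 1) * t / (q\<^sup>2 * (1 - t\<^sup>2))"

lemma t1': "1 - t\<^sup>2 \<noteq> 0" using t1 by simp
lemma ST0: "S \<noteq> 0" "T \<noteq> 0" using S T P0 by auto

lemma bq: "b * q = q\<^sup>2 + 1" using q by (simp add: b field_simps power2_eq_square)

lemma S_eq': "S * (t\<^sup>2 + q\<^sup>2) = (q\<^sup>2 + 1) * t"
proof -
  have "S * (t\<^sup>2 + q\<^sup>2) = q * (S * (t\<^sup>2 / q + q))" using q by (simp add: field_simps power2_eq_square)
  then show ?thesis unfolding S_eq bq[symmetric] by simp
qed
lemma T_eq': "T * (q\<^sup>2 * t\<^sup>2 + 1) = (q\<^sup>2 + 1) * t"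
proof -
  have "T * (q\<^sup>2 * t\<^sup>2 + 1) = q * (T * (q * t\<^sup>2 + 1 / q))" using q by (simp add: field_simps power2_eq_square)
  then show ?thesis unfolding T_eq bq[symmetric] by simp
qed

lemma S_ne_T: "S \<noteq> T"
proof
  assume "S = T"
  then have "S * (t\<^sup>2 + q\<^sup>2) = S * (q\<^sup>2 * t\<^sup>2 + 1)" using S_eq' T_eq' by simp
  then have "S * ((q\<^sup>2 - 1) * (1 - t\<^sup>2)) = 0" by (simp add: algebra_simps)
  then have "S * ((q * d) * (1 - t\<^sup>2)) = 0" unfolding qd .
  then show False using ST0 q d0 t1' by simp
qed

lemma \<alpha>_eqs:
  "S / t = \<alpha> * (1 / t - S)" "S / q\<^sup>2 = \<alpha> * (S / t - 1)"
  "T / (q\<^sup>2 * t) = \<alpha> * (1 / t - T)" "T = \<alpha> * (T / t - 1)"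
proof -
  show "S / t = \<alpha> * (1 / t - S)"
    unfolding \<alpha>_def using S_eq' t0 q t1' by (simp add: divide_simps) (simp add: algebra_simps power2_eq_square)
  show "S / q\<^sup>2 = \<alpha> * (S / t - 1)"
    unfolding \<alpha>_def using S_eq' t0 q t1' by (simp add: divide_simps) (simp add: algebra_simps power2_eq_square)
  show "T / (q\<^sup>2 * t) = \<alpha> * (1 / t - T)"
    unfolding \<alpha>_def using T_eq' t0 q t1' by (simp add: divide_simps) (simp add: algebra_simps power2_eq_square)
  show "T = \<alpha> * (T / t - 1)"
    unfolding \<alpha>_def using T_eq' t0 q t1' by (simp add: divide_simps) (simp add: algebra_simps power2_eq_square)
qed

lemma \<alpha>_ST: "\<alpha> * q * (S - T) = - (d * S * T)"
proof -
  have "(q\<^sup>2 + 1) * t * (S - T) = S * (T * (q\<^sup>2 * t\<^sup>2 + 1)) - T * (S * (t\<^sup>2 + q\<^sup>2))"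
    unfolding S_eq' T_eq' by (simp add: algebra_simps)
  also have "\<dots> = - ((q\<^sup>2 - 1) * S * T * (1 - t\<^sup>2))"
    by (simp add: algebra_simps)
  also have "\<dots> = - (d * S * T) * (q * (1 - t\<^sup>2))"
    unfolding qd[symmetric] by (simp add: mult_ac)
  finally show ?thesis
    using q t1' by (simp add: \<alpha>_def divide_simps) (simp add: mult_ac power2_eq_square)
qed

text \<open>
  A degenerate exchange relation: after both sides are written in words with \<open>g\<close> on the right, the
  special values of \<open>S\<close> and \<open>T\<close> make the words with \<open>g S\<close> disappear, and the others agree by
  \<open>\<alpha>_eqs\<close>.
\<close>

lemma PS_g: "PS * g T = T *s (g S * ((1 / (q\<^sup>2 * t)) *s w T - v T))"
proof -
  have 1: "bracket (w T) (g S) = (- (q * \<alpha> * q) / T) *s (u S * g T - u T * g S)"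
  proof -
    have "q * d * S / (S - T) = - (q * \<alpha> * q) / T"
      using arg_cong[OF \<alpha>_ST, of "\<lambda>x. q * x"] S_ne_T ST0 by (simp add: divide_simps) (simp add: algebra_simps)
    then show ?thesis using bracket_w_g[OF T S S_ne_T[symmetric]] by simp
  qed
  have 2: "bracket (v T) (g S) = (\<alpha> / T) *s (y S * g T - y T * g S)"
  proof -
    have "d * S / (q * (T - S)) = \<alpha> / T"
      using \<alpha>_ST S_ne_T ST0 q by (simp add: divide_simps) (simp add: algebra_simps)
    then show ?thesis using bracket_v_g'[OF T S S_ne_T[symmetric]] by simp
  qed
  have w: "g S * w T = w T * g S - (- (q * \<alpha> * q) / T) *s (u S * g T - u T * g S)"
    unfolding 1[symmetric] by simp
  have v: "g S * v T = v T * g S - (\<alpha> / T) *s (y S * g T - y T * g S)"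
    unfolding 2[symmetric] by simp
  have "PS * g T = (S / t) *s (w S * g T) - (S / q\<^sup>2) *s (v S * g T)"
    by (simp add: PS_def expand)
  also have "\<dots> = \<alpha> *s ((1 / t - S) *s (w S * g T) - (S / t - 1) *s (v S * g T))"
    unfolding \<alpha>_eqs(1,2) by (simp add: expand)
  finally have L: "PS * g T = \<dots>" .
  have "T *s (g S * ((1 / (q\<^sup>2 * t)) *s w T - v T)) = (T / (q\<^sup>2 * t)) *s (g S * w T) - T *s (g S * v T)"
    by (simp add: expand)
  also have "\<dots> = (T / (q\<^sup>2 * t)) *s (w T * g S) - T *s (v T * g S)
       + (\<alpha> / t) *s (u S * g T - u T * g S) + \<alpha> *s (y S * g T - y T * g S)"
    unfolding w v using ST0 q by (simp add: scale_right_diff_distrib scale_right_distrib power2_eq_square)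
  also have "\<dots> = (\<alpha> * (1 / t - T)) *s (w T * g S) - (\<alpha> * (T / t - 1)) *s (v T * g S)
       + (\<alpha> / t) *s (u S * g T - u T * g S) + \<alpha> *s (y S * g T - y T * g S)"
    using \<alpha>_eqs(3,4) by simp
  also have "\<dots> = \<alpha> *s ((1 / t - T) *s (w T * g S) - (T / t - 1) *s (v T * g S)
       + (1 / t) *s (u S * g T - u T * g S) + (y S * g T - y T * g S))"
    by (simp add: scale_right_diff_distrib scale_right_distrib)
  also have "(1 / t - T) *s (w T * g S) - (T / t - 1) *s (v T * g S)
       + (1 / t) *s (u S * g T - u T * g S) + (y S * g T - y T * g S) =
      (1 / t - S) *s (w S * g T) - (S / t - 1) *s (v S * g T)"
    by (simp add: u_def y_def expand)
  finally show ?thesis unfolding L by simp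
qed

lemma determinant_swapped: "determinant scale P q b d \<rho> W1 W0 v w h g t S T"
  by (rule determinant.intro[OF currents_swapped], unfold_locales) (fact t0 t1 S T S_eq T_eq)+

lemma b_T: "b = T * (q * t + 1 / (q * t))"
  using T_eq t0 q by (simp add: field_simps power2_eq_square)

lemma b_S: "b = S * (t / q + q / t)"
  using S_eq t0 q by (simp add: field_simps power2_eq_square)

lemma b_q: "b / q = 1 + 1 / q\<^sup>2"
  using q by (simp add: b field_simps power2_eq_square)

text \<open>
  The image of \<open>PS_g\<close> under the symmetry.
\<close>

lemma PS_h: "S *s (((1 / t) *s v S - (1 / q\<^sup>2) *s w S) * h T) = T *s (h S * ((1 / (q\<^sup>2 * t)) *s v T - w T))"
  using determinant.PS_g[OF determinant_swapped] unfolding determinant.PS_def[OF determinant_swapped] by simp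

lemma Z_expand:
  "Z = (1 / t * S * T) *s (w S * v T) + (t * S * T) *s (v S * w T)
    - (q\<^sup>2 * S * T) *s (w S * w T) - (1 / q\<^sup>2 * S * T) *s (v S * v T) + (- (1 / \<rho>)) *s (g S * h T)"
  unfolding Z_def PS_def QT_def using t0 q
  by (simp add: expand mult_ac)

text \<open>
  In \<open>W0 Z - Z W0\<close> the words that contain \<open>g\<close> cancel by \<open>PS_g\<close>, and those that contain \<open>h\<close> by \<open>PS_h\<close>.
\<close>

lemma W0_Z: "W0 * Z = Z * W0"
proof -
  have W0PS: "W0 * PS = PS * W0 - (1 / (q\<^sup>2 * b)) *s (h S - g S)"
    using ST0 S by (simp add: PS_def W0_w W0_v expand)
  have W0QT: "W0 * QT = QT * W0 + (1 / (t * b)) *s (h T - g T)"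
    using ST0 T by (simp add: QT_def W0_w W0_v expand)
  have "W0 * (PS * QT) = (W0 * PS) * QT" by (simp add: mult.assoc)
  also have "\<dots> = PS * (W0 * QT) - (1 / (q\<^sup>2 * b)) *s ((h S - g S) * QT)"
    unfolding W0PS by (simp add: left_diff_distrib mult.assoc)
  also have "\<dots> = PS * QT * W0 + (1 / (t * b)) *s (PS * (h T - g T)) - (1 / (q\<^sup>2 * b)) *s ((h S - g S) * QT)"
    unfolding W0QT by (simp add: distrib_left mult.assoc)
  finally have 1: "W0 * (PS * QT) = \<dots>" .
  have "W0 * (g S * h T) = (W0 * g S) * h T" by (simp add: mult.assoc)
  also have "\<dots> = (1 / q\<^sup>2) *s (g S * (W0 * h T)) + (\<rho> / q) *s (u S * h T)"
    using S by (simp add: W0_g u_def[symmetric] distrib_right mult.assoc)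
  also have "\<dots> = g S * h T * W0 - (\<rho> / q) *s (g S * u T) + (\<rho> / q) *s (u S * h T)"
    using T q by (simp add: W0_h u_def[symmetric] right_diff_distrib scale_right_diff_distrib mult.assoc power2_eq_square)
  finally have 2: "W0 * (g S * h T) = \<dots>" .
  have "b *s (W0 * Z - Z * W0) = PS * (h T - g T) - (t / q\<^sup>2) *s ((h S - g S) * QT) + (b / q) *s (g S * u T - u S * h T)"
    using t0 b0 \<rho>0 by (simp add: Z_def right_diff_distrib left_diff_distrib 1 2 expand)
  also have "\<dots> = (PS * h T - (t / q\<^sup>2) *s (h S * QT) - (b / q) *s (u S * h T))
      - (PS * g T - (t / q\<^sup>2) *s (g S * QT) - (b / q) *s (g S * u T))"
    by (simp add: expand)
  also have "PS * g T - (t / q\<^sup>2) *s (g S * QT) - (b / q) *s (g S * u T) = 0"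
  proof -
    have bw: "b / q = T / (q\<^sup>2 * t) + T * t"
      using arg_cong[OF b_T, of "\<lambda>x. x / q"] q t0 by (simp add: field_simps power2_eq_square)
    have "(t / q\<^sup>2) *s (g S * QT) + (b / q) *s (g S * u T)
        = (b / q - T * t) *s (g S * w T) - (T * (b / q) - T / q\<^sup>2) *s (g S * v T)"
      using t0 q by (simp add: QT_def u_def expand mult.commute)
    also have "b / q - T * t = T / (q\<^sup>2 * t)" by (simp add: bw)
    also have "T * (b / q) - T / q\<^sup>2 = T" unfolding b_q bq by (simp add: algebra_simps)
    also have "(T / (q\<^sup>2 * t)) *s (g S * w T) - T *s (g S * v T) = PS * g T"
      unfolding PS_g by (simp add: expand)
    finally show ?thesis by (simp add: algebra_simps)
  qed
  also have "PS * h T - (t / q\<^sup>2) *s (h S * QT) - (b / q) *s (u S * h T) = 0"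
  proof -
    have bw: "b / q = S * t / q\<^sup>2 + S / t"
      using arg_cong[OF b_S, of "\<lambda>x. x / q"] q t0 by (simp add: field_simps power2_eq_square)
    have "PS * h T - (b / q) *s (u S * h T) = (S / t - b / q) *s (w S * h T) + (S * (b / q) - S / q\<^sup>2) *s (v S * h T)"
      using t0 q by (simp add: PS_def u_def expand mult.commute)
    also have "S / t - b / q = - S * t / q\<^sup>2" by (simp add: bw)
    also have "S * (b / q) - S / q\<^sup>2 = S" unfolding b_q bq by (simp add: algebra_simps)
    also have "(- S * t / q\<^sup>2) *s (w S * h T) + S *s (v S * h T) = t *s (S *s (((1 / t) *s v S - (1 / q\<^sup>2) *s w S) * h T))"
      using t0 by (simp add: expand mult_ac)
    also have "\<dots> = (t / q\<^sup>2) *s (h S * QT)"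
      unfolding PS_h using t0 q by (simp add: QT_def expand mult_ac)
    finally show ?thesis by (simp add: algebra_simps)
  qed
  finally have "b *s (W0 * Z - Z * W0) = 0" by simp
  then show ?thesis using b0 by simp
qed

lemma W1_Z: "W1 * Z = Z * W1"
proof -
  have W1PS: "W1 * PS = PS * W1 - (1 / (t * b)) *s (h S - g S)"
    using ST0 S by (simp add: PS_def W1_w W1_v expand)
  have W1QT: "W1 * QT = QT * W1 + (q\<^sup>2 / b) *s (h T - g T)"
    using ST0 T by (simp add: QT_def W1_w W1_v expand)
  have "W1 * (PS * QT) = (W1 * PS) * QT" by (simp add: mult.assoc)
  also have "\<dots> = PS * (W1 * QT) - (1 / (t * b)) *s ((h S - g S) * QT)"
    unfolding W1PS by (simp add: left_diff_distrib mult.assoc)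
  also have "\<dots> = PS * QT * W1 + (q\<^sup>2 / b) *s (PS * (h T - g T)) - (1 / (t * b)) *s ((h S - g S) * QT)"
    unfolding W1QT by (simp add: distrib_left mult.assoc)
  finally have 1: "W1 * (PS * QT) = \<dots>" .
  have "W1 * (g S * h T) = (W1 * g S) * h T" by (simp add: mult.assoc)
  also have "\<dots> = q\<^sup>2 *s (g S * (W1 * h T)) - (\<rho> * q) *s (y S * h T)"
    using S by (simp add: W1_g y_def[symmetric] left_diff_distrib mult.assoc)
  also have "\<dots> = g S * h T * W1 + (\<rho> * q) *s (g S * y T) - (\<rho> * q) *s (y S * h T)"
    using T q by (simp add: W1_h y_def[symmetric] distrib_left scale_right_distrib mult.assoc power2_eq_square mult.commute)
  finally have 2: "W1 * (g S * h T) = \<dots>" .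
  have "b *s (W1 * Z - Z * W1) = (q\<^sup>2 * t) *s (PS * (h T - g T)) - (h S - g S) * QT - (b * q) *s (g S * y T - y S * h T)"
    using t0 b0 \<rho>0 by (simp add: Z_def right_diff_distrib left_diff_distrib 1 2 expand mult_ac)
  also have "\<dots> = ((q\<^sup>2 * t) *s (PS * h T) - h S * QT + (b * q) *s (y S * h T))
      - ((q\<^sup>2 * t) *s (PS * g T) - g S * QT + (b * q) *s (g S * y T))"
    by (simp add: expand)
  also have "(q\<^sup>2 * t) *s (PS * g T) - g S * QT + (b * q) *s (g S * y T) = 0"
  proof -
    have bT: "b * q = T * q\<^sup>2 * t + T / t"
      by (subst b_T, insert q t0, simp add: field_simps power2_eq_square)
    have "g S * QT - (b * q) *s (g S * y T) = (T / t - b * q) *s (g S * v T) + (T * (b * q) - T * q\<^sup>2) *s (g S * w T)"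
      using t0 q by (simp add: QT_def y_def expand mult.commute)
    also have "T / t - b * q = - T * q\<^sup>2 * t" by (simp add: bT)
    also have "T * (b * q) - T * q\<^sup>2 = T" unfolding b_q bq by (simp add: algebra_simps)
    also have "(- T * q\<^sup>2 * t) *s (g S * v T) + T *s (g S * w T) = (q\<^sup>2 * t) *s (PS * g T)"
      unfolding PS_g using t0 q by (simp add: expand mult_ac)
    finally show ?thesis by (simp add: algebra_simps)
  qed
  also have "(q\<^sup>2 * t) *s (PS * h T) - h S * QT + (b * q) *s (y S * h T) = 0"
  proof -
    have bS: "b * q = S * t + S * q\<^sup>2 / t"
      by (subst b_S, insert q t0, simp add: field_simps power2_eq_square)
    have "(q\<^sup>2 * t) *s (PS * h T) + (b * q) *s (y S * h T) = (b * q - S * t) *s (v S * h T) + (S * q\<^sup>2 - S * (b * q)) *s (w S * h T)"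
      using t0 q by (simp add: PS_def y_def expand mult.commute)
    also have "b * q - S * t = S * q\<^sup>2 / t" by (simp add: bS)
    also have "S * q\<^sup>2 - S * (b * q) = - S" unfolding b_q bq by (simp add: algebra_simps)
    also have "(S * q\<^sup>2 / t) *s (v S * h T) + (- S) *s (w S * h T) = q\<^sup>2 *s (S *s (((1 / t) *s v S - (1 / q\<^sup>2) *s w S) * h T))"
      using t0 q by (simp add: expand mult_ac)
    also have "\<dots> = h S * QT"
      unfolding PS_h using t0 q by (simp add: QT_def expand mult_ac)
    finally show ?thesis by (simp add: algebra_simps)
  qed
  finally have "b *s (W1 * Z - Z * W1) = 0" by simp
  then show ?thesis using b0 by simp
qed

text \<open>
  The only combination of words in \<open>w\<close> and \<open>v\<close> in the calculation of \<open>g_Z\<close> can be traded for words in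
  \<open>g\<close> and \<open>h\<close>.
\<close>

lemma u_y_minus_y_u:
  assumes "s \<in> P" "s \<noteq> T"
  shows "\<rho> *s (u s * y T - y s * u T) = ((s - T) / (b * d * s * T)) *s bracket (h T) (g s)
    + (d * (1 - s * T) / (b * (s - T))) *s (g T * h s - g s * h T)"
  unfolding bracket_h_g[OF assms(1) T assms(2)] bracket_w_v[OF assms(1) T assms(2)]
  using \<rho>0 by (simp add: scale_right_distrib mult_ac)

text \<open>
  Three consequences of the equations that define \<open>S\<close> and \<open>T\<close>, in the form in which they occur as
  coefficients in \<open>g_Z\<close>.
\<close>

lemma T_minus_S: "d / b * (1 / t - t) * (S * T) = T - S"
proof -
  have "T - S = S * T / b * (b / S - b / T)" using ST0 b0 by (simp add: field_simps)
  also have "b / S = t / q + q / t" using b_S ST0 by (simp add: field_simps)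
  also have "b / T = q * t + 1 / (q * t)" using b_T ST0 by (simp add: field_simps)
  also have "t / q + q / t - (q * t + 1 / (q * t)) = d * (1 / t - t)"
    by (simp add: d algebra_simps)
  finally show ?thesis by simp
qed

lemma T_minus_S_shifted: "d / b * (1 / (q\<^sup>2 * t) - q\<^sup>2 * t) * (S * T) = T - S - d\<^sup>2 * S"
proof -
  have "T - S - d\<^sup>2 * S = S * T / b * (b / S - (1 + d\<^sup>2) * (b / T))" using ST0 b0 by (simp add: field_simps)
  also have "b / S = t / q + q / t" using b_S ST0 by (simp add: field_simps)
  also have "b / T = q * t + 1 / (q * t)" using b_T ST0 by (simp add: field_simps)
  also have "t / q + q / t - (1 + d\<^sup>2) * (q * t + 1 / (q * t)) = d * (1 / (q\<^sup>2 * t) - q\<^sup>2 * t)"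
    using q t0 by (simp add: d field_simps power2_eq_square)
  finally show ?thesis by simp
qed

lemma one_minus_ST: "d\<^sup>2 * (1 - S * T) = d / b * (1 / t - t) * (T - S)"
proof -
  define m where "m = d / b * (1 / t - t)"
  have "(1 - S * T) * (b / S) * (b / T) = (b / S) * (b / T) - b\<^sup>2"
    using ST0 by (simp add: field_simps power2_eq_square)
  also have "\<dots> = (t / q + q / t) * (q * t + 1 / (q * t)) - b\<^sup>2"
  proof -
    have "b / S = t / q + q / t" using b_S ST0 by (simp add: field_simps)
    moreover have "b / T = q * t + 1 / (q * t)" using b_T ST0 by (simp add: field_simps)
    ultimately show ?thesis by simp
  qed
  also have "\<dots> = (1 / t - t)\<^sup>2"
    using q t0 by (simp add: b field_simps power2_eq_square)
  finally have "d\<^sup>2 * ((1 - S * T) * (b / S) * (b / T)) = d\<^sup>2 * (1 / t - t)\<^sup>2"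
    by simp
  moreover have "d\<^sup>2 * ((1 - S * T) * (b / S) * (b / T)) = d\<^sup>2 * x\<^sup>2
      \<Longrightarrow> d\<^sup>2 * (1 - S * T) = d / b * x * (d / b * x * (S * T))" for x
    using ST0 b0 by (simp add: field_simps power2_eq_square)
  ultimately have "d\<^sup>2 * (1 - S * T) = m * (m * (S * T))"
    unfolding m_def by blast
  then show ?thesis unfolding m_def T_minus_S .
qed

lemma g_Z:
  assumes r: "r \<in> P" and rS: "r \<noteq> S" and rT: "r \<noteq> T"
  shows "g r * Z = Z * g r"
proof -
  have r0: "r \<noteq> 0" using r P0 by auto
  define A where "A = bracket (g S) (w r)"
  define B where "B = bracket (g S) (v r)"
  \<comment> \<open>The choices of \<open>a\<close> and \<open>c\<close> are dictated by the steps \<open>gPS\<close> and \<open>gQT\<close>: the brackets of \<open>g r\<close> with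
    \<open>PS\<close> and \<open>QT\<close> are multiples of \<open>[g S, a]\<close> and \<open>[g T, c]\<close>.\<close>
  define a where "a = w r - (t / q\<^sup>2) *s v r"
  define c where "c = v r - (q\<^sup>2 * t) *s w r"
  define R where "R = T *s ((1 / (q\<^sup>2 * t)) *s w T - v T)"
  define XS where "XS = bracket (w S) (v r)"
  define XT where "XT = bracket (w T) (v r)"
  define HS where "HS = bracket (h T) (g S)"
  define Hr where "Hr = bracket (h T) (g r)"
  have XS': "bracket (v S) (w r) = - XS" and XT': "bracket (v T) (w r) = - XT"
    using wv[OF S r] wv[OF T r] by (simp_all add: XS_def XT_def algebra_simps)
  \<comment> \<open>The double relations trade the parameter \<open>r\<close> for \<open>S\<close> or \<open>T\<close>, at the price of a factor
    \<open>r / S\<close> or \<open>r / T\<close>; thus in these two brackets \<open>r\<close> occurs only in the combinations \<open>a\<close> and \<open>c\<close>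
    of \<open>w\<close> and \<open>v\<close>.\<close>
  have gPS: "bracket (g r) PS = (r / t) *s bracket (g S) a"
  proof -
    have "bracket (g r) PS = - ((1 / t) *s S *s bracket (w S) (g r) - (1 / q\<^sup>2) *s S *s bracket (v S) (g r))"
      by (simp add: PS_def expand mult_ac)
    also have "\<dots> = - ((1 / t) *s r *s bracket (w r) (g S) - (1 / q\<^sup>2) *s r *s bracket (v r) (g S))"
      using wg[OF S r] vg[OF S r] by simp
    also have "\<dots> = (r / t) *s bracket (g S) a"
      using t0 by (simp add: a_def expand mult_ac)
    finally show ?thesis .
  qed
  have gQT: "bracket (g r) QT = (r / t) *s bracket (g T) c"
  proof -
    have "bracket (g r) QT = - ((1 / t) *s T *s bracket (v T) (g r) - q\<^sup>2 *s T *s bracket (w T) (g r))"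
      by (simp add: QT_def expand mult_ac)
    also have "\<dots> = - ((1 / t) *s r *s bracket (v r) (g T) - q\<^sup>2 *s r *s bracket (w r) (g T))"
      using wg[OF T r] vg[OF T r] by simp
    also have "\<dots> = (r / t) *s bracket (g T) c"
      using t0 by (simp add: c_def expand mult_ac)
    finally show ?thesis .
  qed
  have gh: "bracket (g r) (h T) = - Hr" by (simp add: Hr_def)
  have "bracket (g r) Z = t *s (bracket (g r) PS * QT + PS * bracket (g r) QT) - (1 / \<rho>) *s (g S * bracket (g r) (h T))"
    using gg[OF r S] by (simp add: Z_def expand) (simp add: mult.assoc[symmetric])
  also have "\<dots> = r *s (bracket (g S) a * QT + PS * bracket (g T) c) + (1 / \<rho>) *s (g S * Hr)"
    unfolding gPS gQT gh using t0 by (simp add: scale_right_distrib)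
  finally have E1: "bracket (g r) Z = \<dots>" .
  \<comment> \<open>The word \<open>PS * g T\<close> equals \<open>g S * R\<close>, so every letter \<open>g\<close> can be brought to the left. The
    combination \<open>c\<close> is chosen by the first step; its brackets with \<open>PS\<close> and \<open>R\<close> reduce to \<open>[w, v]\<close>.\<close>
  have PSc: "bracket PS c = (S * (1 / t - t)) *s XS"
  proof -
    have "bracket PS c = S *s ((1 / t) *s XS + t *s bracket (v S) (w r))"
      using ww[OF S r] vv[OF S r] q t0 by (simp add: PS_def c_def XS_def expand mult_ac)
    then show ?thesis unfolding XS' by (simp add: expand algebra_simps)
  qed
  have Rc: "bracket R c = (T * (1 / (q\<^sup>2 * t) - q\<^sup>2 * t)) *s XT"
  proof -
    have "bracket R c = T *s ((1 / (q\<^sup>2 * t)) *s XT + (q\<^sup>2 * t) *s bracket (v T) (w r))"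
      using ww[OF T r] vv[OF T r] q t0 by (simp add: R_def c_def XT_def expand mult_ac)
    then show ?thesis unfolding XT' by (simp add: expand algebra_simps)
  qed
  have PSg: "PS * g T = g S * R"
    unfolding PS_g R_def by (simp add: expand)
  have "PS * bracket (g T) c = (PS * g T) * c - (bracket PS c) * g T - c * (PS * g T)"
    by (simp add: algebra_simps)
  also have "\<dots> = bracket (g S) c * R + g S * bracket R c - (S * (1 / t - t)) *s (XS * g T)"
    unfolding PSg PSc by (simp add: algebra_simps)
  also have "\<dots> = bracket (g S) c * R + (T * (1 / (q\<^sup>2 * t) - q\<^sup>2 * t)) *s (g S * XT) - (S * (1 / t - t)) *s (XS * g T)"
    unfolding Rc by simp
  finally have E2: "PS * bracket (g T) c = \<dots>" .
  \<comment> \<open>By the equation that defines \<open>T\<close>, the parameter \<open>t\<close> drops out of the right-hand factors, and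
    only the combinations \<open>y T\<close> and \<open>u T\<close> survive.\<close>
  have E3: "bracket (g S) a * QT + bracket (g S) c * R = (b * q) *s (A * y T) + (b / q) *s (B * u T)"
  proof -
    have ga: "bracket (g S) a = A - (t / q\<^sup>2) *s B" and gc: "bracket (g S) c = B - (q\<^sup>2 * t) *s A"
      by (simp_all add: a_def c_def A_def B_def expand)
    have 1: "QT - (q\<^sup>2 * t) *s R = (b * q) *s y T"
    proof -
      have bT: "b * q = T * (1 / t + q\<^sup>2 * t)"
        by (subst b_T, insert q t0, simp add: field_simps power2_eq_square)
      have "QT - (q\<^sup>2 * t) *s R = (T * (1 / t + q\<^sup>2 * t)) *s v T - (T * (q\<^sup>2 + 1)) *s w T"
        using q t0 by (simp add: QT_def R_def expand algebra_simps)
      also have "\<dots> = (b * q) *s y T"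
        unfolding bT[symmetric] bq[symmetric] by (simp add: y_def expand mult_ac)
      finally show ?thesis .
    qed
    have 2: "R - (t / q\<^sup>2) *s QT = (b / q) *s u T"
    proof -
      have bT: "b / q = T * (1 / (q\<^sup>2 * t) + t)"
        by (subst b_T, insert q t0, simp add: field_simps power2_eq_square)
      have "R - (t / q\<^sup>2) *s QT = (T * (1 / (q\<^sup>2 * t) + t)) *s w T - (T * (1 + 1 / q\<^sup>2)) *s v T"
        using q t0 by (simp add: QT_def R_def expand algebra_simps)
      also have "\<dots> = (b / q) *s u T"
        unfolding bT[symmetric] b_q[symmetric] by (simp add: u_def expand mult_ac)
      finally show ?thesis .
    qed
    have "bracket (g S) a * QT + bracket (g S) c * R = A * (QT - (q\<^sup>2 * t) *s R) + B * (R - (t / q\<^sup>2) *s QT)"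
      unfolding ga gc by (simp add: algebra_simps)
    then show ?thesis unfolding 1 2 by simp
  qed
  \<comment> \<open>The exchange relations turn \<open>A\<close> and \<open>B\<close> into words that start with \<open>g\<close>. What follows is
    \<open>u y - y u\<close> at two parameters, which is a combination of \<open>[h, g]\<close> and of products \<open>g h\<close>. So
    \<open>[g r, Z]\<close> is a combination of five words in \<open>g\<close> and \<open>h\<close>, and it remains to see that the five
    coefficients vanish.\<close>
  define k where "k = S / (r - S)"
  have A': "A = (d * k / q) *s (g r * u S - g S * u r)"
  proof -
    have "A = - ((d * S / (q * (S - r))) *s (g r * u S - g S * u r))"
      unfolding bracket_w_g'[OF r S rS, symmetric] by (simp add: A_def)
    also have "d * S / (q * (S - r)) = - (d * S / (q * (r - S)))"
      unfolding minus_diff_eq[of r S, symmetric] mult_minus_right divide_minus_right ..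
    finally show ?thesis by (simp add: k_def mult.commute)
  qed
  have B': "B = - ((q * d * k) *s (g r * y S - g S * y r))"
  proof -
    have "q * d * k = q * d * S / (r - S)" by (simp add: k_def)
    then show ?thesis by (simp only: bracket_v_g[OF r S rS, symmetric] B_def minus_diff_eq)
  qed
  define N where "N s = u s * y T - y s * u T" for s
  have E4: "(b * q) *s (A * y T) + (b / q) *s (B * u T) = (b * d * k) *s (g r * N S - g S * N r)"
    using q by (simp add: A' B' N_def expand mult_ac)
  have "bracket (g r) Z = r *s ((b * d * k) *s (g r * N S - g S * N r)
      + (T * (1 / (q\<^sup>2 * t) - q\<^sup>2 * t)) *s (g S * XT) - (S * (1 / t - t)) *s (XS * g T)) + (1 / \<rho>) *s (g S * Hr)"
    unfolding E1 E2 E4[symmetric] E3[symmetric] by (simp add: algebra_simps)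
  then have "(\<rho> / r) *s bracket (g r) Z = (b * d * k) *s (g r * (\<rho> *s N S) - g S * (\<rho> *s N r))
      + (T * (1 / (q\<^sup>2 * t) - q\<^sup>2 * t)) *s (g S * (\<rho> *s XT)) - (S * (1 / t - t)) *s ((\<rho> *s XS) * g T) + (1 / r) *s (g S * Hr)"
    using \<rho>0 r0 by (simp add: expand mult_ac)
  moreover have "\<rho> *s XS = (d / (b * (S - r))) *s (g r * h S - g S * h r)"
    using \<rho>0 unfolding XS_def bracket_w_v[OF S r rS[symmetric]] by simp
  moreover have "\<rho> *s XT = (d / (b * (T - r))) *s (g r * h T - g T * h r)"
    using \<rho>0 unfolding XT_def bracket_w_v[OF T r rT[symmetric]] by simp
  moreover have "\<rho> *s N S = ((S - T) / (b * d * S * T)) *s HS + (d * (1 - S * T) / (b * (S - T))) *s (g T * h S - g S * h T)"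
    unfolding N_def HS_def by (rule u_y_minus_y_u[OF S S_ne_T])
  moreover have "\<rho> *s N r = ((r - T) / (b * d * r * T)) *s Hr + (d * (1 - r * T) / (b * (r - T))) *s (g T * h r - g r * h T)"
    unfolding N_def Hr_def by (rule u_y_minus_y_u[OF r rT])
  ultimately have E5: "(\<rho> / r) *s bracket (g r) Z =
     (b * d * k) *s (g r * (((S - T) / (b * d * S * T)) *s HS + (d * (1 - S * T) / (b * (S - T))) *s (g T * h S - g S * h T))
       - g S * (((r - T) / (b * d * r * T)) *s Hr + (d * (1 - r * T) / (b * (r - T))) *s (g T * h r - g r * h T)))
      + (T * (1 / (q\<^sup>2 * t) - q\<^sup>2 * t)) *s (g S * ((d / (b * (T - r))) *s (g r * h T - g T * h r)))
      - (S * (1 / t - t)) *s (((d / (b * (S - r))) *s (g r * h S - g S * h r)) * g T) + (1 / r) *s (g S * Hr)"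
    by (simp only:)
  have hg': "h S * g T = g T * h S + HS" "h r * g T = g T * h r + Hr"
    using hg[OF S T] hg[OF r T] by (simp_all add: HS_def Hr_def algebra_simps)
  have comm_gS: "g S * (g r * x) = g r * (g S * x)" for x
    using gg[OF r S] by (simp add: mult.assoc[symmetric])
  define m where "m = d / b * (1 / t - t)"
  define n where "n = d / b * (1 / (q\<^sup>2 * t) - q\<^sup>2 * t)"
  define x1 where "x1 = (S - T) / (S * T)"
  define x2 where "x2 = (r - T) / (r * T)"
  define x3 where "x3 = d\<^sup>2 * (1 - S * T) / (S - T)"
  define x4 where "x4 = d\<^sup>2 * (1 - r * T) / (r - T)"
  define x5 where "x5 = T * n / (T - r)"
  have c: "b * d * k * ((S - T) / (b * d * S * T)) = k * x1"
       "b * d * k * ((r - T) / (b * d * r * T)) = k * x2"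
       "b * d * k * (d * (1 - S * T) / (b * (S - T))) = k * x3"
       "b * d * k * (d * (1 - r * T) / (b * (r - T))) = k * x4"
       "T * (1 / (q\<^sup>2 * t) - q\<^sup>2 * t) * (d / (b * (T - r))) = x5"
    using b0 d0 by (simp_all add: x1_def x2_def x3_def x4_def x5_def n_def power2_eq_square)
  have "S * x * (d / (b * (- e))) = - (S / e * (d / b * x))" for x e by (simp add: mult_ac)
  from this[of "1 / t - t" "r - S"] have c': "S * (1 / t - t) * (d / (b * (S - r))) = - (k * m)"
    by (simp only: minus_diff_eq k_def m_def)
  have gen: "K1 *s (g r * (c1 *s HS + c2 *s (g T * h S - g S * h T)) - g S * (c3 *s Hr + c4 *s (g T * h r - g r * h T)))
      + c5 *s (g S * (c6 *s (g r * h T - g T * h r))) - c7 *s ((c8 *s (g r * h S - g S * h r)) * g T) + c9 *s (g S * Hr)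
    = (K1 * c1) *s (g r * HS) + (K1 * c2) *s (g r * (g T * h S)) - (K1 * c2) *s (g r * (g S * h T))
      - (K1 * c3) *s (g S * Hr) - (K1 * c4) *s (g S * (g T * h r)) + (K1 * c4) *s (g r * (g S * h T))
      + (c5 * c6) *s (g r * (g S * h T)) - (c5 * c6) *s (g S * (g T * h r))
      - (c7 * c8) *s (g r * (g T * h S)) - (c7 * c8) *s (g r * HS)
      + (c7 * c8) *s (g S * (g T * h r)) + (c7 * c8) *s (g S * Hr) + c9 *s (g S * Hr)" for K1 c1 c2 c3 c4 c5 c6 c7 c8 c9
    by (simp add: expand hg' comm_gS)
  have fin: "(\<rho> / r) *s bracket (g r) Z =
      (k * x1 + k * m) *s (g r * HS) + (1 / r - k * x2 - k * m) *s (g S * Hr)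
      + (k * x3 + k * m) *s (g r * (g T * h S)) + (k * x4 + x5 - k * x3) *s (g r * (g S * h T))
      - (k * x4 + x5 + k * m) *s (g S * (g T * h r))"
    unfolding E5 gen c c' by (simp add: expand)
  have x1: "x1 = - m"
    using T_minus_S[folded m_def] ST0 by (simp add: x1_def field_simps)
  have x3: "x3 = - m"
  proof -
    have "x3 * (S - T) = (- m) * (S - T)"
      using S_ne_T by (simp add: x3_def one_minus_ST[folded m_def]) (simp add: algebra_simps)
    then show ?thesis using S_ne_T by (subst (asm) mult_right_cancel) simp_all
  qed
  have z1: "1 / r - k * x2 - k * m = 0"
  proof -
    have m: "m = (T - S) / (S * T)" using T_minus_S[folded m_def] ST0 by (simp add: field_simps)
    show ?thesis unfolding m k_def x2_def using ST0 r0 rS by (simp add: divide_simps) (simp add: algebra_simps)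
  qed
  have z2: "k * x4 + x5 + k * m = 0"
  proof -
    have n: "n * (S * T) = T - S - d\<^sup>2 * S" using T_minus_S_shifted by (simp add: n_def)
    have m: "m * (S * T) = T - S" using T_minus_S by (simp add: m_def)
    have m2: "m * (T - S) = d\<^sup>2 * (1 - S * T)" using one_minus_ST by (simp add: m_def)
    have "(T - S) * (T - S) = (m * (T - S)) * (S * T)" using m by (simp add: mult_ac)
    then have sq: "(T - S) * (T - S) = d\<^sup>2 * (1 - S * T) * (S * T)" unfolding m2 .
    have "(S * (d\<^sup>2 * (1 - r * T)) - T * n * (r - S) + S * m * (r - T)) * (S * T)
        = S * (d\<^sup>2 * (1 - r * T)) * (S * T) - T * (r - S) * (n * (S * T)) + S * (r - T) * (m * (S * T))"
      by (simp add: algebra_simps)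
    also have "\<dots> = r * (d\<^sup>2 * (1 - S * T) * (S * T)) - r * ((T - S) * (T - S))"
      unfolding m n by (simp add: algebra_simps)
    also have "\<dots> = 0" unfolding sq by simp
    finally have z: "S * (d\<^sup>2 * (1 - r * T)) - T * n * (r - S) + S * m * (r - T) = 0"
      using ST0 by simp
    have "T - r = - (r - T)" by simp
    then have "x5 = - (T * n / (r - T))" by (simp only: x5_def divide_minus_right)
    then have "k * x4 + x5 + k * m = (S * (d\<^sup>2 * (1 - r * T)) - T * n * (r - S) + S * m * (r - T)) / ((r - S) * (r - T))"
      using rS rT by (simp add: k_def x4_def add_divide_distrib diff_divide_distrib)
    then show ?thesis unfolding z by simp
  qed
  have "(\<rho> / r) *s bracket (g r) Z = 0"
    unfolding fin x1 x3 z1 z2 using z2 by simp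
  then show ?thesis using \<rho>0 r0 by simp
qed
end

section \<open>Series over a typed algebra\<close>

context typed_algebra begin

text \<open>
  Laurent series over the field act on Laurent series over the algebra. This makes the latter an algebra
  over a field in which differences of parameters are invertible.
\<close>

definition const_fls :: "'k fls \<Rightarrow> 'r fls" where
  "const_fls c = Abs_fls (\<lambda>n. (c $$ n) *s 1)"

definition const_fps :: "'k fps \<Rightarrow> 'r fps" where
  "const_fps c = Abs_fps (\<lambda>n. (c $ n) *s 1)"

definition scale_fls :: "'k fls \<Rightarrow> 'r fls \<Rightarrow> 'r fls" where
  "scale_fls c x = const_fls c * x"

lemma const_fps_nth [simp]: "const_fps c $ n = (c $ n) *s 1"
  by (simp add: const_fps_def)

lemma const_fls_nth [simp]: "const_fls c $$ n = (c $$ n) *s 1"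
  unfolding const_fls_def by (rule nth_Abs_fls_lower_bound[of "fls_subdegree c"]) simp

lemma const_fls_fps: "const_fls (fps_to_fls c) = fps_to_fls (const_fps c)"
  by (rule fls_eqI) simp

lemma const_fls_eq_0: "const_fls c = 0 \<longleftrightarrow> c = 0"
  by (simp add: fls_eq_iff)

lemma subdegree_const_fls: "fls_subdegree (const_fls c) = fls_subdegree c"
proof (cases "c = 0")
  case False
  show ?thesis
    by (rule fls_subdegree_eqI) (use False in auto)
qed (simp add: const_fls_eq_0[THEN iffD2])

lemma const_fls_add: "const_fls (c + c') = const_fls c + const_fls c'"
  by (rule fls_eqI) (simp add: scale_left_distrib)

lemma const_fls_mult: "const_fls (c * c') = const_fls c * const_fls c'"
  by (rule fls_eqI) (simp add: fls_times_nth(2) subdegree_const_fls scale_sum_left mult.commute)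

lemma const_fls_1: "const_fls 1 = 1"
  by (rule fls_eqI) (simp add: fls_one_nth)

lemma const_fls_comm: "const_fls c * x = x * const_fls c"
proof (rule fls_eqI)
  fix n
  let ?d = "fls_subdegree c" and ?e = "fls_subdegree x"
  have "(const_fls c * x) $$ n = (\<Sum>i=?d..n - ?e. (c $$ i) *s (x $$ (n - i)))"
    by (simp add: fls_times_nth(2) subdegree_const_fls)
  also have "\<dots> = (\<Sum>i=?e + ?d..n. (c $$ (?d + n - i)) *s (x $$ (i - ?d)))"
    by (rule sum.reindex_bij_witness[of _ "\<lambda>i. ?d + n - i" "\<lambda>i. ?d + n - i"]) auto
  also have "\<dots> = (x * const_fls c) $$ n"
    by (simp add: fls_times_nth(1) subdegree_const_fls)
  finally show "(const_fls c * x) $$ n = (x * const_fls c) $$ n" .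
qed

lemma typed_algebra_fls: "typed_algebra scale_fls"
proof
  fix a b x y
  show "scale_fls a (x + y) = scale_fls a x + scale_fls a y" by (simp add: scale_fls_def distrib_left)
  show "scale_fls (a + b) x = scale_fls a x + scale_fls b x" by (simp add: scale_fls_def const_fls_add distrib_right)
  show "scale_fls a (scale_fls b x) = scale_fls (a * b) x" by (simp add: scale_fls_def const_fls_mult mult.assoc)
  show "scale_fls 1 x = x" by (simp add: scale_fls_def const_fls_1)
  show "scale_fls a x * y = scale_fls a (x * y)" by (simp add: scale_fls_def mult.assoc)
  show "x * scale_fls a y = scale_fls a (x * y)"
    unfolding scale_fls_def mult.assoc[symmetric] const_fls_comm[of a x] ..
qed

lemma scale_fls_fps: "scale_fls (fps_to_fls c) (fps_to_fls x) = fps_to_fls (const_fps c * x)"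
  by (simp add: scale_fls_def const_fls_fps fls_times_fps_to_fls)

text \<open>
  The values at the series \<open>s\<close> (and \<open>t\<close>) of the generating functions of a sequence and of a double
  sequence. They are used for \<open>s\<close> and \<open>t\<close> without constant term only; then summands with larger indices do
  not contribute.
\<close>

definition series_at :: "(nat \<Rightarrow> 'r) \<Rightarrow> 'k fps \<Rightarrow> 'r fps" where
  "series_at a s = Abs_fps (\<lambda>n. \<Sum>i\<le>n. (s ^ i $ n) *s a i)"

definition double_series :: "(nat \<Rightarrow> nat \<Rightarrow> 'r) \<Rightarrow> 'k fps \<Rightarrow> 'k fps \<Rightarrow> 'r fps" where
  "double_series f s t = Abs_fps (\<lambda>n. \<Sum>i\<le>n. \<Sum>j\<le>n. ((s ^ i * t ^ j) $ n) *s f i j)"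

lemma const_fps_mult_nth: "(const_fps c * x) $ n = (\<Sum>i\<le>n. (c $ i) *s (x $ (n - i)))"
  by (simp add: fps_mult_nth atLeast0AtMost)

lemma series_at_nth:
  assumes "s $ 0 = 0" "n \<le> N"
  shows "series_at a s $ n = (\<Sum>i\<le>N. (s ^ i $ n) *s a i)"
  unfolding series_at_def fps_nth_Abs_fps
  by (rule sum.mono_neutral_left) (use assms in \<open>auto simp: startsby_zero_power_prefix\<close>)

lemma power_mult_power_nth_below:
  fixes s t :: "'k fps"
  assumes "s $ 0 = 0" "t $ 0 = 0" "n < i + j"
  shows "(s ^ i * t ^ j) $ n = 0"
  unfolding fps_mult_nth
proof (rule sum.neutral, rule ballI)
  fix k assume "k \<in> {0..n}"
  then have "k < i \<or> n - k < j" using assms by auto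
  then show "s ^ i $ k * t ^ j $ (n - k) = 0"
    using startsby_zero_power_prefix[OF assms(1), of i] startsby_zero_power_prefix[OF assms(2), of j] by auto
qed

lemma sum_scale_triangle:
  "(\<Sum>k\<le>n. \<Sum>i\<in>I. \<Sum>j\<in>J. (x i k * y j (n - k)) *s f i j)
    = (\<Sum>i\<in>I. \<Sum>j\<in>J. (\<Sum>k\<le>n. x i k * y j (n - k)) *s f i j)"
proof -
  have "(\<Sum>k\<le>n. \<Sum>i\<in>I. \<Sum>j\<in>J. (x i k * y j (n - k)) *s f i j)
      = (\<Sum>i\<in>I. \<Sum>k\<le>n. \<Sum>j\<in>J. (x i k * y j (n - k)) *s f i j)" by (rule sum.swap)
  also have "\<dots> = (\<Sum>i\<in>I. \<Sum>j\<in>J. \<Sum>k\<le>n. (x i k * y j (n - k)) *s f i j)"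
    by (rule sum.cong[OF refl], rule sum.swap)
  finally show ?thesis by (simp add: scale_sum_left)
qed

lemma series_at_mult:
  assumes "s $ 0 = 0" "t $ 0 = 0"
  shows "series_at a s * series_at b t = double_series (\<lambda>i j. a i * b j) s t"
proof (rule fps_ext)
  fix n
  have "(series_at a s * series_at b t) $ n = (\<Sum>k\<le>n. (\<Sum>i\<le>n. (s ^ i $ k) *s a i) * (\<Sum>j\<le>n. (t ^ j $ (n - k)) *s b j))"
    using assms by (simp add: fps_mult_nth atLeast0AtMost series_at_nth[where N = n])
  also have "\<dots> = (\<Sum>k\<le>n. \<Sum>i\<le>n. \<Sum>j\<le>n. (s ^ i $ k * t ^ j $ (n - k)) *s (a i * b j))"
    by (simp add: sum_product mult.commute)
  also have "\<dots> = (\<Sum>i\<le>n. \<Sum>j\<le>n. (\<Sum>k\<le>n. s ^ i $ k * t ^ j $ (n - k)) *s (a i * b j))"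
    by (rule sum_scale_triangle)
  finally show "(series_at a s * series_at b t) $ n = double_series (\<lambda>i j. a i * b j) s t $ n"
    by (simp add: double_series_def fps_mult_nth atLeast0AtMost)
qed

lemma series_at_mult':
  assumes "s $ 0 = 0" "t $ 0 = 0"
  shows "series_at b t * series_at a s = double_series (\<lambda>i j. b j * a i) s t"
proof (rule fps_ext)
  fix n
  have "(series_at b t * series_at a s) $ n = double_series (\<lambda>i j. b i * a j) t s $ n" by (simp add: series_at_mult assms)
  also have "\<dots> = double_series (\<lambda>i j. b j * a i) s t $ n"
    unfolding double_series_def fps_nth_Abs_fps by (subst sum.swap) (simp add: mult.commute)
  finally show "(series_at b t * series_at a s) $ n = double_series (\<lambda>i j. b j * a i) s t $ n" .
qed

lemma double_series_diff: "double_series f s t - double_series g s t = double_series (\<lambda>i j. f i j - g i j) s t"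
  by (rule fps_ext) (simp add: double_series_def scale_right_diff_distrib sum_subtractf)

lemma double_series_add: "double_series f s t + double_series g s t = double_series (\<lambda>i j. f i j + g i j) s t"
  by (rule fps_ext) (simp add: double_series_def scale_right_distrib sum.distrib)

text \<open>
  A family of relations for all pairs of indices is thereby turned into one identity of currents.
\<close>

lemma bracket_series_at:
  assumes "s $ 0 = 0" "t $ 0 = 0"
  shows "bracket (series_at a s) (series_at b t) = double_series (\<lambda>i j. bracket (a i) (b j)) s t"
  unfolding series_at_mult[OF assms] series_at_mult'[OF assms] double_series_diff ..

text \<open>
  Multiplication of the generating function by its variable.
\<close>

definition shift :: "(nat \<Rightarrow> 'r) \<Rightarrow> nat \<Rightarrow> 'r" where
  "shift a i = (case i of 0 \<Rightarrow> 0 | Suc j \<Rightarrow> a j)"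

lemma shift_simps [simp]: "shift a 0 = 0" "shift a (Suc j) = a j"
  by (simp_all add: shift_def)

lemma const_mult_series_at:
  assumes "s $ 0 = 0"
  shows "const_fps s * series_at a s = series_at (shift a) s"
proof (rule fps_ext)
  fix n
  have "(const_fps s * series_at a s) $ n = (\<Sum>k\<le>n. (s $ k) *s (\<Sum>i\<le>n. (s ^ i $ (n - k)) *s a i))"
    using assms by (simp add: const_fps_mult_nth series_at_nth[where N = n])
  also have "\<dots> = (\<Sum>i\<le>n. (s ^ Suc i $ n) *s a i)"
  proof -
    have "(\<Sum>k\<le>n. (s $ k) *s (\<Sum>i\<le>n. (s ^ i $ (n - k)) *s a i))
        = (\<Sum>k\<le>n. \<Sum>i\<le>n. (s $ k * s ^ i $ (n - k)) *s a i)"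
      by (simp add: scale_sum_right)
    also have "\<dots> = (\<Sum>i\<le>n. \<Sum>k\<le>n. (s $ k * s ^ i $ (n - k)) *s a i)"
      by (rule sum.swap)
    finally show ?thesis
      by (simp add: scale_sum_left fps_mult_nth atLeast0AtMost)
  qed
  also have "\<dots> = series_at (shift a) s $ n"
    by (subst series_at_nth[OF assms, of n "Suc n"]) (simp_all add: sum.atMost_Suc_shift del: sum.atMost_Suc power_Suc)
  finally show "(const_fps s * series_at a s) $ n = series_at (shift a) s $ n" .
qed

lemma series_at_linear:
  "series_at a s + series_at b s = series_at (\<lambda>i. a i + b i) s"
  "series_at a s - series_at b s = series_at (\<lambda>i. a i - b i) s"
  "fps_const x * series_at a s = series_at (\<lambda>i. x * a i) s"
  "series_at a s * fps_const x = series_at (\<lambda>i. a i * x) s"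
  "const_fps (fps_const c) * series_at a s = series_at (\<lambda>i. c *s a i) s"
proof -
  show "series_at a s + series_at b s = series_at (\<lambda>i. a i + b i) s"
    by (rule fps_ext) (simp add: series_at_def scale_right_distrib sum.distrib)
  show "series_at a s - series_at b s = series_at (\<lambda>i. a i - b i) s"
    by (rule fps_ext) (simp add: series_at_def scale_right_diff_distrib sum_subtractf)
  show "fps_const x * series_at a s = series_at (\<lambda>i. x * a i) s"
    by (rule fps_ext) (simp add: series_at_def sum_distrib_left)
  show "series_at a s * fps_const x = series_at (\<lambda>i. a i * x) s"
    by (rule fps_ext) (simp add: series_at_def sum_distrib_right)
  have "const_fps (fps_const c) = fps_const (c *s 1)"
    by (rule fps_ext) simp
  then show "const_fps (fps_const c) * series_at a s = series_at (\<lambda>i. c *s a i) s"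
    by (intro fps_ext) (simp add: series_at_def scale_sum_right mult.commute)
qed

lemma const_fps_simps:
  "const_fps (c + c') = const_fps c + const_fps c'" "const_fps (c - c') = const_fps c - const_fps c'"
  "const_fps (c * c') = const_fps c * const_fps c'" "const_fps 1 = 1"
  by (rule fps_ext, simp add: scale_left_distrib scale_left_diff_distrib fps_mult_nth scale_sum_left fps_one_nth mult.commute)+

lemma const_fps_comm: "const_fps c * x = x * const_fps c"
proof (rule fps_ext)
  fix n
  have "(const_fps c * x) $ n = (\<Sum>i\<le>n. (c $ (n - i)) *s (x $ i))"
    unfolding const_fps_mult_nth
    by (rule sum.reindex_bij_witness[of _ "\<lambda>i. n - i" "\<lambda>i. n - i"]) auto
  then show "(const_fps c * x) $ n = (x * const_fps c) $ n"
    by (simp add: fps_mult_nth atLeast0AtMost)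
qed

lemma const_fps_power: "const_fps (c ^ n) = const_fps c ^ n"
  by (induction n) (simp_all add: const_fps_simps)

lemma bracket_series_at_shift:
  assumes "s $ 0 = 0" "t $ 0 = 0"
  shows "const_fps s * bracket (series_at a s) (series_at b t) = double_series (\<lambda>i j. bracket (shift a i) (b j)) s t"
    and "const_fps t * bracket (series_at a s) (series_at b t) = double_series (\<lambda>i j. bracket (a i) (shift b j)) s t"
proof -
  have "const_fps s * bracket (series_at a s) (series_at b t) = bracket (const_fps s * series_at a s) (series_at b t)"
    by (simp add: right_diff_distrib mult.assoc const_fps_comm)
  then show "const_fps s * bracket (series_at a s) (series_at b t) = double_series (\<lambda>i j. bracket (shift a i) (b j)) s t"
    by (simp only: const_mult_series_at[OF assms(1)] bracket_series_at[OF assms])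
  have "const_fps t * bracket (series_at a s) (series_at b t) = bracket (series_at a s) (const_fps t * series_at b t)"
    unfolding right_diff_distrib mult.assoc[symmetric] const_fps_comm[of t "series_at a s"] ..
  then show "const_fps t * bracket (series_at a s) (series_at b t) = double_series (\<lambda>i j. bracket (a i) (shift b j)) s t"
    by (simp only: const_mult_series_at[OF assms(2)] bracket_series_at[OF assms])
qed

end

text \<open>
  Sequences that satisfy the relations of the alternating generators: \<open>w k\<close>, \<open>v k\<close>, \<open>g k\<close>, \<open>h k\<close> stand for
  \<open>W\<^sub>-\<^sub>k\<close>, \<open>W\<^sub>k\<^sub>+\<^sub>1\<close>, \<open>G\<^sub>k\<close>, \<open>Gt\<^sub>k\<close>. That \<open>g 0\<close> is the prescribed scalar is expressed by its
  action on the letters, because the algebra will be embedded as a direct factor, where the scalars are the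
  multiples of a unit different from \<open>1\<close>.
\<close>

locale alternating = typed_algebra scale
  for scale :: "'k::field \<Rightarrow> 'r::ring_1 \<Rightarrow> 'r"  (infixr \<open>*s\<close> 75) +
  fixes q :: 'k and w v g h :: "nat \<Rightarrow> 'r"
  assumes wv0: "bracket (w 0) (v k) = inverse (q2 q) *s (h (Suc k) - g (Suc k))"
    and w0v: "bracket (w k) (v 0) = inverse (q2 q) *s (h (Suc k) - g (Suc k))"
    and w0g: "q *s (w 0 * g (Suc k)) - inverse q *s (g (Suc k) * w 0) = rho q *s w (Suc k) - rho q *s v k"
    and hw0: "q *s (h (Suc k) * w 0) - inverse q *s (w 0 * h (Suc k)) = rho q *s w (Suc k) - rho q *s v k"
    and gv0: "q *s (g (Suc k) * v 0) - inverse q *s (v 0 * g (Suc k)) = rho q *s v (Suc k) - rho q *s w k"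
    and v0h: "q *s (v 0 * h (Suc k)) - inverse q *s (h (Suc k) * v 0) = rho q *s v (Suc k) - rho q *s w k"
    and ww: "bracket (w k) (w l) = 0" and vv: "bracket (v k) (v l) = 0"
    and wv: "bracket (w k) (v l) + bracket (v k) (w l) = 0"
    and wg: "bracket (w k) (g (Suc l)) + bracket (g (Suc k)) (w l) = 0"
    and wh: "bracket (w k) (h (Suc l)) + bracket (h (Suc k)) (w l) = 0"
    and vg: "bracket (v k) (g (Suc l)) + bracket (g (Suc k)) (v l) = 0"
    and vh: "bracket (v k) (h (Suc l)) + bracket (h (Suc k)) (v l) = 0"
    and gg: "bracket (g (Suc k)) (g (Suc l)) = 0" and hh: "bracket (h (Suc k)) (h (Suc l)) = 0"
    and hg: "bracket (h (Suc k)) (g (Suc l)) + bracket (g (Suc k)) (h (Suc l)) = 0"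
    and h0: "h 0 = g 0"
    and g0: "g 0 * w k = (- (q - inverse q) * (q2 q)\<^sup>2) *s w k" "g 0 * v k = (- (q - inverse q) * (q2 q)\<^sup>2) *s v k"
      "g 0 * g k = (- (q - inverse q) * (q2 q)\<^sup>2) *s g k" "g 0 * h k = (- (q - inverse q) * (q2 q)\<^sup>2) *s h k"
      "w k * g 0 = (- (q - inverse q) * (q2 q)\<^sup>2) *s w k" "v k * g 0 = (- (q - inverse q) * (q2 q)\<^sup>2) *s v k"
      "g k * g 0 = (- (q - inverse q) * (q2 q)\<^sup>2) *s g k" "h k * g 0 = (- (q - inverse q) * (q2 q)\<^sup>2) *s h k"
    and q0: "q \<noteq> 0" and q_not_root: "n \<ge> 1 \<Longrightarrow> q ^ n \<noteq> 1"
begin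

lemma q2_nonzero: "q2 q \<noteq> 0"
proof
  assume "q2 q = 0"
  then have "q * q = - 1" using q0 by (simp add: q2_def field_simps eq_neg_iff_add_eq_0)
  then have "q ^ 4 = 1" by (simp add: numeral_eq_Suc mult.assoc[symmetric])
  then show False using q_not_root[of 4] by simp
qed

lemma q_diff_nonzero: "q - inverse q \<noteq> 0"
proof
  assume "q - inverse q = 0"
  then have "q ^ 2 = 1" using q0 by (simp add: field_simps power2_eq_square)
  then show False using q_not_root[of 2] by simp
qed

lemma rho_eq: "rho q = - ((q2 q * (q - inverse q))\<^sup>2)"
  using q0 by (simp add: rho_def q2_def algebra_simps power2_eq_square)

text \<open>
  With the shifted sequences, the relations extend to the index \<open>0\<close>, where they hold because of the
  value of \<open>G\<^sub>0 = Gt\<^sub>0\<close>. In this form they are coefficients of identities between currents.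
\<close>

lemma wg_all: "bracket (shift w i) (g j) + bracket (g i) (shift w j) = 0"
  using wg g0 by (cases i; cases j) auto
lemma wh_all: "bracket (shift w i) (h j) + bracket (h i) (shift w j) = 0"
  using wh g0 h0 by (cases i; cases j) auto
lemma vg_all: "bracket (shift v i) (g j) + bracket (g i) (shift v j) = 0"
  using vg g0 by (cases i; cases j) auto
lemma vh_all: "bracket (shift v i) (h j) + bracket (h i) (shift v j) = 0"
  using vh g0 h0 by (cases i; cases j) auto
lemma gg_all: "bracket (g i) (g j) = 0"
  using gg g0 by (cases i; cases j) auto
lemma hh_all: "bracket (h i) (h j) = 0"
  using hh g0 h0 by (cases i; cases j) auto
lemma hg_all: "bracket (h i) (g j) + bracket (g i) (h j) = 0"
  using hg g0 h0 by (cases i; cases j) auto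
lemma wv0_all: "q2 q *s bracket (w 0) (shift v i) = h i - g i"
  using wv0 q2_nonzero h0 by (cases i) auto
lemma w0v_all: "q2 q *s bracket (shift w i) (v 0) = h i - g i"
  using w0v q2_nonzero h0 by (cases i) auto
lemma rho_g0: "q * (- (q - inverse q) * (q2 q)\<^sup>2) - inverse q * (- (q - inverse q) * (q2 q)\<^sup>2) = rho q"
  by (simp add: rho_eq algebra_simps power2_eq_square)
lemma w0g_all: "q *s (w 0 * g i) - inverse q *s (g i * w 0) = rho q *s (w i - shift v i)"
  using w0g g0 rho_g0 by (cases i) (auto simp: scale_right_diff_distrib scale_left_diff_distrib[symmetric])
lemma hw0_all: "q *s (h i * w 0) - inverse q *s (w 0 * h i) = rho q *s (w i - shift v i)"
  using hw0 g0 h0 rho_g0 by (cases i) (auto simp: scale_right_diff_distrib scale_left_diff_distrib[symmetric])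
lemma gv0_all: "q *s (g i * v 0) - inverse q *s (v 0 * g i) = rho q *s (v i - shift w i)"
  using gv0 g0 rho_g0 by (cases i) (auto simp: scale_right_diff_distrib scale_left_diff_distrib[symmetric])
lemma v0h_all: "q *s (v 0 * h i) - inverse q *s (h i * v 0) = rho q *s (v i - shift w i)"
  using v0h g0 h0 rho_g0 by (cases i) (auto simp: scale_right_diff_distrib scale_left_diff_distrib[symmetric])

definition params :: "'k fls set" where "params = {fps_to_fls s | s. s $ 0 = 0 \<and> s \<noteq> 0}"
definition laurent_at :: "(nat \<Rightarrow> 'r) \<Rightarrow> 'k fls \<Rightarrow> 'r fls" where "laurent_at a s = fps_to_fls (series_at a (fls_regpart s))"

lemma laurent_at_fps [simp]: "laurent_at a (fps_to_fls s) = fps_to_fls (series_at a s)"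
  by (simp add: laurent_at_def)

lemma series_relations:
  assumes "s $ 0 = 0"
  shows "const_fps (fps_const (q2 q)) * (const_fps s * bracket (fps_const (w 0)) (series_at v s)) = series_at h s - series_at g s"
    and "const_fps (fps_const (q2 q)) * (const_fps s * bracket (series_at w s) (fps_const (v 0))) = series_at h s - series_at g s"
    and "const_fps (fps_const q) * (fps_const (w 0) * series_at g s) - const_fps (fps_const (inverse q)) * (series_at g s * fps_const (w 0))
        = const_fps (fps_const (rho q)) * (series_at w s - const_fps s * series_at v s)"
    and "const_fps (fps_const q) * (series_at h s * fps_const (w 0)) - const_fps (fps_const (inverse q)) * (fps_const (w 0) * series_at h s)
        = const_fps (fps_const (rho q)) * (series_at w s - const_fps s * series_at v s)"
    and "const_fps (fps_const q) * (series_at g s * fps_const (v 0)) - const_fps (fps_const (inverse q)) * (fps_const (v 0) * series_at g s)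
        = const_fps (fps_const (rho q)) * (series_at v s - const_fps s * series_at w s)"
    and "const_fps (fps_const q) * (fps_const (v 0) * series_at h s) - const_fps (fps_const (inverse q)) * (series_at h s * fps_const (v 0))
        = const_fps (fps_const (rho q)) * (series_at v s - const_fps s * series_at w s)"
proof -
  have shift_bracket: "shift (\<lambda>i. bracket x (f i)) = (\<lambda>i. bracket x (shift f i))"
     "shift (\<lambda>i. bracket (f i) x) = (\<lambda>i. bracket (shift f i) x)" for x and f :: "nat \<Rightarrow> 'r"
    by (auto simp: fun_eq_iff shift_def split: nat.split)
  show "const_fps (fps_const (q2 q)) * (const_fps s * bracket (fps_const (w 0)) (series_at v s)) = series_at h s - series_at g s"
    "const_fps (fps_const (q2 q)) * (const_fps s * bracket (series_at w s) (fps_const (v 0))) = series_at h s - series_at g s"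
    by (simp_all only: series_at_linear const_mult_series_at[OF assms] shift_bracket wv0_all w0v_all)
qed (simp_all only: series_at_linear const_mult_series_at[OF assms] w0g_all hw0_all gv0_all v0h_all)

lemma double_relations:
  assumes s: "s $ 0 = 0" and t: "t $ 0 = 0"
  shows "bracket (series_at w s) (series_at w t) = 0" "bracket (series_at v s) (series_at v t) = 0"
    "bracket (series_at g s) (series_at g t) = 0" "bracket (series_at h s) (series_at h t) = 0"
    "bracket (series_at w s) (series_at v t) = bracket (series_at w t) (series_at v s)"
    "bracket (series_at h s) (series_at g t) = bracket (series_at h t) (series_at g s)"
    "const_fps s * bracket (series_at w s) (series_at g t) = const_fps t * bracket (series_at w t) (series_at g s)"
    "const_fps s * bracket (series_at w s) (series_at h t) = const_fps t * bracket (series_at w t) (series_at h s)"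
    "const_fps s * bracket (series_at v s) (series_at g t) = const_fps t * bracket (series_at v t) (series_at g s)"
    "const_fps s * bracket (series_at v s) (series_at h t) = const_fps t * bracket (series_at v t) (series_at h s)"
proof -
  have bil0: "double_series (\<lambda>i j. 0) s t = 0" by (rule fps_ext) (simp add: double_series_def)
  have flip: "bracket (series_at a t) (series_at b s) = - double_series (\<lambda>i j. bracket (b i) (a j)) s t" for a b
    unfolding bracket_series_at[OF s t, symmetric] by simp
  have flip': "const_fps t * bracket (series_at a t) (series_at b s) = - double_series (\<lambda>i j. bracket (b i) (shift a j)) s t" for a b
    unfolding bracket_series_at_shift(2)[OF s t, symmetric] by (simp add: algebra_simps)
  have eqI: "x = - y" if "x + y = 0" for x y :: "'r fps"
    using that by (simp add: eq_neg_iff_add_eq_0)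
  show "bracket (series_at w s) (series_at w t) = 0" "bracket (series_at v s) (series_at v t) = 0"
    "bracket (series_at g s) (series_at g t) = 0" "bracket (series_at h s) (series_at h t) = 0"
    by (simp_all only: bracket_series_at[OF s t] ww vv gg_all hh_all bil0)
  show "bracket (series_at w s) (series_at v t) = bracket (series_at w t) (series_at v s)"
    "bracket (series_at h s) (series_at g t) = bracket (series_at h t) (series_at g s)"
    unfolding flip by (rule eqI; simp only: bracket_series_at[OF s t] double_series_add wv hg_all bil0)+
  show "const_fps s * bracket (series_at w s) (series_at g t) = const_fps t * bracket (series_at w t) (series_at g s)"
    "const_fps s * bracket (series_at w s) (series_at h t) = const_fps t * bracket (series_at w t) (series_at h s)"
    "const_fps s * bracket (series_at v s) (series_at g t) = const_fps t * bracket (series_at v t) (series_at g s)"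
    "const_fps s * bracket (series_at v s) (series_at h t) = const_fps t * bracket (series_at v t) (series_at h s)"
    unfolding flip' by (rule eqI; simp only: bracket_series_at_shift(1)[OF s t] double_series_add wg_all wh_all vg_all vh_all bil0)+
qed

lemma fls_bracket: "bracket (fps_to_fls x) (fps_to_fls y) = fps_to_fls (bracket x y)"
  by (simp add: fls_times_fps_to_fls)

lemma scale_fls_const_fps: "scale_fls (fls_const c) (fps_to_fls x) = fps_to_fls (const_fps (fps_const c) * x)"
  using scale_fls_fps[of "fps_const c" x] by simp

lemma scale_fls_scale: "scale_fls a (scale_fls b x) = scale_fls (a * b) x"
  by (simp add: scale_fls_def const_fls_mult mult.assoc)

theorem currents:
  "currents scale_fls params (fls_const q) (fls_const (q2 q)) (fls_const (q - inverse q)) (fls_const (rho q))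
     (fls_const (w 0)) (fls_const (v 0)) (laurent_at w) (laurent_at v) (laurent_at g) (laurent_at h)"
proof -
  interpret F: typed_algebra scale_fls by (rule typed_algebra_fls)
  let ?q = "fls_const q"
  have q: "?q \<noteq> 0" using q0 by simp
  have b0: "fls_const (q2 q) \<noteq> 0" using q2_nonzero by simp
  have inv: "fls_const (inverse q) = 1 / ?q"
    using q0 by (simp add: fls_inverse_const divide_inverse)
  note fps_rules = fls_bracket scale_fls_fps scale_fls_const_fps fls_times_fps_to_fls[symmetric]
     fps_to_fls_minus[symmetric] fps_to_fls_plus[symmetric] fps_const_to_fls[symmetric]
  show ?thesis
  proof (intro currents.intro[OF typed_algebra_fls] currents_axioms.intro)
    show "?q \<noteq> 0" "fls_const (q2 q) \<noteq> 0" by fact+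
    show "fls_const (q - inverse q) \<noteq> 0" using q_diff_nonzero by simp
    show "fls_const (q2 q) = ?q + 1 / ?q" unfolding inv[symmetric] by (simp add: q2_def fls_plus_const)
    show "fls_const (q - inverse q) = ?q - 1 / ?q" unfolding inv[symmetric] by (simp add: fls_minus_const)
    show "fls_const (rho q) = - (fls_const (q2 q) * fls_const (q - inverse q))\<^sup>2"
      by (simp add: rho_eq power2_eq_square fls_const_mult_const)
    show "0 \<notin> params" by (auto simp: params_def)
  next
    fix x assume "x \<in> params"
    then obtain s where s: "s $ 0 = 0" "s \<noteq> 0" and x: "x = fps_to_fls s" by (auto simp: params_def)
    then have x0: "x \<noteq> 0" by simp
    show "fls_const (w 0) * laurent_at w x = laurent_at w x * fls_const (w 0)"
      unfolding x laurent_at_fps fps_const_to_fls[symmetric] fls_times_fps_to_fls[symmetric] series_at_linear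
      using ww[of 0] by simp
    show "fls_const (v 0) * laurent_at v x = laurent_at v x * fls_const (v 0)"
      unfolding x laurent_at_fps fps_const_to_fls[symmetric] fls_times_fps_to_fls[symmetric] series_at_linear
      using vv[of 0] by simp
    have 1: "bracket W V = scale_fls (1 / (x * fls_const (q2 q))) Y"
      if "scale_fls (fls_const (q2 q)) (scale_fls x (bracket W V)) = Y" for W V Y
    proof -
      have "scale_fls (1 / (x * fls_const (q2 q))) Y = bracket W V"
        unfolding that[symmetric] scale_fls_scale using x0 b0 by (simp add: mult.commute)
      then show ?thesis ..
    qed
    have "scale_fls (fls_const (q2 q)) (scale_fls x (bracket (fls_const (w 0)) (laurent_at v x))) = laurent_at h x - laurent_at g x"
      unfolding x laurent_at_fps by (simp only: fps_rules series_relations[OF s(1)])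
    from 1[OF this] show "fls_const (w 0) * laurent_at v x = laurent_at v x * fls_const (w 0)
        + scale_fls (1 / (x * fls_const (q2 q))) (laurent_at h x - laurent_at g x)"
      by (simp add: algebra_simps)
    have "scale_fls (fls_const (q2 q)) (scale_fls x (bracket (laurent_at w x) (fls_const (v 0)))) = laurent_at h x - laurent_at g x"
      unfolding x laurent_at_fps by (simp only: fps_rules series_relations[OF s(1)])
    from 1[OF this] show "fls_const (v 0) * laurent_at w x = laurent_at w x * fls_const (v 0)
        + scale_fls (1 / (x * fls_const (q2 q))) (laurent_at g x - laurent_at h x)"
      by (simp add: algebra_simps F.expand)
    have 2: "A = scale_fls (1 / ?q\<^sup>2) B + scale_fls (fls_const (rho q) / ?q) C"
         "B = scale_fls (?q\<^sup>2) A - scale_fls (fls_const (rho q) * ?q) C"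
      if "scale_fls ?q A - scale_fls (fls_const (inverse q)) B = scale_fls (fls_const (rho q)) C" for A B C
    proof -
      have "scale_fls (1 / ?q) (scale_fls ?q A - scale_fls (1 / ?q) B) = scale_fls (1 / ?q) (scale_fls (fls_const (rho q)) C)"
        using that unfolding inv by simp
      then show "A = scale_fls (1 / ?q\<^sup>2) B + scale_fls (fls_const (rho q) / ?q) C"
        using q by (simp add: F.expand power2_eq_square algebra_simps)
      have "scale_fls ?q (scale_fls ?q A - scale_fls (1 / ?q) B) = scale_fls ?q (scale_fls (fls_const (rho q)) C)"
        using that unfolding inv by simp
      then show "B = scale_fls (?q\<^sup>2) A - scale_fls (fls_const (rho q) * ?q) C"
        using q by (simp add: F.expand power2_eq_square algebra_simps)
    qed
    have "scale_fls ?q (fls_const (w 0) * laurent_at g x) - scale_fls (fls_const (inverse q)) (laurent_at g x * fls_const (w 0))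
        = scale_fls (fls_const (rho q)) (laurent_at w x - scale_fls x (laurent_at v x))"
      unfolding x laurent_at_fps by (simp only: fps_rules series_relations[OF s(1)])
    from 2(1)[OF this] show "fls_const (w 0) * laurent_at g x = scale_fls (1 / ?q\<^sup>2) (laurent_at g x * fls_const (w 0))
        + scale_fls (fls_const (rho q) / ?q) (laurent_at w x - scale_fls x (laurent_at v x))" .
    have "scale_fls ?q (laurent_at h x * fls_const (w 0)) - scale_fls (fls_const (inverse q)) (fls_const (w 0) * laurent_at h x)
        = scale_fls (fls_const (rho q)) (laurent_at w x - scale_fls x (laurent_at v x))"
      unfolding x laurent_at_fps by (simp only: fps_rules series_relations[OF s(1)])
    from 2(2)[OF this] show "fls_const (w 0) * laurent_at h x = scale_fls (?q\<^sup>2) (laurent_at h x * fls_const (w 0))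
        - scale_fls (fls_const (rho q) * ?q) (laurent_at w x - scale_fls x (laurent_at v x))" .
    have "scale_fls ?q (laurent_at g x * fls_const (v 0)) - scale_fls (fls_const (inverse q)) (fls_const (v 0) * laurent_at g x)
        = scale_fls (fls_const (rho q)) (laurent_at v x - scale_fls x (laurent_at w x))"
      unfolding x laurent_at_fps by (simp only: fps_rules series_relations[OF s(1)])
    from 2(2)[OF this] show "fls_const (v 0) * laurent_at g x = scale_fls (?q\<^sup>2) (laurent_at g x * fls_const (v 0))
        - scale_fls (fls_const (rho q) * ?q) (laurent_at v x - scale_fls x (laurent_at w x))" .
    have "scale_fls ?q (fls_const (v 0) * laurent_at h x) - scale_fls (fls_const (inverse q)) (laurent_at h x * fls_const (v 0))
        = scale_fls (fls_const (rho q)) (laurent_at v x - scale_fls x (laurent_at w x))"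
      unfolding x laurent_at_fps by (simp only: fps_rules series_relations[OF s(1)])
    from 2(1)[OF this] show "fls_const (v 0) * laurent_at h x = scale_fls (1 / ?q\<^sup>2) (laurent_at h x * fls_const (v 0))
        + scale_fls (fls_const (rho q) / ?q) (laurent_at v x - scale_fls x (laurent_at w x))" .
  next
    fix x y assume "x \<in> params" "y \<in> params"
    then obtain s t where s: "s $ 0 = 0" "s \<noteq> 0" and x: "x = fps_to_fls s"
      and t: "t $ 0 = 0" "t \<noteq> 0" and y: "y = fps_to_fls t" by (auto simp: params_def)
    note e = double_relations[OF s(1) t(1)]
    show "laurent_at w x * laurent_at w y = laurent_at w y * laurent_at w x" "laurent_at v x * laurent_at v y = laurent_at v y * laurent_at v x"
       "laurent_at g x * laurent_at g y = laurent_at g y * laurent_at g x" "laurent_at h x * laurent_at h y = laurent_at h y * laurent_at h x"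
      unfolding x y laurent_at_fps using e(1-4) by (simp_all add: fls_times_fps_to_fls[symmetric])
    show "bracket (laurent_at w x) (laurent_at v y) = bracket (laurent_at w y) (laurent_at v x)"
      "bracket (laurent_at h x) (laurent_at g y) = bracket (laurent_at h y) (laurent_at g x)"
      "scale_fls x (bracket (laurent_at w x) (laurent_at g y)) = scale_fls y (bracket (laurent_at w y) (laurent_at g x))"
      "scale_fls x (bracket (laurent_at w x) (laurent_at h y)) = scale_fls y (bracket (laurent_at w y) (laurent_at h x))"
      "scale_fls x (bracket (laurent_at v x) (laurent_at g y)) = scale_fls y (bracket (laurent_at v y) (laurent_at g x))"
      "scale_fls x (bracket (laurent_at v x) (laurent_at h y)) = scale_fls y (bracket (laurent_at v y) (laurent_at h x))"
      unfolding x y laurent_at_fps fls_bracket scale_fls_fps e by (rule refl)+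
  qed
qed

end

section \<open>Centrality of the coefficients of the determinant\<close>

context typed_algebra begin

text \<open>
  The series \<open>Z(t)\<close>, with \<open>T\<close> written as the series \<open>S\<close> for \<open>q\<^sup>-\<^sup>1\<close>.
\<close>

definition det_fps :: "'k \<Rightarrow> (nat \<Rightarrow> 'r) \<Rightarrow> (nat \<Rightarrow> 'r) \<Rightarrow> (nat \<Rightarrow> 'r) \<Rightarrow> (nat \<Rightarrow> 'r) \<Rightarrow> 'r fps" where
  "det_fps q w v g h =
    (let S = S_series q; T = S_series (inverse q) in
     const_fps (fps_shift 1 (S * T)) * (series_at w S * series_at v T)
     + const_fps (fps_X * S * T) * (series_at v S * series_at w T)
     - const_fps (fps_const (q\<^sup>2) * S * T) * (series_at w S * series_at w T)
     - const_fps (fps_const (inverse q ^ 2) * S * T) * (series_at v S * series_at v T)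
     + const_fps (fps_const (inverse ((q\<^sup>2 - inverse q ^ 2)\<^sup>2))) * (series_at g S * series_at h T))"

end

lemma q2_inverse [simp]: "q2 (inverse q) = q2 q"
  by (simp add: q2_def add.commute)

lemma T_series_conv_S_series: "T_series q = S_series (inverse q)"
  unfolding T_series_def S_series_def q2_inverse inverse_inverse_eq ..

lemma S_series_nth_0 [simp]: "S_series q $ 0 = 0"
  and S_series_nth_1 [simp]: "S_series q $ Suc 0 = q2 q * inverse q"
  by (simp_all add: S_series_def)

context alternating begin

lemma S_in_params: "fps_to_fls (S_series q) \<in> params" "fps_to_fls (S_series (inverse q)) \<in> params"
proof -
  have "S_series q $ 1 \<noteq> 0" "S_series (inverse q) $ 1 \<noteq> 0"
    using q0 q2_nonzero by simp_all
  then have "S_series q \<noteq> 0" "S_series (inverse q) \<noteq> 0" by (metis fps_zero_nth)+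
  then show "fps_to_fls (S_series q) \<in> params" "fps_to_fls (S_series (inverse q)) \<in> params"
    by (auto simp: params_def)
qed

lemma determinant:
  "determinant scale_fls params (fls_const q) (fls_const (q2 q)) (fls_const (q - inverse q)) (fls_const (rho q))
     (fls_const (w 0)) (fls_const (v 0)) (laurent_at w) (laurent_at v) (laurent_at g) (laurent_at h)
     fls_X (fps_to_fls (S_series q)) (fps_to_fls (S_series (inverse q)))"
proof (intro determinant.intro[OF currents] determinant_axioms.intro S_in_params)
  have inv: "fls_const (inverse q) = 1 / fls_const q"
    using q0 by (simp add: fls_inverse_const divide_inverse)
  note fps_rules = fls_times_fps_to_fls[symmetric]
     fps_to_fls_minus[symmetric] fps_to_fls_plus[symmetric] fps_const_to_fls[symmetric] fps_X_to_fls[symmetric]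
  show "(fls_X :: 'k fls) \<noteq> 0" by simp
  have "fps_X\<^sup>2 $ 2 \<noteq> (1 :: 'k fps) $ 2" by (simp add: fps_X_power_nth)
  then have "fps_X\<^sup>2 \<noteq> (1 :: 'k fps)" by metis
  then have "fps_to_fls (fps_X\<^sup>2) \<noteq> fps_to_fls (1 :: 'k fps)" by (simp only: fps_to_fls_eq_iff not_False_eq_True)
  moreover have "fps_to_fls (fps_X\<^sup>2) = (fls_X\<^sup>2 :: 'k fls)" by (simp add: fps_to_fls_power)
  ultimately show "fls_X\<^sup>2 \<noteq> (1 :: 'k fls)" by simp
  have "fps_to_fls (S_series q) * (fls_X\<^sup>2 * fls_const (inverse q) + fls_const q)
      = fps_to_fls ((fps_const (inverse q) * fps_X\<^sup>2 + fps_const q) * S_series q)"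
    by (simp add: fls_times_fps_to_fls fps_to_fls_power algebra_simps)
  also have "\<dots> = fls_const (q2 q) * fls_X"
    unfolding S_series_eq[OF q0] by (simp add: fls_times_fps_to_fls)
  finally show "fps_to_fls (S_series q) * (fls_X\<^sup>2 / fls_const q + fls_const q) = fls_const (q2 q) * fls_X"
    unfolding inv by (simp add: mult.commute)
  have "fps_to_fls (S_series (inverse q)) * (fls_const q * fls_X\<^sup>2 + fls_const (inverse q))
      = fps_to_fls ((fps_const q * fps_X\<^sup>2 + fps_const (inverse q)) * T_series q)"
    by (simp add: fls_times_fps_to_fls fps_to_fls_power algebra_simps T_series_conv_S_series)
  also have "\<dots> = fls_const (q2 q) * fls_X"
    unfolding T_series_eq[OF q0] by (simp add: fls_times_fps_to_fls)
  finally show "fps_to_fls (S_series (inverse q)) * (fls_const q * fls_X\<^sup>2 + 1 / fls_const q) = fls_const (q2 q) * fls_X"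
    unfolding inv .
qed

definition Z where "Z = det_fps q w v g h"

lemma rho_eq': "rho q = - ((q\<^sup>2 - inverse q ^ 2)\<^sup>2)"
  by (simp add: rho_def)

lemma rho_nonzero: "rho q \<noteq> 0"
  using q2_nonzero q_diff_nonzero by (simp add: rho_eq)

sublocale D: determinant scale_fls params "fls_const q" "fls_const (q2 q)" "fls_const (q - inverse q)" "fls_const (rho q)"
     "fls_const (w 0)" "fls_const (v 0)" "laurent_at w" "laurent_at v" "laurent_at g" "laurent_at h"
     fls_X "fps_to_fls (S_series q)" "fps_to_fls (S_series (inverse q))"
  by (rule determinant)

lemma fps_to_fls_Z: "fps_to_fls Z = D.Z"
proof -
  let ?S = "S_series q" and ?T = "S_series (inverse q)"
  let ?s = "fps_to_fls ?S" and ?t = "fps_to_fls ?T"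
  have sh: "fps_to_fls (fps_shift 1 (?S * ?T)) = 1 / fls_X * ?s * ?t"
  proof -
    have "?S * ?T = fps_X * fps_shift 1 (?S * ?T)"
      by (rule fps_ext) (simp add: fps_X_mult_nth fps_mult_nth_0)
    then have "?s * ?t = fls_X * fps_to_fls (fps_shift 1 (?S * ?T))"
      by (metis fls_times_fps_to_fls fps_X_to_fls)
    moreover have "fls_X \<noteq> (0 :: 'k fls)" by simp
    ultimately show ?thesis
      by (simp only: mult.assoc times_divide_eq_left mult_1 nonzero_mult_div_cancel_left not_False_eq_True)
  qed
  have inv: "fls_const (inverse q) = 1 / fls_const q"
    using q0 by (simp add: fls_inverse_const divide_inverse)
  have inv2: "fls_const (inverse q ^ 2) = 1 / (fls_const q)\<^sup>2"
    by (simp only: fls_const_power inv) (simp add: power_divide)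
  have invr: "fls_const (inverse ((q\<^sup>2 - inverse q ^ 2)\<^sup>2)) = - (1 / fls_const (rho q))"
    by (simp add: rho_eq' fls_inverse_const divide_inverse)
  have q2: "fls_const (q\<^sup>2) = (fls_const q)\<^sup>2" by (simp add: fls_const_power)
  have "fps_to_fls Z = scale_fls (1 / fls_X * ?s * ?t) (laurent_at w ?s * laurent_at v ?t)
    + scale_fls (fls_X * ?s * ?t) (laurent_at v ?s * laurent_at w ?t)
    - scale_fls ((fls_const q)\<^sup>2 * ?s * ?t) (laurent_at w ?s * laurent_at w ?t)
    - scale_fls (1 / (fls_const q)\<^sup>2 * ?s * ?t) (laurent_at v ?s * laurent_at v ?t)
    + scale_fls (- (1 / fls_const (rho q))) (laurent_at g ?s * laurent_at h ?t)"
    unfolding sh[symmetric] inv2[symmetric] invr[symmetric] unfolding q2[symmetric]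
    by (simp only: Z_def det_fps_def Let_def laurent_at_fps fps_X_to_fls[symmetric] fps_const_to_fls[symmetric]
      fls_times_fps_to_fls[symmetric] scale_fls_fps fps_to_fls_plus[symmetric] fps_to_fls_minus[symmetric])
  also have "\<dots> = D.Z"
    unfolding D.Z_expand ..
  finally show ?thesis .
qed

lemma commutes_Z_0: "w 0 * (Z $ n) = Z $ n * w 0" "v 0 * (Z $ n) = Z $ n * v 0"
proof -
  have "fps_to_fls (fps_const (w 0) * Z) = fps_to_fls (Z * fps_const (w 0))"
    "fps_to_fls (fps_const (v 0) * Z) = fps_to_fls (Z * fps_const (v 0))"
    using D.W0_Z D.W1_Z unfolding fls_times_fps_to_fls fps_to_fls_Z by simp_all
  then have "(fps_const (w 0) * Z) $ n = (Z * fps_const (w 0)) $ n" 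
    "(fps_const (v 0) * Z) $ n = (Z * fps_const (v 0)) $ n" by (simp_all only: fps_to_fls_eq_iff)
  then show "w 0 * (Z $ n) = Z $ n * w 0" "v 0 * (Z $ n) = Z $ n * v 0" by simp_all
qed

lemma series_at_X: "series_at (fps_nth f) fps_X = f"
  by (rule fps_ext) (simp add: series_at_def fps_X_power_nth if_distrib[of "\<lambda>c. c *s _"] cong: if_cong)

text \<open>
  The parameter \<open>r\<close> is taken to be a power \<open>t\<^sup>N\<close> of the variable. If \<open>N\<close> exceeds \<open>n\<close>, the coefficient of
  \<open>t\<^sup>N\<^sup>k\<^sup>+\<^sup>n\<close> separates the contribution of \<open>g k\<close> and \<open>Z\<^sub>n\<close> from those of the letters \<open>g i\<close> with \<open>i > k\<close>; those
  with \<open>i < k\<close> vanish by induction. The bound \<open>N \<ge> 2\<close> keeps \<open>r\<close> different from \<open>S\<close> and \<open>T\<close>, whose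
  order is \<open>1\<close>.
\<close>

lemma commutes_Z_g: "bracket (g k) (Z $ n) = 0"
proof (induction k arbitrary: n rule: less_induct)
  case (less k)
  define N where "N = n + 2"
  have N: "N \<ge> 2" "N > n" by (simp_all add: N_def)
  have X0: "(fps_X ^ N) $ 0 = (0 :: 'k)" using N by (simp add: fps_X_power_nth)
  have X00: "fps_X $ 0 = (0 :: 'k)" by simp
  have X1: "(fps_X ^ N) $ 1 = (0 :: 'k)" using N by (simp add: fps_X_power_nth)
  have ne: "fps_X ^ N \<noteq> S_series q" "fps_X ^ N \<noteq> S_series (inverse q)"
  proof -
    have "S_series q $ 1 \<noteq> 0" "S_series (inverse q) $ 1 \<noteq> 0" using q0 q2_nonzero by simp_all
    then show "fps_X ^ N \<noteq> S_series q" "fps_X ^ N \<noteq> S_series (inverse q)" using X1 by metis+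
  qed
  have "fps_to_fls (fps_X ^ N) \<in> params" using X0 by (auto simp: params_def)
  from D.g_Z[OF this] ne have "laurent_at g (fps_to_fls (fps_X ^ N)) * D.Z = D.Z * laurent_at g (fps_to_fls (fps_X ^ N))"
    by (simp only: fps_to_fls_eq_iff not_False_eq_True)
  then have "fps_to_fls (series_at g (fps_X ^ N) * Z) = fps_to_fls (Z * series_at g (fps_X ^ N))"
    unfolding fls_times_fps_to_fls fps_to_fls_Z by simp
  then have "bracket (series_at g (fps_X ^ N)) (series_at (fps_nth Z) fps_X) = 0"
    unfolding series_at_X fps_to_fls_eq_iff by simp
  then have "double_series (\<lambda>i j. bracket (g i) (Z $ j)) (fps_X ^ N) fps_X = 0"
    by (simp only: bracket_series_at[OF X0 X00])
  then have "0 = double_series (\<lambda>i j. bracket (g i) (Z $ j)) (fps_X ^ N) fps_X $ (N * k + n)" by simp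
  also have "\<dots> = (\<Sum>i\<le>N * k + n. \<Sum>j\<le>N * k + n. if N * i + j = N * k + n then bracket (g i) (Z $ j) else 0)"
    unfolding double_series_def fps_nth_Abs_fps
    by (intro sum.cong refl) (simp add: power_mult[symmetric] power_add[symmetric] fps_X_power_nth)
  also have "\<dots> = (\<Sum>i\<le>N * k + n. if i = k then bracket (g k) (Z $ n) else 0)"
  proof (rule sum.cong[OF refl])
    fix i
    consider "i < k" | "i = k" | "i > k" by linarith
    then show "(\<Sum>j\<le>N * k + n. if N * i + j = N * k + n then bracket (g i) (Z $ j) else 0)
      = (if i = k then bracket (g k) (Z $ n) else 0)"
    proof cases
      case 1
      then show ?thesis using less by (simp cong: if_cong)
    next
      case 2
      then show ?thesis by simp
    next
      case 3
      then have "N * k + N \<le> N * i" by (metis Suc_leI mult_Suc_right mult_le_mono2 add.commute)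
      then have "N * i + j \<noteq> N * k + n" for j using N by linarith
      then show ?thesis using 3 by simp
    qed
  qed
  also have "\<dots> = bracket (g k) (Z $ n)"
    using N by (simp add: trans_le_add1)
  finally show ?case by simp
qed

text \<open>
  The relations of \<open>w 0\<close> and \<open>v 0\<close> with \<open>g (Suc k)\<close> produce the letters with the next index.
\<close>

lemma commutes_Z_wv: "w k * (Z $ n) = Z $ n * w k \<and> v k * (Z $ n) = Z $ n * v k"
proof (induction k)
  case 0
  then show ?case using commutes_Z_0 by simp
next
  case (Suc k)
  let ?z = "Z $ n"
  define C where "C = {x. x * ?z = ?z * x}"
  have C: "x + y \<in> C" "x - y \<in> C" "x * y \<in> C" if "x \<in> C" "y \<in> C" for x y
  proof -
    show "x + y \<in> C" "x - y \<in> C" using that by (simp_all add: C_def algebra_simps)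
    show "x * y \<in> C" using that by (simp add: C_def) (metis mult.assoc)
  qed
  have C_scale: "c *s x \<in> C" if "x \<in> C" for x c using that by (simp add: C_def)
  have "w 0 \<in> C" "v 0 \<in> C" "g (Suc k) \<in> C" "w k \<in> C" "v k \<in> C"
    using commutes_Z_0 commutes_Z_g[of "Suc k" n] Suc by (simp_all add: C_def)
  then have "rho q *s w (Suc k) - rho q *s v k \<in> C" "rho q *s v (Suc k) - rho q *s w k \<in> C"
    unfolding w0g[symmetric] gv0[symmetric] by (simp_all add: C C_scale)
  then have "(1 / rho q) *s (rho q *s w (Suc k) - rho q *s v k) + v k \<in> C"
    "(1 / rho q) *s (rho q *s v (Suc k) - rho q *s w k) + w k \<in> C"
    using \<open>v k \<in> C\<close> \<open>w k \<in> C\<close> by (simp_all add: C C_scale)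
  then have "w (Suc k) \<in> C" "v (Suc k) \<in> C"
    using rho_nonzero by (simp_all add: scale_right_diff_distrib)
  then show ?case by (simp add: C_def)
qed

lemma h_eq: "h (Suc k) = g (Suc k) + q2 q *s bracket (w 0) (v k)"
  unfolding wv0 using q2_nonzero by simp

lemma commutes_Z:
  "w k * (Z $ n) = Z $ n * w k" "v k * (Z $ n) = Z $ n * v k"
  "g k * (Z $ n) = Z $ n * g k" "h k * (Z $ n) = Z $ n * h k"
proof -
  show w: "w k * (Z $ n) = Z $ n * w k" and v: "v k * (Z $ n) = Z $ n * v k" for k
    using commutes_Z_wv by auto
  show g: "g k * (Z $ n) = Z $ n * g k" for k using commutes_Z_g[of k n] by simp
  show "h k * (Z $ n) = Z $ n * h k"
  proof (cases k)
    case 0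
    then show ?thesis using g[of 0] h0 by simp
  next
    case (Suc m)
    have "x * y * Z $ n = Z $ n * (x * y)" if "x * Z $ n = Z $ n * x" "y * Z $ n = Z $ n * y" for x y
      using that(1) by (simp add: mult.assoc that(2)) (simp add: mult.assoc[symmetric])
    from this[OF w v] this[OF v w]
    have "w 0 * v m * Z $ n = Z $ n * (w 0 * v m)" "v m * w 0 * Z $ n = Z $ n * (v m * w 0)" .
    then show ?thesis unfolding Suc h_eq using g[of "Suc m"] by (simp add: algebra_simps)
  qed
qed

end

global_interpretation free: typed_algebra "scale :: 'f::field \<Rightarrow> ('g, 'f) free_alg \<Rightarrow> ('g, 'f) free_alg"
proof
  interpret F_algebra "free_algebra :: ('f, ('g, 'f) free_alg) module" by (rule F_algebra_free_algebra)
  fix c :: 'f and x y :: "('g, 'f) free_alg"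
  show "(c \<bullet> x) * y = c \<bullet> (x * y)" using smult_assoc2[of x y c] by (simp add: free_algebra_def)
  show "x * (c \<bullet> y) = c \<bullet> (x * y)" using smult_assoc3[of x y c] by (simp add: free_algebra_def)
qed

lemma scalar_fps_eq: "scalar_fps = free.const_fps"
  by (simp add: fun_eq_iff scalar_fps_def free.const_fps_def)

text \<open>
  Multiplicative linear maps from the free algebra; they need not preserve the unit.
\<close>

locale free_hom = typed_algebra scale for scale :: "'k::field \<Rightarrow> 'r::ring_1 \<Rightarrow> 'r"  (infixr \<open>*s\<close> 75) +
  fixes \<theta> :: "'k alt_free \<Rightarrow> 'r"
  assumes hom_add: "\<theta> (x + y) = \<theta> x + \<theta> y" and hom_mult: "\<theta> (x * y) = \<theta> x * \<theta> y" and hom_scale: "\<theta> (c \<bullet> x) = c *s \<theta> x"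
begin

lemma hom_0: "\<theta> 0 = 0" using hom_add[of 0 0] by simp
lemma hom_uminus: "\<theta> (- x) = - \<theta> x" using hom_add[of "- x" x] hom_0 by (simp add: eq_neg_iff_add_eq_0)
lemma hom_diff: "\<theta> (x - y) = \<theta> x - \<theta> y" using hom_add[of x "- y"] hom_uminus by simp
lemma hom_sum: "\<theta> (sum f I) = (\<Sum>i\<in>I. \<theta> (f i))"
  by (induction I rule: infinite_finite_induct) (simp_all add: hom_0 hom_add)

definition series_image :: "'k alt_free fps \<Rightarrow> 'r fps" where "series_image f = Abs_fps (\<lambda>n. \<theta> (f $ n))"

lemma series_image_simps:
  "series_image (f + g) = series_image f + series_image g" "series_image (f - g) = series_image f - series_image g" "series_image (f * g) = series_image f * series_image g"
  by (rule fps_ext, simp add: series_image_def hom_add hom_diff fps_mult_nth hom_sum hom_mult)+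

lemma series_image_scalar: "series_image (free.const_fps c * f) = const_fps c * series_image f"
  by (rule fps_ext) (simp add: series_image_def free.const_fps_mult_nth const_fps_mult_nth hom_sum hom_scale)

lemma series_image_compose: "series_image (Abs_fps a oo free.const_fps s) = series_at (\<lambda>n. \<theta> (a n)) s"
  by (rule fps_ext) (simp add: series_image_def fps_compose_nth series_at_def free.const_fps_power[symmetric] hom_sum hom_scale atLeast0AtMost)

lemma hom_Z: "series_image (Z_series q) = det_fps q (\<lambda>k. \<theta> (W (- int k))) (\<lambda>k. \<theta> (W (int k + 1))) (\<lambda>k. \<theta> (G q k)) (\<lambda>k. \<theta> (Gt q k))"
proof -
  have shift: "fps_shift 1 (free.const_fps c) = free.const_fps (fps_shift 1 c)" for c :: "'k fps"
    by (rule fps_ext) simp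
  have X: "fps_X = (free.const_fps fps_X :: 'k alt_free fps)"
    by (rule fps_ext) simp
  have C: "fps_const (c \<bullet> 1) = (free.const_fps (fps_const c) :: 'k alt_free fps)" for c :: 'k
    by (rule fps_ext) simp
  show ?thesis
    unfolding Z_series_def Let_def scalar_fps_eq C X T_series_conv_S_series
      free.const_fps_simps(3)[of "S_series q" "S_series (inverse q)", symmetric] shift mult.assoc
      series_image_simps(1,2) series_image_scalar Wminus_series_def Wplus_series_def G_series_def Gt_series_def
    unfolding series_image_simps(3) series_image_compose
    by (simp add: det_fps_def Let_def mult.assoc const_fps_simps)
qed

end

section \<open>A ring type that contains the algebra\<close>

lemma carrier_free [simp]: "carrier free_algebra = UNIV" and zero_free [simp]: "\<zero>\<^bsub>free_algebra\<^esub> = 0"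
  and add_free [simp]: "x \<oplus>\<^bsub>free_algebra\<^esub> y = x + y" and mult_free [simp]: "x \<otimes>\<^bsub>free_algebra\<^esub> y = x * y"
  and one_free [simp]: "\<one>\<^bsub>free_algebra\<^esub> = 1" and smult_free [simp]: "c \<odot>\<^bsub>free_algebra\<^esub> x = c \<bullet> x"
  by (simp_all add: free_algebra_def)

lemma ring_free_algebra: "ring (free_algebra :: ('f::field, ('g, 'f) free_alg) module)"
  using F_algebra_free_algebra by (rule F_algebra.axioms)

lemma a_inv_free: "\<ominus>\<^bsub>free_algebra\<^esub> x = - (x :: ('g, 'f::field) free_alg)"
proof -
  interpret ring "free_algebra :: ('f, ('g, 'f) free_alg) module" by (rule ring_free_algebra)
  show ?thesis by (rule minus_equality) simp_all
qed

definition rel_ideal :: "'f::field \<Rightarrow> 'f alt_free set" where "rel_ideal q = relator_ideal (alt_rel q)"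

lemma ideal_rel: "ideal (rel_ideal q) free_algebra"
proof -
  interpret ring "free_algebra :: ('a, 'a alt_free) module" by (rule ring_free_algebra)
  show ?thesis unfolding rel_ideal_def relator_ideal_def by (rule genideal_ideal) simp
qed

lemma rel_in_ideal: "alt_rel q x y \<Longrightarrow> x - y \<in> rel_ideal q"
proof -
  assume r: "alt_rel q x y"
  interpret ring "free_algebra :: ('a, 'a alt_free) module" by (rule ring_free_algebra)
  show ?thesis unfolding rel_ideal_def relator_ideal_def
    by (rule subsetD[OF genideal_self]) (use r in auto)
qed

lemma (in free_hom) ker_ideal:
  assumes "\<And>x y. alt_rel q x y \<Longrightarrow> \<theta> x = \<theta> y" "x \<in> rel_ideal q"
  shows "\<theta> x = 0"
proof -
  interpret ring "free_algebra :: ('k, 'k alt_free) module" by (rule ring_free_algebra)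
  have "ideal {x. \<theta> x = 0} free_algebra"
  proof (rule idealI[OF ring_free_algebra])
    show "subgroup {x. \<theta> x = 0} (add_monoid free_algebra)"
    proof (rule subgroup.intro)
      fix x assume "x \<in> {x. \<theta> x = 0}"
      then show "inv\<^bsub>add_monoid free_algebra\<^esub> x \<in> {x. \<theta> x = 0}"
        unfolding a_inv_free[unfolded a_inv_def] by (simp add: hom_uminus)
    qed (auto simp: hom_add hom_0)
  qed (auto simp: hom_mult)
  then have "rel_ideal q \<subseteq> {x. \<theta> x = 0}"
    unfolding rel_ideal_def relator_ideal_def
    by (rule genideal_minimal) (auto simp: hom_diff assms(1))
  then show ?thesis using assms(2) by auto
qed

lemma lookup_mult_zero: "Poly_Mapping.lookup (x * y) 0 = Poly_Mapping.lookup x 0 * Poly_Mapping.lookup y 0"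
  for x y :: "('g, 'f::field) free_alg"
proof -
  have upd: "Poly_Mapping.update a b f = f + Poly_Mapping.single a b" if "a \<notin> Poly_Mapping.keys f" for a b and f :: "('g, 'f) free_alg"
    using that by (intro poly_mapping_eqI)
      (auto simp: Poly_Mapping.lookup_update lookup_add lookup_single in_keys_iff when_def)
  have m0: "a + b = 0 \<longleftrightarrow> a = 0 \<and> b = 0" for a b :: "'g fmon"
    by (cases a; cases b) (auto simp: zero_fmon_def)
  have 1: "Poly_Mapping.lookup (Poly_Mapping.single a b * y) 0 = Poly_Mapping.lookup (Poly_Mapping.single a b) 0 * Poly_Mapping.lookup y 0" for a b
  proof (induction y rule: update_induct)
    case const
    then show ?case by simp
  next
    case (update f a' b')
    then show ?case by (simp add: upd ring_distribs mult_single lookup_add lookup_single m0 when_def)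
  qed
  show ?thesis
  proof (induction x rule: update_induct)
    case const
    then show ?case by simp
  next
    case (update f a' b')
    then show ?case by (simp add: upd ring_distribs lookup_add 1)
  qed
qed

text \<open>
  No relation has a constant term, so the augmentation of the free algebra vanishes on the ideal.
\<close>

lemma one_notin_rel_ideal: "1 \<notin> rel_ideal q"
proof
  assume 1: "1 \<in> rel_ideal q"
  interpret free_hom "(*)" "\<lambda>x. Poly_Mapping.lookup x 0"
    by unfold_locales (simp_all add: lookup_add lookup_mult_zero algebra_simps)
  have gen0: "Poly_Mapping.lookup (gen x) 0 = 0" for x :: alt_gen
    by (simp add: gen_def lookup_single zero_fmon_def)
  have "Poly_Mapping.lookup x 0 = Poly_Mapping.lookup y 0" if "alt_rel q x y" for x y
    using that by cases (simp_all add: comm_def qcomm_def lookup_add lookup_minus lookup_mult_zero W_def G_def Gt_def gen0)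
  from ker_ideal[OF this 1] show False by (simp add: lookup_one)
qed

lemma Aq_simps:
  "\<zero>\<^bsub>Aq q\<^esub> = rel_ideal q" "\<one>\<^bsub>Aq q\<^esub> = to_Aq q 1" "carrier (Aq q) = range (to_Aq q)"
  "to_Aq q x \<oplus>\<^bsub>Aq q\<^esub> to_Aq q y = to_Aq q (x + y)" "to_Aq q x \<otimes>\<^bsub>Aq q\<^esub> to_Aq q y = to_Aq q (x * y)"
  "c \<odot>\<^bsub>Aq q\<^esub> to_Aq q x = to_Aq q (c \<bullet> x)"
proof -
  interpret F_algebra "free_algebra :: ('a, 'a alt_free) module" by (rule F_algebra_free_algebra)
  interpret I: ideal "rel_ideal q" free_algebra by (rule ideal_rel)
  have A: "Aq q = alg_quot free_algebra (rel_ideal q)" by (simp add: Aq_def presented_algebra_def rel_ideal_def)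
  show "\<zero>\<^bsub>Aq q\<^esub> = rel_ideal q" "\<one>\<^bsub>Aq q\<^esub> = to_Aq q 1"
    by (simp_all add: A alg_quot_def FactRing_def to_Aq_def rel_ideal_def[symmetric])
  show "carrier (Aq q) = range (to_Aq q)"
    by (auto simp: A alg_quot_def FactRing_def A_RCOSETS_def' to_Aq_def rel_ideal_def[symmetric])
  show "to_Aq q x \<oplus>\<^bsub>Aq q\<^esub> to_Aq q y = to_Aq q (x + y)" "to_Aq q x \<otimes>\<^bsub>Aq q\<^esub> to_Aq q y = to_Aq q (x * y)"
    using I.a_rcos_sum[of x y] I.rcoset_mult_add[of x y]
    by (simp_all add: A alg_quot_def FactRing_def to_Aq_def rel_ideal_def[symmetric])
  show "c \<odot>\<^bsub>Aq q\<^esub> to_Aq q x = to_Aq q (c \<bullet> x)"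
    using smult_coset[OF ideal_rel[of q], of x c] by (simp add: A to_Aq_def rel_ideal_def[symmetric])
qed

lemma to_Aq_eq_iff: "to_Aq q x = to_Aq q y \<longleftrightarrow> x - y \<in> rel_ideal q"
proof -
  interpret F_algebra "free_algebra :: ('a, 'a alt_free) module" by (rule F_algebra_free_algebra)
  interpret I: ideal "rel_ideal q" free_algebra by (rule ideal_rel)
  show ?thesis
    using quotient_eq_iff_same_a_r_cos[OF ideal_rel[of q], of x y]
    by (simp add: to_Aq_def rel_ideal_def[symmetric] a_minus_def a_inv_free)
qed

lemma ring_Aq: "ring (Aq q)"
  using F_algebra_Aq by (rule F_algebra.axioms)

lemmas Aq_rules = ring.ring_simprules[OF ring_Aq]
lemmas Aq_smult = F_algebra.smult_closed[OF F_algebra_Aq] F_algebra.smult_l_distr[OF F_algebra_Aq]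
  F_algebra.smult_r_distr[OF F_algebra_Aq] F_algebra.smult_assoc1[OF F_algebra_Aq]
  F_algebra.smult_one[OF F_algebra_Aq] F_algebra.smult_assoc2[OF F_algebra_Aq] F_algebra.smult_assoc3[OF F_algebra_Aq]

text \<open>
  The product of the algebras for all values of the parameter is taken because a type cannot depend on the
  value \<open>q\<close>.
\<close>

typedef (overloaded) 'f Aq_prod = "{x :: 'f::field \<Rightarrow> 'f alt_free set. \<forall>p. x p \<in> carrier (Aq p)}"
  morphisms component Abs_Aq_prod
proof
  show "(\<lambda>p. \<zero>\<^bsub>Aq p\<^esub>) \<in> {x. \<forall>p. x p \<in> carrier (Aq p)}"
    by (simp add: Aq_rules)
qed

setup_lifting type_definition_Aq_prod

instantiation Aq_prod :: (field) ring_1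
begin
lift_definition zero_Aq_prod :: "'a Aq_prod" is "\<lambda>p. \<zero>\<^bsub>Aq p\<^esub>"
  by (simp add: Aq_rules)
lift_definition one_Aq_prod :: "'a Aq_prod" is "\<lambda>p. \<one>\<^bsub>Aq p\<^esub>"
  by (simp add: Aq_rules)
lift_definition plus_Aq_prod :: "'a Aq_prod \<Rightarrow> 'a Aq_prod \<Rightarrow> 'a Aq_prod" is "\<lambda>x y p. x p \<oplus>\<^bsub>Aq p\<^esub> y p"
  by (simp add: Aq_rules)
lift_definition uminus_Aq_prod :: "'a Aq_prod \<Rightarrow> 'a Aq_prod" is "\<lambda>x p. \<ominus>\<^bsub>Aq p\<^esub> x p"
  by (simp add: Aq_rules)
lift_definition minus_Aq_prod :: "'a Aq_prod \<Rightarrow> 'a Aq_prod \<Rightarrow> 'a Aq_prod" is "\<lambda>x y p. x p \<ominus>\<^bsub>Aq p\<^esub> y p"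
  by (simp add: Aq_rules)
lift_definition times_Aq_prod :: "'a Aq_prod \<Rightarrow> 'a Aq_prod \<Rightarrow> 'a Aq_prod" is "\<lambda>x y p. x p \<otimes>\<^bsub>Aq p\<^esub> y p"
  by (simp add: Aq_rules)
instance
proof
  fix a b c :: "'a Aq_prod"
  have eqI: "x = y" if "\<And>p. component x p = component y p" for x y :: "'a Aq_prod"
    using that by (simp add: component_inject[symmetric] fun_eq_iff)
  have C: "component x p \<in> carrier (Aq p)" for x :: "'a Aq_prod" and p
    using component[of x] by simp
  note rep = zero_Aq_prod.rep_eq one_Aq_prod.rep_eq plus_Aq_prod.rep_eq uminus_Aq_prod.rep_eq
    minus_Aq_prod.rep_eq times_Aq_prod.rep_eq
  show "a + b + c = a + (b + c)" "a + b = b + a" "0 + a = a" "- a + a = 0" "a - b = a + - b"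
    "a * b * c = a * (b * c)" "1 * a = a" "a * 1 = a" "(a + b) * c = a * c + b * c" "a * (b + c) = a * b + a * c"
    by (rule eqI; unfold rep; intro Aq_rules monoid.r_one[OF ring.is_monoid[OF ring_Aq]] C)+
  show "(0 :: 'a Aq_prod) \<noteq> 1"
  proof transfer
    have "to_Aq q 0 \<noteq> to_Aq q 1" for q :: 'a
      using one_notin_rel_ideal[of q] to_Aq_eq_iff[of q 1 0] by auto
    moreover have "to_Aq q 0 = rel_ideal q" for q :: 'a
    proof -
      interpret A: ring "Aq q" by (rule ring_Aq)
      have "to_Aq q 0 \<oplus>\<^bsub>Aq q\<^esub> to_Aq q 0 = to_Aq q 0" "to_Aq q 0 \<in> carrier (Aq q)" by (simp_all add: Aq_simps)
      then have "to_Aq q 0 = \<zero>\<^bsub>Aq q\<^esub>" using A.add.l_cancel_one by metis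
      then show ?thesis by (simp add: Aq_simps)
    qed
    ultimately show "(\<lambda>p::'a. \<zero>\<^bsub>Aq p\<^esub>) \<noteq> (\<lambda>p. \<one>\<^bsub>Aq p\<^esub>)"
      by (simp add: fun_eq_iff Aq_simps)
  qed
qed
end

lift_definition scale_prod :: "'f::field \<Rightarrow> 'f Aq_prod \<Rightarrow> 'f Aq_prod" is "\<lambda>c x p. c \<odot>\<^bsub>Aq p\<^esub> x p"
  by (simp add: F_algebra.smult_closed[OF F_algebra_Aq])

global_interpretation P: typed_algebra "scale_prod :: 'f::field \<Rightarrow> _"
proof
  have eqI: "x = y" if "\<And>p. component x p = component y p" for x y :: "'f Aq_prod"
    using that by (simp add: component_inject[symmetric] fun_eq_iff)
  have C: "component x p \<in> carrier (Aq p)" for x :: "'f Aq_prod" and p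
    using component[of x] by simp
  note rep = plus_Aq_prod.rep_eq times_Aq_prod.rep_eq scale_prod.rep_eq
  fix a b :: 'f and x y :: "'f Aq_prod"
  show "scale_prod a (x + y) = scale_prod a x + scale_prod a y" by (rule eqI) (simp add: rep C Aq_smult)
  show "scale_prod (a + b) x = scale_prod a x + scale_prod b x" by (rule eqI) (simp add: rep C Aq_smult)
  show "scale_prod a (scale_prod b x) = scale_prod (a * b) x" by (rule eqI) (simp add: rep C Aq_smult)
  show "scale_prod 1 x = x" by (rule eqI) (simp add: rep C Aq_smult)
  show "scale_prod a x * y = scale_prod a (x * y)" by (rule eqI) (simp add: rep C Aq_smult)
  show "x * scale_prod a y = scale_prod a (x * y)" by (rule eqI) (simp add: rep C Aq_smult)
qed

text \<open>
  The inclusion of a factor of the product. It is multiplicative but does not preserve the unit.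
\<close>

lift_definition inc :: "'f::field \<Rightarrow> 'f alt_free set \<Rightarrow> 'f Aq_prod"
  is "\<lambda>q x p. if p = q \<and> x \<in> carrier (Aq q) then x else \<zero>\<^bsub>Aq p\<^esub>"
  by (simp add: Aq_rules)

lemma inc_simps:
  assumes "x \<in> carrier (Aq q)" "y \<in> carrier (Aq q)"
  shows "inc q (x \<oplus>\<^bsub>Aq q\<^esub> y) = inc q x + inc q y" "inc q (x \<otimes>\<^bsub>Aq q\<^esub> y) = inc q x * inc q y"
    "inc q (c \<odot>\<^bsub>Aq q\<^esub> x) = scale_prod c (inc q x)" "inc q x = inc q y \<longleftrightarrow> x = y"
proof -
  have c0: "c \<odot>\<^bsub>Aq p\<^esub> \<zero>\<^bsub>Aq p\<^esub> = \<zero>\<^bsub>Aq p\<^esub>" for p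
  proof -
    interpret A: F_algebra "Aq p" by (rule F_algebra_Aq)
    have "c \<odot>\<^bsub>Aq p\<^esub> (\<zero>\<^bsub>Aq p\<^esub> \<oplus>\<^bsub>Aq p\<^esub> \<zero>\<^bsub>Aq p\<^esub>) = c \<odot>\<^bsub>Aq p\<^esub> \<zero>\<^bsub>Aq p\<^esub> \<oplus>\<^bsub>Aq p\<^esub> c \<odot>\<^bsub>Aq p\<^esub> \<zero>\<^bsub>Aq p\<^esub>"
      by (rule A.smult_r_distr) simp_all
    then show ?thesis using A.smult_closed[of "\<zero>\<^bsub>Aq p\<^esub>" c] by (simp add: A.add.l_cancel_one')
  qed
  have eqI: "x = y" if "\<And>p. component x p = component y p" for x y :: "'a Aq_prod"
    using that by (simp add: component_inject[symmetric] fun_eq_iff)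
  have z: "\<zero>\<^bsub>Aq p\<^esub> \<in> carrier (Aq p)" "\<zero>\<^bsub>Aq p\<^esub> \<oplus>\<^bsub>Aq p\<^esub> \<zero>\<^bsub>Aq p\<^esub> = \<zero>\<^bsub>Aq p\<^esub>" "\<zero>\<^bsub>Aq p\<^esub> \<otimes>\<^bsub>Aq p\<^esub> \<zero>\<^bsub>Aq p\<^esub> = \<zero>\<^bsub>Aq p\<^esub>" for p :: 'a
  proof -
    interpret A: ring "Aq p" by (rule ring_Aq)
    show "\<zero>\<^bsub>Aq p\<^esub> \<in> carrier (Aq p)" "\<zero>\<^bsub>Aq p\<^esub> \<oplus>\<^bsub>Aq p\<^esub> \<zero>\<^bsub>Aq p\<^esub> = \<zero>\<^bsub>Aq p\<^esub>" "\<zero>\<^bsub>Aq p\<^esub> \<otimes>\<^bsub>Aq p\<^esub> \<zero>\<^bsub>Aq p\<^esub> = \<zero>\<^bsub>Aq p\<^esub>" by simp_all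
  qed
  have cl: "x \<oplus>\<^bsub>Aq q\<^esub> y \<in> carrier (Aq q)" "x \<otimes>\<^bsub>Aq q\<^esub> y \<in> carrier (Aq q)" "c \<odot>\<^bsub>Aq q\<^esub> x \<in> carrier (Aq q)"
    by (intro Aq_rules Aq_smult assms)+
  note R = inc.rep_eq plus_Aq_prod.rep_eq times_Aq_prod.rep_eq scale_prod.rep_eq
  show "inc q (x \<oplus>\<^bsub>Aq q\<^esub> y) = inc q x + inc q y"
    by (rule eqI) (use assms cl z in \<open>auto simp: R\<close>)
  show "inc q (x \<otimes>\<^bsub>Aq q\<^esub> y) = inc q x * inc q y"
    by (rule eqI) (use assms cl z in \<open>auto simp: R\<close>)
  show "inc q (c \<odot>\<^bsub>Aq q\<^esub> x) = scale_prod c (inc q x)"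
    by (rule eqI) (use assms cl z c0 in \<open>auto simp: R\<close>)
  show "inc q x = inc q y \<longleftrightarrow> x = y"
  proof
    assume "inc q x = inc q y"
    then have "component (inc q x) q = component (inc q y) q" by simp
    then show "x = y" using assms by (simp add: R)
  qed simp
qed

definition cls :: "'f::field \<Rightarrow> 'f alt_free \<Rightarrow> 'f Aq_prod" where "cls q x = inc q (to_Aq q x)"

global_interpretation C: free_hom scale_prod "cls q" for q :: "'f::field"
proof
  have c: "to_Aq q x \<in> carrier (Aq q)" for x by (simp add: Aq_simps)
  fix x y c
  show "cls q (x + y) = cls q x + cls q y" "cls q (x * y) = cls q x * cls q y" "cls q (c \<bullet> x) = scale_prod c (cls q x)"
    using inc_simps(1-3)[OF c c] by (simp_all add: cls_def Aq_simps)
qed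

lemma cls_eq_iff: "cls q x = cls q y \<longleftrightarrow> to_Aq q x = to_Aq q y"
  unfolding cls_def by (rule inc_simps) (simp_all add: Aq_simps)

lemma cls_rel: "alt_rel q x y \<Longrightarrow> cls q x = cls q y"
  unfolding cls_eq_iff to_Aq_eq_iff by (rule rel_in_ideal)

section \<open>Twisting the generating functions by a scalar series\<close>

context typed_algebra begin

text \<open>
  The homomorphism from the free algebra that extends a map on the generators.
\<close>

definition lift_hom :: "('g \<Rightarrow> 'r) \<Rightarrow> ('g, 'k) free_alg \<Rightarrow> 'r" where
  "lift_hom \<theta> x = (\<Sum>m\<in>Poly_Mapping.keys x. Poly_Mapping.lookup x m *s (case m of FMon u \<Rightarrow> prod_list (map \<theta> u)))"

lemma lift_hom_superset:
  assumes "finite S" "Poly_Mapping.keys x \<subseteq> S"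
  shows "lift_hom \<theta> x = (\<Sum>m\<in>S. Poly_Mapping.lookup x m *s (case m of FMon u \<Rightarrow> prod_list (map \<theta> u)))"
  unfolding lift_hom_def by (rule sum.mono_neutral_left) (use assms in \<open>auto simp: in_keys_iff\<close>)

lemma lift_hom_add: "lift_hom \<theta> (x + y) = lift_hom \<theta> x + lift_hom \<theta> y"
proof -
  let ?S = "Poly_Mapping.keys x \<union> Poly_Mapping.keys y"
  have "Poly_Mapping.keys (x + y) \<subseteq> ?S" by (rule Poly_Mapping.keys_add)
  then show ?thesis
    by (simp add: lift_hom_superset[of ?S] lookup_add scale_left_distrib sum.distrib)
qed

lemma lift_hom_scale: "lift_hom \<theta> (c \<bullet> x) = c *s lift_hom \<theta> x"
proof -
  have "Poly_Mapping.keys (c \<bullet> x) \<subseteq> Poly_Mapping.keys x" by (auto simp: in_keys_iff)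
  then show ?thesis
    by (simp add: lift_hom_superset[of "Poly_Mapping.keys x"] scale_sum_right)
qed

lemma lift_hom_single: "lift_hom \<theta> (Poly_Mapping.single (FMon u) c) = c *s prod_list (map \<theta> u)"
  by (simp add: lift_hom_superset[of "{FMon u}"])

lemma lift_hom_gen: "lift_hom \<theta> (gen x) = \<theta> x"
  by (simp add: gen_def lift_hom_single)

lemma lift_hom_1: "lift_hom (\<theta> :: 'g \<Rightarrow> 'r) 1 = 1"
proof -
  have one: "(1 :: ('g, 'k) free_alg) = Poly_Mapping.single (FMon []) 1"
    by (simp add: zero_fmon_def[symmetric])
  show ?thesis unfolding one by (simp add: lift_hom_single)
qed

end

lemma free_alg_induct [case_names zero add]:
  fixes x :: "('g, 'f::field) free_alg"
  assumes "P 0" and "\<And>x u c. P x \<Longrightarrow> P (x + Poly_Mapping.single (FMon u) c)"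
  shows "P x"
proof (induction x rule: update_induct)
  case const
  then show ?case using assms(1) by simp
next
  case (update f a b)
  have "Poly_Mapping.update a b f = f + Poly_Mapping.single a b"
    using update(1) by (intro poly_mapping_eqI)
      (auto simp: Poly_Mapping.lookup_update lookup_add lookup_single in_keys_iff when_def)
  then show ?case using assms(2)[OF update(3)] by (cases a) simp
qed

lemma (in typed_algebra) lift_hom_mult: "lift_hom \<theta> (x * y) = lift_hom \<theta> x * lift_hom \<theta> y"
proof (induction x rule: free_alg_induct)
  case zero
  show ?case by (simp add: lift_hom_def)
next
  case (add x u c)
  have "lift_hom \<theta> (Poly_Mapping.single (FMon u) c * y) = lift_hom \<theta> (Poly_Mapping.single (FMon u) c) * lift_hom \<theta> y"
  proof (induction y rule: free_alg_induct)
    case zero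
    show ?case by (simp add: lift_hom_def)
  next
    case (add y u' c')
    then show ?case by (simp add: distrib_left lift_hom_add mult_single lift_hom_single mult.commute)
  qed
  then show ?case using add by (simp add: distrib_right lift_hom_add)
qed

abbreviation good :: "'f::field \<Rightarrow> bool" where "good q \<equiv> q \<noteq> 0 \<and> (\<forall>n\<ge>1. q ^ n \<noteq> (1::'f))"

context free_hom begin

abbreviation "wseq k \<equiv> \<theta> (W (- int k))"
abbreviation "vseq k \<equiv> \<theta> (W (int k + 1))"
abbreviation "gseq q k \<equiv> \<theta> (G q k)"
abbreviation "hseq q k \<equiv> \<theta> (Gt q k)"

lemma hom_one: "\<theta> 1 * \<theta> x = \<theta> x" "\<theta> x * \<theta> 1 = \<theta> x"
  by (simp_all add: hom_mult[symmetric])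

lemma hom_comm: "\<theta> (comm x y) = bracket (\<theta> x) (\<theta> y)"
  "\<theta> (qcomm q x y) = q *s (\<theta> x * \<theta> y) - inverse q *s (\<theta> y * \<theta> x)"
  by (simp_all add: comm_def qcomm_def hom_diff hom_mult hom_scale)

text \<open>
  A homomorphism from the free algebra respects the relations if and only if the images of the generators
  are alternating sequences; the converse is \<open>respects_of_alternating\<close>.
\<close>

lemma alternating_of_respects:
  assumes "\<And>x y. alt_rel q x y \<Longrightarrow> \<theta> x = \<theta> y" and "good q"
  shows "alternating scale q wseq vseq (gseq q) (hseq q)"
proof -
  note R = hom_comm hom_diff hom_add hom_scale hom_0
  have i: "- int k - 1 = - int (Suc k)" "int k + 2 = int (Suc k) + 1" for k by simp_all
  show ?thesis
    apply unfold_locales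
    subgoal for k using assms(1)[OF alt_rel.intros(1)[of q k]] by (simp add: R)
    subgoal for k using assms(1)[OF alt_rel.intros(2)[of q k]] by (simp add: R)
    subgoal for k using assms(1)[OF alt_rel.intros(3)[of q k], unfolded i] by (simp add: R)
    subgoal for k using assms(1)[OF alt_rel.intros(4)[of q k], unfolded i] by (simp add: R)
    subgoal for k using assms(1)[OF alt_rel.intros(5)[of q k], unfolded i] by (simp add: R)
    subgoal for k using assms(1)[OF alt_rel.intros(6)[of q k], unfolded i] by (simp add: R)
    subgoal for k l using assms(1)[OF alt_rel.intros(7)[of q k l]] by (simp add: R)
    subgoal for k l using assms(1)[OF alt_rel.intros(8)[of q k l]] by (simp add: R)
    subgoal for k l using assms(1)[OF alt_rel.intros(9)[of q k l]] by (simp add: R)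
    subgoal for k l using assms(1)[OF alt_rel.intros(10)[of q k l]] by (simp add: R)
    subgoal for k l using assms(1)[OF alt_rel.intros(11)[of q k l]] by (simp add: R)
    subgoal for k l using assms(1)[OF alt_rel.intros(12)[of q k l]] by (simp add: R)
    subgoal for k l using assms(1)[OF alt_rel.intros(13)[of q k l]] by (simp add: R)
    subgoal for k l using assms(1)[OF alt_rel.intros(14)[of q k l]] by (simp add: R)
    subgoal for k l using assms(1)[OF alt_rel.intros(15)[of q k l]] by (simp add: R)
    subgoal for k l using assms(1)[OF alt_rel.intros(16)[of q k l]] by (simp add: R)
    using assms(2) by (simp_all add: G_def Gt_def hom_scale hom_one)
qed

lemma respects_of_alternating:
  assumes "alternating scale q wseq vseq (gseq q) (hseq q)" "alt_rel q x y"
  shows "\<theta> x = \<theta> y"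
proof -
  interpret alternating scale q wseq vseq "gseq q" "hseq q" by fact
  note R = hom_comm hom_diff hom_add hom_scale hom_0
  have i: "- int k - 1 = - int (Suc k)" "int k + 2 = int (Suc k) + 1" for k by simp_all
  show ?thesis
    using assms(2)
    apply cases
    subgoal for k using wv0[of k] by (simp add: R)
    subgoal for k using w0v[of k] by (simp add: R)
    subgoal for k using w0g[of k] unfolding i by (simp add: R)
    subgoal for k using hw0[of k] unfolding i by (simp add: R)
    subgoal for k using gv0[of k] unfolding i by (simp add: R)
    subgoal for k using v0h[of k] unfolding i by (simp add: R)
    subgoal for k l using ww[of k l] by (simp add: R)
    subgoal for k l using vv[of k l] by (simp add: R)
    subgoal for k l using wv[of k l] by (simp add: R)
    subgoal for k l using wg[of k l] by (simp add: R)
    subgoal for k l using wh[of k l] by (simp add: R)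
    subgoal for k l using vg[of k l] by (simp add: R)
    subgoal for k l using vh[of k l] by (simp add: R)
    subgoal for k l using gg[of k l] by (simp add: R)
    subgoal for k l using hh[of k l] by (simp add: R)
    subgoal for k l using hg[of k l] by (simp add: R)
    done
qed

end

context typed_algebra begin

text \<open>
  Multiplication of the generating function by \<open>1 + c t\<^sup>n\<close>.
\<close>

definition twist :: "'k \<Rightarrow> nat \<Rightarrow> (nat \<Rightarrow> 'r) \<Rightarrow> nat \<Rightarrow> 'r" where
  "twist c n a k = a k + c *s (if n \<le> k then a (k - n) else 0)"

lemma shift_twist: "n \<ge> 1 \<Longrightarrow> shift (twist c n a) i = twist c n (shift a) i"
  by (cases i) (auto simp: twist_def Suc_diff_le not_less_eq_eq le_Suc_eq)

text \<open>
  A bilinear relation that holds for all pairs of indices survives the twist, because the left-hand side for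
  the twisted sequences is a sum of four instances of the original one.
\<close>

lemma twist_bilinear:
  assumes X: "\<And>i j. bracket (A i) (B j) + bracket (C i) (D j) = 0"
  shows "bracket (twist c n A i) (twist c n B j) + bracket (twist c n C i) (twist c n D j) = 0"
proof -
  define r where "r a i = (if n \<le> i then a (i - n) else 0)" for a :: "nat \<Rightarrow> 'r" and i
  have r: "bracket (r A i) (B j) + bracket (r C i) (D j) = 0"
    "bracket (A i) (r B j) + bracket (C i) (r D j) = 0"
    "bracket (r A i) (r B j) + bracket (r C i) (r D j) = 0"
    using X by (simp_all add: r_def)
  have "bracket (A i + c *s r A i) (B j + c *s r B j) + bracket (C i + c *s r C i) (D j + c *s r D j)
    = (bracket (A i) (B j) + bracket (C i) (D j)) + c *s (bracket (r A i) (B j) + bracket (r C i) (D j))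
    + c *s (bracket (A i) (r B j) + bracket (C i) (r D j)) + (c * c) *s (bracket (r A i) (r B j) + bracket (r C i) (r D j))"
    by (simp add: expand algebra_simps)
  also have "\<dots> = 0" unfolding r X by simp
  finally show ?thesis by (simp add: twist_def r_def)
qed

lemma twist_bracket:
  assumes "\<And>i j. bracket (A i) (B j) = 0"
  shows "bracket (twist c n A i) (twist c n B j) = 0"
  using twist_bilinear[of A B "\<lambda>_. 0" "\<lambda>_. 0" c n i j] assms by (simp add: twist_def)

lemma twist_linear:
  "x * twist c n a i = twist c n (\<lambda>i. x * a i) i" "twist c n a i * x = twist c n (\<lambda>i. a i * x) i"
  "k *s twist c n a i = twist c n (\<lambda>i. k *s a i) i" "twist c n a i - twist c n b i = twist c n (\<lambda>i. a i - b i) i"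
  by (auto simp: twist_def expand mult.commute)

lemma twist_0: "n \<ge> 1 \<Longrightarrow> twist c n a 0 = a 0" by (simp add: twist_def)

lemma series_at_twist:
  assumes "s $ 0 = 0"
  shows "series_at (twist c n a) s = const_fps (1 + fps_const c * s ^ n) * series_at a s"
proof -
  have "series_at ((shift ^^ n) a) s = const_fps (s ^ n) * series_at a s"
    by (induction n) (simp_all add: const_fps_simps const_mult_series_at[OF assms, symmetric] mult.assoc)
  moreover have "(shift ^^ n) a = (\<lambda>k. if n \<le> k then a (k - n) else 0)"
  proof (induction n)
    case (Suc n)
    show ?case
    proof
      fix k show "(shift ^^ Suc n) a k = (if Suc n \<le> k then a (k - Suc n) else 0)"
        by (cases k) (simp_all add: Suc)
    qed
  qed simp
  ultimately have "series_at (\<lambda>k. if n \<le> k then a (k - n) else 0) s = const_fps (s ^ n) * series_at a s" by simp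
  then have "series_at (twist c n a) s = series_at a s + const_fps (fps_const c) * (const_fps (s ^ n) * series_at a s)"
    by (simp only: series_at_linear[symmetric] twist_def[abs_def])
  then show ?thesis by (simp add: const_fps_simps distrib_right mult.assoc)
qed

lemma det_fps_twist:
  "det_fps q (twist c n w) (twist c n v) (twist c n g) (twist c n h)
    = const_fps ((1 + fps_const c * S_series q ^ n) * (1 + fps_const c * S_series (inverse q) ^ n)) * det_fps q w v g h"
proof -
  let ?S = "S_series q" and ?T = "S_series (inverse q)"
  let ?f = "1 + fps_const c * ?S ^ n" and ?g = "1 + fps_const c * ?T ^ n"
  have e: "const_fps a * ((const_fps ?f * x) * (const_fps ?g * y)) = const_fps (?f * ?g) * (const_fps a * (x * y))" for a x y
  proof -
    have "const_fps a * ((const_fps ?f * x) * (const_fps ?g * y)) = const_fps a * (const_fps ?f * ((x * const_fps ?g) * y))"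
      by (simp only: mult.assoc)
    also have "\<dots> = (const_fps a * const_fps ?f * const_fps ?g) * (x * y)"
      unfolding const_fps_comm[of ?g x, symmetric] by (simp only: mult.assoc)
    also have "const_fps a * const_fps ?f * const_fps ?g = const_fps (?f * ?g) * const_fps a"
      by (simp only: const_fps_simps(3)[symmetric] mult_ac)
    finally show ?thesis by (simp only: mult.assoc)
  qed
  show ?thesis
    unfolding det_fps_def Let_def by (simp only: series_at_twist S_series_nth_0 e distrib_left right_diff_distrib)
qed

end

text \<open>
  The condition \<open>n \<ge> 1\<close> is what keeps \<open>w 0\<close>, \<open>v 0\<close>, \<open>g 0\<close> and \<open>h 0\<close> fixed.
\<close>

lemma (in alternating) alternating_twist:
  assumes n: "n \<ge> 1"
  shows "alternating scale q (twist c n w) (twist c n v) (twist c n g) (twist c n h)"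
proof -
  let ?d = "twist c n"
  have inj: "x = inverse (q2 q) *s y" if "q2 q *s x = y" for x y
    using that q2_nonzero by auto
  note sh = shift_twist[OF n] twist_0[OF n]
  have 1: "q2 q *s bracket (?d w 0) (shift (?d v) i) = ?d h i - ?d g i" 
     "q2 q *s bracket (shift (?d w) i) (?d v 0) = ?d h i - ?d g i" for i
    unfolding sh by (simp_all only: twist_linear wv0_all w0v_all)
  have 2: "q *s (?d w 0 * ?d g i) - inverse q *s (?d g i * ?d w 0) = rho q *s (?d w i - shift (?d v) i)"
    "q *s (?d h i * ?d w 0) - inverse q *s (?d w 0 * ?d h i) = rho q *s (?d w i - shift (?d v) i)"
    "q *s (?d g i * ?d v 0) - inverse q *s (?d v 0 * ?d g i) = rho q *s (?d v i - shift (?d w) i)"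
    "q *s (?d v 0 * ?d h i) - inverse q *s (?d h i * ?d v 0) = rho q *s (?d v i - shift (?d w) i)" for i
    unfolding sh by (simp_all only: twist_linear w0g_all hw0_all gv0_all v0h_all)
  have 3: "bracket (shift (?d w) i) (?d g j) + bracket (?d g i) (shift (?d w) j) = 0"
    "bracket (shift (?d w) i) (?d h j) + bracket (?d h i) (shift (?d w) j) = 0"
    "bracket (shift (?d v) i) (?d g j) + bracket (?d g i) (shift (?d v) j) = 0"
    "bracket (shift (?d v) i) (?d h j) + bracket (?d h i) (shift (?d v) j) = 0" for i j
    unfolding sh using twist_bilinear[OF wg_all] twist_bilinear[OF wh_all] twist_bilinear[OF vg_all] twist_bilinear[OF vh_all] by simp_all
  show ?thesis
  proof unfold_locales
    fix k l
    show "bracket (?d w 0) (?d v k) = inverse (q2 q) *s (?d h (Suc k) - ?d g (Suc k))"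
      "bracket (?d w k) (?d v 0) = inverse (q2 q) *s (?d h (Suc k) - ?d g (Suc k))"
      by (rule inj, use 1[of "Suc k"] in simp)+
    show "q *s (?d w 0 * ?d g (Suc k)) - inverse q *s (?d g (Suc k) * ?d w 0) = rho q *s ?d w (Suc k) - rho q *s ?d v k"
      "q *s (?d h (Suc k) * ?d w 0) - inverse q *s (?d w 0 * ?d h (Suc k)) = rho q *s ?d w (Suc k) - rho q *s ?d v k"
      "q *s (?d g (Suc k) * ?d v 0) - inverse q *s (?d v 0 * ?d g (Suc k)) = rho q *s ?d v (Suc k) - rho q *s ?d w k"
      "q *s (?d v 0 * ?d h (Suc k)) - inverse q *s (?d h (Suc k) * ?d v 0) = rho q *s ?d v (Suc k) - rho q *s ?d w k"
      using 2[of "Suc k"] by (simp_all only: shift_simps scale_right_diff_distrib)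
    show "bracket (?d w k) (?d w l) = 0" "bracket (?d v k) (?d v l) = 0"
      "bracket (?d g (Suc k)) (?d g (Suc l)) = 0" "bracket (?d h (Suc k)) (?d h (Suc l)) = 0"
      by (rule twist_bracket ww vv gg_all hh_all)+
    show "bracket (?d w k) (?d v l) + bracket (?d v k) (?d w l) = 0"
      "bracket (?d h (Suc k)) (?d g (Suc l)) + bracket (?d g (Suc k)) (?d h (Suc l)) = 0"
      by (rule twist_bilinear wv hg_all)+
    show "bracket (?d w k) (?d g (Suc l)) + bracket (?d g (Suc k)) (?d w l) = 0"
      "bracket (?d w k) (?d h (Suc l)) + bracket (?d h (Suc k)) (?d w l) = 0"
      "bracket (?d v k) (?d g (Suc l)) + bracket (?d g (Suc k)) (?d v l) = 0"
      "bracket (?d v k) (?d h (Suc l)) + bracket (?d h (Suc k)) (?d v l) = 0"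
      using 3[of "Suc k" "Suc l"] by (simp_all only: shift_simps)
    show "?d h 0 = ?d g 0" using h0 by (simp only: sh)
    show "?d g 0 * ?d w k = (- (q - inverse q) * (q2 q)\<^sup>2) *s ?d w k" 
      "?d g 0 * ?d v k = (- (q - inverse q) * (q2 q)\<^sup>2) *s ?d v k"
      "?d g 0 * ?d g k = (- (q - inverse q) * (q2 q)\<^sup>2) *s ?d g k" 
      "?d g 0 * ?d h k = (- (q - inverse q) * (q2 q)\<^sup>2) *s ?d h k"
      "?d w k * ?d g 0 = (- (q - inverse q) * (q2 q)\<^sup>2) *s ?d w k"
      "?d v k * ?d g 0 = (- (q - inverse q) * (q2 q)\<^sup>2) *s ?d v k"
      "?d g k * ?d g 0 = (- (q - inverse q) * (q2 q)\<^sup>2) *s ?d g k" 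
      "?d h k * ?d g 0 = (- (q - inverse q) * (q2 q)\<^sup>2) *s ?d h k"
      unfolding sh by (simp_all only: twist_linear g0)
    show "q \<noteq> 0" by (rule q0)
    show "q ^ m \<noteq> 1" if "1 \<le> m" for m using q_not_root that .
  qed
qed

definition twist_gen :: "'f::field \<Rightarrow> 'f \<Rightarrow> nat \<Rightarrow> alt_gen \<Rightarrow> 'f alt_free" where
  "twist_gen q c n x = (case x of
      GenW i \<Rightarrow> (if i \<le> 0 then free.twist c n (\<lambda>k. W (- int k)) (nat (- i)) else free.twist c n (\<lambda>k. W (int k + 1)) (nat (i - 1)))
    | GenG k \<Rightarrow> free.twist c n (G q) (Suc k)
    | GenGt k \<Rightarrow> free.twist c n (Gt q) (Suc k))"

definition twist_hom :: "'f::field \<Rightarrow> 'f \<Rightarrow> nat \<Rightarrow> 'f alt_free \<Rightarrow> 'f alt_free" where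
  "twist_hom q c n = free.lift_hom (twist_gen q c n)"

lemma twist_hom_simps: "twist_hom q c n (x + y) = twist_hom q c n x + twist_hom q c n y" "twist_hom q c n (x * y) = twist_hom q c n x * twist_hom q c n y"
  "twist_hom q c n (a \<bullet> x) = a \<bullet> twist_hom q c n x" "twist_hom q c n 1 = 1"
  by (simp_all add: twist_hom_def free.lift_hom_add free.lift_hom_mult free.lift_hom_scale free.lift_hom_1)

lemma twist_hom_letters:
  assumes n: "n \<ge> 1"
  shows "twist_hom q c n (W (- int k)) = free.twist c n (\<lambda>k. W (- int k)) k"
    "twist_hom q c n (W (int k + 1)) = free.twist c n (\<lambda>k. W (int k + 1)) k"
    "twist_hom q c n (G q k) = free.twist c n (G q) k"
    "twist_hom q c n (Gt q k) = free.twist c n (Gt q) k"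
proof -
  have g: "twist_hom q c n (gen x) = twist_gen q c n x" for x by (simp add: twist_hom_def free.lift_hom_gen)
  show "twist_hom q c n (W (- int k)) = free.twist c n (\<lambda>k. W (- int k)) k"
    "twist_hom q c n (W (int k + 1)) = free.twist c n (\<lambda>k. W (int k + 1)) k"
    by (simp_all add: W_def g twist_gen_def)
  have G0: "G q 0 = (- (q - inverse q) * (q2 q)\<^sup>2) \<bullet> 1" "Gt q 0 = (- (q - inverse q) * (q2 q)\<^sup>2) \<bullet> 1"
    by (simp_all add: G_def Gt_def)
  show "twist_hom q c n (G q k) = free.twist c n (G q) k"
  proof (cases k)
    case 0
    show ?thesis unfolding 0 free.twist_0[OF n] G0 by (simp only: twist_hom_simps)
  next
    case (Suc m)
    have "G q k = gen (GenG m)" by (simp add: Suc G_def)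
    then show ?thesis by (simp add: g twist_gen_def Suc)
  qed
  show "twist_hom q c n (Gt q k) = free.twist c n (Gt q) k"
  proof (cases k)
    case 0
    show ?thesis unfolding 0 free.twist_0[OF n] G0 by (simp only: twist_hom_simps)
  next
    case (Suc m)
    have "Gt q k = gen (GenGt m)" by (simp add: Suc Gt_def)
    then show ?thesis by (simp add: g twist_gen_def Suc)
  qed
qed

lemma alternating_cls: "good q \<Longrightarrow> alternating scale_prod q (\<lambda>k. cls q (W (- int k))) (\<lambda>k. cls q (W (int k + 1))) (\<lambda>k. cls q (G q k)) (\<lambda>k. cls q (Gt q k))"
  by (rule C.alternating_of_respects[OF cls_rel])

global_interpretation D: free_hom scale_prod "\<lambda>x. cls q (twist_hom q c n x)" for q c :: "'f::field" and n
  by unfold_locales (simp_all add: twist_hom_simps C.hom_add C.hom_mult C.hom_scale)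

lemma cls_twist: "cls q (free.twist c n a k) = P.twist c n (\<lambda>k. cls q (a k)) k"
  by (simp add: free.twist_def P.twist_def C.hom_add C.hom_scale C.hom_0)

lemma twist_hom_respects:
  assumes "good q" "n \<ge> 1" "cls q x = cls q y"
  shows "cls q (twist_hom q c n x) = cls q (twist_hom q c n y)"
proof -
  have alt: "alternating scale_prod q (\<lambda>k. cls q (twist_hom q c n (W (- int k)))) (\<lambda>k. cls q (twist_hom q c n (W (int k + 1))))
      (\<lambda>k. cls q (twist_hom q c n (G q k))) (\<lambda>k. cls q (twist_hom q c n (Gt q k)))"
    unfolding twist_hom_letters[OF assms(2)] cls_twist
    by (rule alternating.alternating_twist[OF alternating_cls[OF assms(1)] assms(2)])
  have "x - y \<in> rel_ideal q" using assms(3) by (simp add: cls_eq_iff to_Aq_eq_iff)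
  have "cls q (twist_hom q c n (x - y)) = 0"
    by (rule free_hom.ker_ideal[OF D.free_hom_axioms[of q c n] _ \<open>x - y \<in> rel_ideal q\<close>])
      (rule free_hom.respects_of_alternating[OF D.free_hom_axioms[of q c n] alt])
  then show ?thesis by (simp add: D.hom_diff)
qed

section \<open>Polynomials over a typed algebra\<close>

context typed_algebra begin

text \<open>
  Here \<open>z\<close> and \<open>p\<close> need not commute, so the binomial theorem is not available; but only the leading
  coefficient matters.
\<close>

lemma power_expansion:
  "\<exists>b. (\<forall>c. p * (z + c *s 1) ^ N = (\<Sum>j\<le>N. c ^ j *s b j)) \<and> b N = p"
proof (induction N)
  case 0
  show ?case by (rule exI[of _ "\<lambda>_. p"]) simp
next
  case (Suc N)
  then obtain b where b: "\<And>c. p * (z + c *s 1) ^ N = (\<Sum>j\<le>N. c ^ j *s b j)" and bN: "b N = p" by auto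
  define b' where "b' j = (if j \<le> N then b j * z else 0) + shift b j" for j
  have "p * (z + c *s 1) ^ Suc N = (\<Sum>j\<le>Suc N. c ^ j *s b' j)" for c
  proof -
    have "p * (z + c *s 1) ^ Suc N = (\<Sum>j\<le>N. c ^ j *s b j) * (z + c *s 1)"
      by (simp only: power_Suc2 mult.assoc[symmetric] b)
    also have "\<dots> = (\<Sum>j\<le>N. c ^ j *s (b j * z)) + (\<Sum>j\<le>N. c ^ Suc j *s b j)"
      by (simp add: distrib_left sum_distrib_right scale_sum_right)
    also have "(\<Sum>j\<le>N. c ^ j *s (b j * z)) = (\<Sum>j\<le>Suc N. c ^ j *s (if j \<le> N then b j * z else 0))"
      by simp
    also have "(\<Sum>j\<le>N. c ^ Suc j *s b j) = (\<Sum>j\<le>Suc N. c ^ j *s shift b j)"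
      by (simp add: sum.atMost_Suc_shift del: sum.atMost_Suc power_Suc)
    finally show ?thesis by (simp only: b'_def scale_right_distrib sum.distrib)
  qed
  then show ?case using bN by (intro exI[of _ b']) (simp add: b'_def)
qed

text \<open>
  A polynomial function with coefficients in the algebra is replaced by \<open>p (q c) - q\<^sup>N p (c)\<close>, which has
  smaller degree and whose coefficients are nonzero multiples of the original ones.
\<close>

lemma vandermonde:
  assumes q: "\<And>n. n \<ge> 1 \<Longrightarrow> q ^ n \<noteq> (1 :: 'k)" "q \<noteq> 0"
    and zero: "\<And>c. (\<Sum>j\<le>N. c ^ j *s a j) = 0" and "j \<le> N"
  shows "a j = 0"
  using zero \<open>j \<le> N\<close>
proof (induction N arbitrary: a j)
  case 0
  then show ?case by simp
next
  case (Suc N)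
  have "(\<Sum>j\<le>N. c ^ j *s ((q ^ j - q ^ Suc N) *s a j)) = 0" for c
  proof -
    \<comment> \<open>The summand for \<open>j = Suc N\<close> is zero.\<close>
    have "(\<Sum>j\<le>Suc N. c ^ j *s ((q ^ j - q ^ Suc N) *s a j)) = (\<Sum>j\<le>Suc N. (q * c) ^ j *s a j) - q ^ Suc N *s (\<Sum>j\<le>Suc N. c ^ j *s a j)"
      unfolding scale_sum_right sum_subtractf[symmetric]
      by (rule sum.cong) (simp_all add: power_mult_distrib scale_left_diff_distrib scale_right_diff_distrib right_diff_distrib mult_ac)
    also have "\<dots> = 0" by (simp only: Suc.prems(1)) simp
    finally show ?thesis by simp
  qed
  from Suc.IH[OF this] have IH: "(q ^ j - q ^ Suc N) *s a j = 0" if "j \<le> N" for j using that by simp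
  have a: "a j = 0" if j: "j \<le> N" for j
  proof -
    have "q ^ Suc N = q ^ j * q ^ (Suc N - j)" using j by (simp add: power_add[symmetric] del: power_Suc)
    moreover have "q ^ (Suc N - j) \<noteq> 1" using j by (intro q(1)) simp
    ultimately have "q ^ j - q ^ Suc N \<noteq> 0" using q(2) by simp
    then show ?thesis using IH[OF j] by simp
  qed
  then have "a (Suc N) = 0" using Suc.prems(1)[of 1] by simp
  then show ?case using a Suc.prems(2) le_Suc_eq by auto
qed

lemma polynomial_zero:
  assumes q: "\<And>n. n \<ge> 1 \<Longrightarrow> q ^ n \<noteq> (1 :: 'k)" "q \<noteq> 0"
    and "\<And>c. (\<Sum>j\<le>N. p j * (z + c *s 1) ^ j) = 0" "j \<le> N"
  shows "p j = 0"
  using assms(3,4)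
proof (induction N arbitrary: j)
  case 0
  then show ?case by simp
next
  case (Suc N)
  have "\<forall>j. \<exists>b. (\<forall>c. p j * (z + c *s 1) ^ j = (\<Sum>i\<le>j. c ^ i *s b i)) \<and> b j = p j"
    by (intro allI power_expansion)
  from choice[OF this] obtain b where
    bb: "\<forall>j. (\<forall>c. p j * (z + c *s 1) ^ j = (\<Sum>i\<le>j. c ^ i *s b j i)) \<and> b j j = p j" ..
  then have b: "\<And>j c. p j * (z + c *s 1) ^ j = (\<Sum>i\<le>j. c ^ i *s b j i)" and bj: "\<And>j. b j j = p j"
    by blast+
  define a where "a i = (\<Sum>j\<in>{i..Suc N}. b j i)" for i
  have "(\<Sum>i\<le>Suc N. c ^ i *s a i) = 0" for c
  proof -
    have "(\<Sum>i\<le>Suc N. c ^ i *s a i) = (\<Sum>i\<le>Suc N. \<Sum>j\<in>{i..Suc N}. c ^ i *s b j i)"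
      by (simp only: a_def scale_sum_right)
    also have "\<dots> = (\<Sum>i\<le>Suc N. \<Sum>j\<le>Suc N. if i \<le> j then c ^ i *s b j i else 0)"
      by (intro sum.cong refl sum.mono_neutral_cong_left) auto
    also have "\<dots> = (\<Sum>j\<le>Suc N. \<Sum>i\<le>Suc N. if i \<le> j then c ^ i *s b j i else 0)"
      by (rule sum.swap)
    also have "\<dots> = (\<Sum>j\<le>Suc N. \<Sum>i\<le>j. c ^ i *s b j i)"
      by (intro sum.cong refl sum.mono_neutral_cong_right) auto
    also have "\<dots> = 0" by (simp only: b[symmetric] Suc.prems(1))
    finally show ?thesis .
  qed
  from vandermonde[OF q this] have "a (Suc N) = 0" by simp
  then have pN: "p (Suc N) = 0" by (simp add: a_def bj)
  then have "(\<Sum>j\<le>N. p j * (z + c *s 1) ^ j) = 0" for c using Suc.prems(1)[of c] by simp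
  from Suc.IH[OF this] show ?case using pN Suc.prems(2) le_Suc_eq by auto
qed

text \<open>
  The polynomials in \<open>z\<close> with coefficients in \<open>Y\<close>, in Horner form.
\<close>

inductive_set adjoin :: "'r set \<Rightarrow> 'r \<Rightarrow> 'r set" for Y z where
  base: "y \<in> Y \<Longrightarrow> y \<in> adjoin Y z"
| step: "x \<in> adjoin Y z \<Longrightarrow> y \<in> Y \<Longrightarrow> y + x * z \<in> adjoin Y z"

text \<open>
  The unit is a parameter because a direct factor of a product has a unit of its own.
\<close>

definition subalg_on :: "'r \<Rightarrow> 'r set \<Rightarrow> bool" where
  "subalg_on e U \<longleftrightarrow> e \<in> U \<and> (\<forall>x\<in>U. \<forall>y\<in>U. x + y \<in> U \<and> x * y \<in> U) \<and> (\<forall>c. \<forall>x\<in>U. c *s x \<in> U)"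

lemma subalg_onD:
  assumes "subalg_on e U"
  shows "e \<in> U" "x \<in> U \<Longrightarrow> y \<in> U \<Longrightarrow> x + y \<in> U" "x \<in> U \<Longrightarrow> y \<in> U \<Longrightarrow> x * y \<in> U" "x \<in> U \<Longrightarrow> c *s x \<in> U"
    "0 \<in> U" "x \<in> U \<Longrightarrow> y \<in> U \<Longrightarrow> x - y \<in> U" "(\<And>i. i \<in> I \<Longrightarrow> f i \<in> U) \<Longrightarrow> sum f I \<in> U"
proof -
  show e: "e \<in> U" and a: "\<And>x y. x \<in> U \<Longrightarrow> y \<in> U \<Longrightarrow> x + y \<in> U" and "x \<in> U \<Longrightarrow> y \<in> U \<Longrightarrow> x * y \<in> U"
    and s: "\<And>x c. x \<in> U \<Longrightarrow> c *s x \<in> U"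
    using assms by (auto simp: subalg_on_def)
  show 0: "0 \<in> U" using s[OF e, of 0] by simp
  show "x - y \<in> U" if "x \<in> U" "y \<in> U" using a[OF that(1) s[OF that(2), of "- 1"]] by simp
  show "(\<And>i. i \<in> I \<Longrightarrow> f i \<in> U) \<Longrightarrow> sum f I \<in> U"
    by (induction I rule: infinite_finite_induct) (simp_all add: 0 a)
qed

lemma subalg_on_adjoin:
  assumes Y: "subalg_on e Y" and comm: "\<And>y. y \<in> adjoin Y z \<Longrightarrow> z * y = y * z"
  shows "subalg_on e (adjoin Y z)"
proof -
  note Y' = subalg_onD[OF Y]
  have add0: "y + x' \<in> adjoin Y z" if "x' \<in> adjoin Y z" "y \<in> Y" for x' y
    using that(1)
  proof cases
    case base
    then show ?thesis using that(2) by (intro adjoin.base Y')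
  next
    case (step x y')
    then show ?thesis using adjoin.step[OF step(2) Y'(2)[OF that(2) step(3)]] by (simp add: add.assoc)
  qed
  have add: "x + x' \<in> adjoin Y z" if "x \<in> adjoin Y z" "x' \<in> adjoin Y z" for x x'
    using that
  proof (induction x arbitrary: x')
    case (base y)
    then show ?case using add0 by blast
  next
    case (step x y)
    from step.prems show ?case
    proof cases
      case base
      then show ?thesis using add0[OF adjoin.step[OF step.hyps(1,2)], of x'] by (simp add: add_ac)
    next
      case (step x1 y1)
      then have "x + x1 \<in> adjoin Y z" "y + y1 \<in> Y" using step.IH \<open>y \<in> Y\<close> Y' by auto
      from adjoin.step[OF this] show ?thesis using step by (simp add: algebra_simps)
    qed
  qed
  have zmult: "x * z \<in> adjoin Y z" if "x \<in> adjoin Y z" for x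
    using adjoin.step[OF that Y'(5)] by simp
  have scale: "c *s x \<in> adjoin Y z" if "x \<in> adjoin Y z" for c x
    using that
  proof (induction x)
    case (base y)
    then show ?case by (intro adjoin.base Y')
  next
    case (step x y)
    then show ?case using adjoin.step[OF step.IH Y'(4)[OF step.hyps(2)]] by (simp add: scale_right_distrib)
  qed
  have ymult: "y * x \<in> adjoin Y z" if "x \<in> adjoin Y z" "y \<in> Y" for x y
    using that
  proof (induction x)
    case (base y)
    then show ?case by (intro adjoin.base Y')
  next
    case (step x y')
    then show ?case using adjoin.step[OF step.IH[OF \<open>y \<in> Y\<close>] Y'(3)[OF \<open>y \<in> Y\<close> \<open>y' \<in> Y\<close>]] by (simp add: distrib_left mult.assoc)
  qed
  have "x * x' \<in> adjoin Y z" if "x \<in> adjoin Y z" "x' \<in> adjoin Y z" for x x'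
    using that
  proof (induction x)
    case (base y)
    then show ?case using ymult by blast
  next
    case (step x y)
    have "y * x' + (x * x') * z \<in> adjoin Y z"
      using add[OF ymult zmult] step by blast
    then show ?case using comm[OF step.prems] by (simp add: distrib_right mult.assoc)
  qed
  then show ?thesis using add scale Y'(1) by (auto simp: subalg_on_def intro: adjoin.base)
qed

lemma adjoin_sum:
  assumes "x \<in> adjoin Y z" "0 \<in> Y"
  obtains N y where "\<And>j. y j \<in> Y" "\<And>j. j > N \<Longrightarrow> y j = 0" "x = (\<Sum>j\<le>N. y j * z ^ j)"
proof -
  have "\<exists>N y. (\<forall>j. y j \<in> Y) \<and> (\<forall>j>N. y j = 0) \<and> x = (\<Sum>j\<le>N. y j * z ^ j)"
    using assms(1)
  proof induction
    case (base y)
    show ?case by (rule exI[of _ 0], rule exI[of _ "\<lambda>j. if j = 0 then y else 0"]) (use base assms(2) in auto)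
  next
    case (step x y)
    then obtain N a where a: "\<forall>j. a j \<in> Y" "\<forall>j>N. a j = 0" "x = (\<Sum>j\<le>N. a j * z ^ j)" by blast
    define a' where "a' j = (case j of 0 \<Rightarrow> y | Suc i \<Rightarrow> a i)" for j
    have "y + x * z = (\<Sum>j\<le>Suc N. a' j * z ^ j)"
      unfolding a(3) by (simp add: sum.atMost_Suc_shift a'_def sum_distrib_right mult.assoc power_commutes del: sum.atMost_Suc)
    moreover have "\<forall>j. a' j \<in> Y" "\<forall>j>Suc N. a' j = 0" using a step(2) by (auto simp: a'_def split: nat.split)
    ultimately show ?case by blast
  qed
  then show ?thesis using that by metis
qed

end

locale good_parameter =
  fixes q :: "'f::field"
  assumes good: "q \<noteq> 0 \<and> (\<forall>n\<ge>1. q ^ n \<noteq> 1)"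
begin

abbreviation "w k \<equiv> cls q (W (- int k))"
abbreviation "v k \<equiv> cls q (W (int k + 1))"
abbreviation "g k \<equiv> cls q (G q k)"
abbreviation "h k \<equiv> cls q (Gt q k)"
definition "B = range (cls q)"
definition "e = cls q 1"

sublocale A: alternating scale_prod q w v g h
  by (rule alternating_cls) (rule good)

definition "z n = cls q (inverse (q2 q ^ n) \<bullet> Z_series q $ n)"

lemma cls_Z: "cls q (Z_series q $ n) = A.Z $ n"
  using arg_cong[OF C.hom_Z[of q q], of "\<lambda>f. f $ n"] by (simp add: C.series_image_def A.Z_def)

lemma z_eq: "z n = scale_prod (inverse (q2 q ^ n)) (A.Z $ n)"
  by (simp add: z_def C.hom_scale cls_Z)

lemma subalg_on_B: "P.subalg_on e B"
  unfolding P.subalg_on_def B_def e_def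
  by (auto simp: C.hom_add[symmetric] C.hom_mult[symmetric] C.hom_scale[symmetric])

lemma e_mult: "x \<in> B \<Longrightarrow> e * x = x" "x \<in> B \<Longrightarrow> x * e = x"
  by (auto simp: B_def e_def C.hom_one)

lemma z_in_B: "z n \<in> B" and letters_in_B: "w k \<in> B" "v k \<in> B" "g k \<in> B" "h k \<in> B"
  by (auto simp: z_def B_def)

lemma letters_generate:
  assumes U: "P.subalg_on e U" and "\<And>k. w k \<in> U" "\<And>k. v k \<in> U" "\<And>k. g k \<in> U" "\<And>k. h k \<in> U"
  shows "B \<subseteq> U"
proof -
  have gen: "cls q (gen x) \<in> U" for x
  proof (cases x)
    case (GenW i)
    show ?thesis
    proof (cases "i \<le> 0")
      case True
      then show ?thesis using assms(2)[of "nat (- i)"] GenW by (simp add: W_def)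
    next
      case False
      then show ?thesis using assms(3)[of "nat (i - 1)"] GenW by (simp add: W_def)
    qed
  next
    case (GenG k)
    then show ?thesis using assms(4)[of "Suc k"] by (simp add: G_def)
  next
    case (GenGt k)
    then show ?thesis using assms(5)[of "Suc k"] by (simp add: Gt_def)
  qed
  have mon: "cls q (Poly_Mapping.single (FMon u) 1) \<in> U" for u
  proof (induction u)
    case Nil
    have "Poly_Mapping.single (FMon []) 1 = (1 :: 'f alt_free)" by (simp add: zero_fmon_def[symmetric])
    then show ?case using P.subalg_onD(1)[OF U] by (simp add: e_def)
  next
    case (Cons a u)
    have "Poly_Mapping.single (FMon (a # u)) 1 = gen a * (Poly_Mapping.single (FMon u) 1 :: 'f alt_free)"
      by (simp add: gen_def mult_single)
    then show ?case using P.subalg_onD(3)[OF U gen Cons] by (simp add: C.hom_mult)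
  qed
  have "cls q x \<in> U" for x
  proof (induction x rule: free_alg_induct)
    case zero
    show ?case using P.subalg_onD(5)[OF U] by (simp add: C.hom_0)
  next
    case (add x u c)
    have "Poly_Mapping.single (FMon u) c = c \<bullet> (Poly_Mapping.single (FMon u) 1 :: 'f alt_free)"
      by (rule poly_mapping_eqI) (simp add: lookup_single when_def)
    then show ?case using P.subalg_onD(2)[OF U add P.subalg_onD(4)[OF U mon]] by (simp add: C.hom_add C.hom_scale)
  qed
  then show ?thesis by (auto simp: B_def)
qed

text \<open>
  The centralizer of \<open>z n\<close> is a subalgebra that contains all letters.
\<close>

lemma z_central: "x \<in> B \<Longrightarrow> z n * x = x * z n"
proof -
  let ?U = "{x \<in> B. x * z n = z n * x}"
  have "P.subalg_on e ?U"
    unfolding P.subalg_on_def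
  proof (intro conjI ballI allI)
    show "e \<in> ?U" using P.subalg_onD(1)[OF subalg_on_B] z_in_B by (simp add: e_mult)
    fix x y c assume x: "x \<in> ?U" and y: "y \<in> ?U"
    then show "x + y \<in> ?U" using P.subalg_onD(2)[OF subalg_on_B] by (simp add: algebra_simps)
    have xz: "x * z n = z n * x" and yz: "y * z n = z n * y" using x y by auto
    have "x * y * z n = x * z n * y" by (simp only: mult.assoc yz)
    also have "\<dots> = z n * (x * y)" by (simp only: xz mult.assoc)
    finally have "x * y * z n = z n * (x * y)" .
    then show "x * y \<in> ?U" using x y P.subalg_onD(3)[OF subalg_on_B] by simp
  next
    fix x c assume x: "x \<in> ?U"
    then show "scale_prod c x \<in> ?U" using P.subalg_onD(4)[OF subalg_on_B] by simp
  qed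
  then have "B \<subseteq> ?U"
  proof (rule letters_generate)
    fix k
    show "w k \<in> ?U" "v k \<in> ?U" "g k \<in> ?U" "h k \<in> ?U"
      unfolding z_eq by (simp_all only: mem_Collect_eq letters_in_B P.mult_scale_left P.mult_scale_right A.commutes_Z simp_thms)
  qed
  then show "x \<in> B \<Longrightarrow> z n * x = x * z n" by auto
qed

lemma q_powers_nonzero: "inverse q ^ n + q ^ n \<noteq> 0" if "n \<ge> 1"
proof
  assume "inverse q ^ n + q ^ n = 0"
  then have "q ^ n * (inverse q ^ n + q ^ n) = 0" by simp
  then have "q ^ n * q ^ n = - 1" using good by (simp add: distrib_left power_inverse eq_neg_iff_add_eq_0 add.commute)
  then have "(q ^ n * q ^ n) * (q ^ n * q ^ n) = 1" by simp
  then have "q ^ (n + n + (n + n)) = 1" by (simp add: power_add)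
  moreover have "n + n + (n + n) \<ge> 1" using that by simp
  ultimately show False using good by blast
qed

end

section \<open>Generation by the first two letters and the central elements\<close>

context typed_algebra begin

lemma double_series_in:
  assumes U: "subalg_on e U" and f: "\<And>i j. i \<le> n \<Longrightarrow> j \<le> n \<Longrightarrow> f i j \<in> U" and m: "m \<le> n"
  shows "double_series f s t $ m \<in> U"
  unfolding double_series_def fps_nth_Abs_fps by (intro subalg_onD(7)[OF U] subalg_onD(4)[OF U] f) (use m in auto)

lemma const_fps_mult_double_series_in:
  assumes U: "subalg_on e U" and f: "\<And>i j. i \<le> n \<Longrightarrow> j \<le> n \<Longrightarrow> f i j \<in> U" and c: "c $ 0 = 0"
  shows "(const_fps c * double_series f s t) $ Suc n \<in> U"
  unfolding const_fps_mult_nth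
proof (rule subalg_onD(7)[OF U])
  fix k assume "k \<in> {..Suc n}"
  show "(c $ k) *s (double_series f s t $ (Suc n - k)) \<in> U"
  proof (cases k)
    case 0
    then show ?thesis using c subalg_onD(5)[OF U] by simp
  next
    case (Suc k')
    then show ?thesis by (intro subalg_onD(4)[OF U] double_series_in[OF U, of n] f) simp_all
  qed
qed

end

context alternating begin

lemma Z_nth_0: "Z $ 0 = (inverse ((q\<^sup>2 - inverse q ^ 2)\<^sup>2)) *s (g 0 * h 0)"
proof -
  have "fps_shift 1 (S_series q * S_series (inverse q)) $ 0 = 0"
    by (simp add: fps_mult_nth)
  then show ?thesis
    by (simp add: Z_def det_fps_def Let_def const_fps_mult_nth fps_mult_nth_0 series_at_def)
qed

text \<open>
  In the coefficient of \<open>t\<^sup>N\<close>, the terms in \<open>w\<close> and \<open>v\<close> have a factor of positive order and only involve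
  smaller indices; the product \<open>g(S) h(T)\<close> contributes \<open>g N\<close> and \<open>h N\<close> only together with \<open>h 0\<close> and \<open>g 0\<close>.
\<close>

lemma Z_leading:
  assumes U: "subalg_on e U" and wv: "\<And>i. i \<le> n \<Longrightarrow> w i \<in> U \<and> v i \<in> U \<and> g i \<in> U \<and> h i \<in> U"
  defines "N \<equiv> Suc n"
  shows "Z $ N - (inverse ((q\<^sup>2 - inverse q ^ 2)\<^sup>2)) *s ((q2 q * inverse q) ^ N *s (g N * h 0) + (q2 q * q) ^ N *s (g 0 * h N)) \<in> U"
proof -
  let ?S = "S_series q" and ?T = "S_series (inverse q)"
  let ?k = "inverse ((q\<^sup>2 - inverse q ^ 2)\<^sup>2)"
  have S0: "?S $ 0 = 0" "?T $ 0 = 0" by simp_all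
  have sh: "fps_shift 1 (?S * ?T) $ 0 = 0" "(fps_X * ?S * ?T) $ 0 = 0"
    "(fps_const (q\<^sup>2) * ?S * ?T) $ 0 = 0" "(fps_const (inverse q ^ 2) * ?S * ?T) $ 0 = 0"
    by (simp_all add: fps_mult_nth)
  define R where "R = const_fps (fps_shift 1 (?S * ?T)) * double_series (\<lambda>i j. w i * v j) ?S ?T
     + const_fps (fps_X * ?S * ?T) * double_series (\<lambda>i j. v i * w j) ?S ?T
     - const_fps (fps_const (q\<^sup>2) * ?S * ?T) * double_series (\<lambda>i j. w i * w j) ?S ?T
     - const_fps (fps_const (inverse q ^ 2) * ?S * ?T) * double_series (\<lambda>i j. v i * v j) ?S ?T"
  have "R $ N \<in> U"
    unfolding R_def N_def fps_add_nth fps_sub_nth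
    by (intro subalg_onD(2,6)[OF U] const_fps_mult_double_series_in[OF U] subalg_onD(3)[OF U] sh) (use wv in auto)
  moreover have "Z = R + const_fps (fps_const ?k) * double_series (\<lambda>i j. g i * h j) ?S ?T"
    by (simp add: Z_def det_fps_def Let_def R_def series_at_mult[OF S0])
  then have "Z $ N = R $ N + ?k *s (double_series (\<lambda>i j. g i * h j) ?S ?T $ N)"
    by (simp add: const_fps_mult_nth if_distrib[of "\<lambda>c. c *s _"] cong: if_cong)
  moreover have "double_series (\<lambda>i j. g i * h j) ?S ?T $ N
      - ((q2 q * inverse q) ^ N *s (g N * h 0) + (q2 q * q) ^ N *s (g 0 * h N)) \<in> U"
  proof -
    let ?f = "\<lambda>i j. ((?S ^ i * ?T ^ j) $ N) *s (g i * h j)"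
    have lead: "?S ^ N $ N = (q2 q * inverse q) ^ N" "?T ^ N $ N = (q2 q * q) ^ N"
      using startsby_zero_power_nth_same[OF S0(1), of N] startsby_zero_power_nth_same[OF S0(2), of N] by simp_all
    have z: "?f i j = 0" if "i + j > N" for i j
      using power_mult_power_nth_below[OF S0 that] by simp
    have "double_series (\<lambda>i j. g i * h j) ?S ?T $ N = (\<Sum>i\<le>Suc n. \<Sum>j\<le>Suc n. ?f i j)"
      by (simp only: double_series_def fps_nth_Abs_fps N_def)
    also have "\<dots> = (\<Sum>i\<le>n. \<Sum>j\<le>n. ?f i j) + (\<Sum>i\<le>n. ?f i N) + (\<Sum>j\<le>Suc n. ?f N j)"
      by (simp only: sum.atMost_Suc sum.distrib N_def add_ac)
    also have "(\<Sum>i\<le>n. ?f i N) = ?f 0 N"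
      by (subst sum.remove[of _ 0]) (auto intro!: sum.neutral z)
    also have "(\<Sum>j\<le>Suc n. ?f N j) = ?f N 0"
      by (subst sum.remove[of _ 0]) (auto intro!: sum.neutral z)
    finally have "double_series (\<lambda>i j. g i * h j) ?S ?T $ N
      - ((q2 q * inverse q) ^ N *s (g N * h 0) + (q2 q * q) ^ N *s (g 0 * h N)) = (\<Sum>i\<le>n. \<Sum>j\<le>n. ?f i j)"
      by (simp add: lead)
    also have "\<dots> \<in> U"
      by (intro subalg_onD(7)[OF U] subalg_onD(4)[OF U] subalg_onD(3)[OF U]) (use wv in auto)
    finally show ?thesis .
  qed
  ultimately show ?thesis
  proof -
    assume a: "R $ N \<in> U" and b: "Z $ N = R $ N + ?k *s (double_series (\<lambda>i j. g i * h j) ?S ?T $ N)"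
      and c: "double_series (\<lambda>i j. g i * h j) ?S ?T $ N
      - ((q2 q * inverse q) ^ N *s (g N * h 0) + (q2 q * q) ^ N *s (g 0 * h N)) \<in> U"
    have "R $ N + ?k *s (double_series (\<lambda>i j. g i * h j) ?S ?T $ N
      - ((q2 q * inverse q) ^ N *s (g N * h 0) + (q2 q * q) ^ N *s (g 0 * h N))) \<in> U"
      by (intro subalg_onD[OF U] a c)
    then show ?thesis unfolding b by (simp only: scale_right_diff_distrib add_diff_eq)
  qed
qed

end

context good_parameter begin

lemma g0_eq: "g 0 = scale_prod (- (q - inverse q) * (q2 q)\<^sup>2) e" "h 0 = scale_prod (- (q - inverse q) * (q2 q)\<^sup>2) e"
  by (simp_all only: G_def Gt_def nat.case e_def C.hom_scale)

lemma W01_Z_generate: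
  assumes U: "P.subalg_on e U" and w0: "w 0 \<in> U" and v0: "v 0 \<in> U" and z: "\<And>n. n \<ge> 1 \<Longrightarrow> z n \<in> U"
  shows "B \<subseteq> U"
proof -
  note U' = P.subalg_onD[OF U]
  let ?\<kappa> = "- (q - inverse q) * (q2 q)\<^sup>2"
  let ?k = "inverse ((q\<^sup>2 - inverse q ^ 2)\<^sup>2)"
  have \<kappa>: "?\<kappa> \<noteq> 0" using A.q_diff_nonzero A.q2_nonzero by simp
  have k: "?k \<noteq> 0" using A.rho_nonzero A.rho_eq' by simp
  have div: "x \<in> U" if "scale_prod c x \<in> U" "c \<noteq> 0" for c x
    using U'(4)[OF that(1), of "inverse c"] that(2) by simp
  have all: "w n \<in> U \<and> v n \<in> U \<and> g n \<in> U \<and> h n \<in> U" for n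
  proof (induction n rule: less_induct)
    case (less n)
    show ?case
    proof (cases n)
      case 0
      then show ?thesis using w0 v0 U'(1,4) unfolding 0 g0_eq by auto
    next
      case (Suc m)
      have IH: "w i \<in> U \<and> v i \<in> U \<and> g i \<in> U \<and> h i \<in> U" if "i \<le> m" for i
        using less that Suc by simp
      let ?\<alpha> = "(q2 q * inverse q) ^ n" and ?\<beta> = "(q2 q * q) ^ n"
      have zn: "A.Z $ n \<in> U"
        by (rule div[of "inverse (q2 q ^ n)"]) (use z[of n] A.q2_nonzero Suc in \<open>simp_all add: z_eq\<close>)
      have "A.Z $ n - scale_prod ?k (scale_prod ?\<alpha> (g n * h 0) + scale_prod ?\<beta> (g 0 * h n)) \<in> U"
        unfolding Suc by (rule A.Z_leading[OF U IH])
      from U'(6)[OF zn this] have "scale_prod ?k (scale_prod ?\<alpha> (g n * h 0) + scale_prod ?\<beta> (g 0 * h n)) \<in> U"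
        by simp
      then have "scale_prod ?\<alpha> (g n * h 0) + scale_prod ?\<beta> (g 0 * h n) \<in> U" by (rule div) (rule k)
      also have "scale_prod ?\<alpha> (g n * h 0) + scale_prod ?\<beta> (g 0 * h n) = scale_prod ?\<kappa> (scale_prod ?\<alpha> (g n) + scale_prod ?\<beta> (h n))"
        unfolding A.h0 A.g0 by (simp add: P.scale_right_distrib mult.commute)
      finally have 1: "scale_prod ?\<alpha> (g n) + scale_prod ?\<beta> (h n) \<in> U" by (rule div) (rule \<kappa>)
      have 2: "h n - g n \<in> U"
      proof -
        have "h n - g n = scale_prod (q2 q) (w 0 * v m - v m * w 0)"
          unfolding Suc using A.wv0[of m] A.q2_nonzero by simp
        also have "\<dots> \<in> U" by (intro U' w0) (use IH in auto)
        finally show ?thesis .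
      qed
      have "scale_prod ?\<alpha> (g n) + scale_prod ?\<beta> (h n) - scale_prod ?\<beta> (h n - g n) \<in> U"
        by (rule U'(6)[OF 1 U'(4)[OF 2]])
      then have "scale_prod (?\<alpha> + ?\<beta>) (g n) \<in> U"
        by (simp add: P.scale_right_diff_distrib P.scale_left_distrib)
      moreover have "?\<alpha> + ?\<beta> = q2 q ^ n * (inverse q ^ n + q ^ n)" by (simp add: power_mult_distrib distrib_left)
      then have "?\<alpha> + ?\<beta> \<noteq> 0" using A.q2_nonzero q_powers_nonzero[of n] Suc by simp
      ultimately have gn: "g n \<in> U" by (rule div)
      from U'(2)[OF 2 gn] have hn: "h n \<in> U" by simp
      have wm: "w m \<in> U" "v m \<in> U" using IH by auto
      have "scale_prod (rho q) (w n) - scale_prod (rho q) (v m) \<in> U"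
        unfolding Suc A.w0g[symmetric] by (intro U' w0) (use gn Suc in simp_all)
      from U'(2)[OF this U'(4)[OF wm(2), of "rho q"]] have "scale_prod (rho q) (w n) \<in> U" by simp
      then have wn: "w n \<in> U" by (rule div) (rule A.rho_nonzero)
      have "scale_prod (rho q) (v n) - scale_prod (rho q) (w m) \<in> U"
        unfolding Suc A.gv0[symmetric] by (intro U' v0) (use gn Suc in simp_all)
      from U'(2)[OF this U'(4)[OF wm(1), of "rho q"]] have "scale_prod (rho q) (v n) \<in> U" by simp
      then have vn: "v n \<in> U" by (rule div) (rule A.rho_nonzero)
      show ?thesis using gn hn wn vn by simp
    qed
  qed
  show ?thesis by (rule letters_generate[OF U]) (use all in auto)
qed

text \<open>
  The endomorphism of the algebra that is induced by the twist; it is independent of the choice of a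
  representative by \<open>twist_hom_respects\<close>.
\<close>

definition \<sigma> where "\<sigma> c n b = cls q (twist_hom q c n (SOME x. cls q x = b))"

lemma \<sigma>_cls: "n \<ge> 1 \<Longrightarrow> \<sigma> c n (cls q x) = cls q (twist_hom q c n x)"
  unfolding \<sigma>_def by (rule twist_hom_respects[OF good]) (auto intro: someI[of "\<lambda>y. cls q y = cls q x"])

lemma \<sigma>_hom:
  assumes n: "n \<ge> 1" and x: "x \<in> B" and y: "y \<in> B"
  shows "\<sigma> c n (x + y) = \<sigma> c n x + \<sigma> c n y" "\<sigma> c n (x * y) = \<sigma> c n x * \<sigma> c n y"
    "\<sigma> c n (scale_prod a x) = scale_prod a (\<sigma> c n x)" "\<sigma> c n e = e" "\<sigma> c n x \<in> B"
proof -
  obtain x' y' where xy: "x = cls q x'" "y = cls q y'" using x y by (auto simp: B_def)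
  show "\<sigma> c n (x + y) = \<sigma> c n x + \<sigma> c n y" "\<sigma> c n (x * y) = \<sigma> c n x * \<sigma> c n y"
    "\<sigma> c n (scale_prod a x) = scale_prod a (\<sigma> c n x)" "\<sigma> c n e = e" "\<sigma> c n x \<in> B"
    unfolding xy e_def C.hom_add[symmetric] C.hom_mult[symmetric] C.hom_scale[symmetric] \<sigma>_cls[OF n] twist_hom_simps
    by (simp_all add: B_def)
qed

lemma \<sigma>_W01:
  assumes "n \<ge> 1" shows "\<sigma> c n (w 0) = w 0" "\<sigma> c n (v 0) = v 0"
  unfolding \<sigma>_cls[OF assms] twist_hom_letters[OF assms] free.twist_0[OF assms] by (rule refl)+

text \<open>
  The twist multiplies \<open>Z(t)\<close> by \<open>(1 + c S\<^sup>n) (1 + c T\<^sup>n)\<close>. Modulo \<open>t\<^sup>n\<^sup>+\<^sup>1\<close> this is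
  \<open>1 + c (q + q\<^sup>-\<^sup>1)\<^sup>n (q\<^sup>n + q\<^sup>-\<^sup>n) t\<^sup>n\<close>, and \<open>Z\<^sub>0\<close> is the scalar \<open>(q + q\<^sup>-\<^sup>1)\<^sup>2\<close>.
\<close>

lemma \<sigma>_Z:
  assumes n: "n \<ge> 1" and m: "m \<le> n"
  shows "\<sigma> c n (z m) = z m + (if m = n then scale_prod (c * ((inverse q ^ n + q ^ n) * (q2 q)\<^sup>2)) e else 0)"
proof -
  let ?S = "S_series q" and ?T = "S_series (inverse q)"
  let ?f = "(1 + fps_const c * ?S ^ n) * (1 + fps_const c * ?T ^ n)"
  have S0: "?S $ 0 = 0" "?T $ 0 = 0" by simp_all
  have lead: "?S ^ n $ n = (q2 q * inverse q) ^ n" "?T ^ n $ n = (q2 q * q) ^ n"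
    using startsby_zero_power_nth_same[OF S0(1), of n] startsby_zero_power_nth_same[OF S0(2), of n] by simp_all
  have "D.series_image q c n (Z_series q) = P.const_fps ?f * A.Z"
    unfolding D.hom_Z twist_hom_letters[OF n] cls_twist P.det_fps_twist A.Z_def ..
  then have "cls q (twist_hom q c n (Z_series q $ m)) = (P.const_fps ?f * A.Z) $ m"
    by (simp add: D.series_image_def fps_eq_iff)
  also have "\<dots> = (\<Sum>i\<le>m. scale_prod (?f $ i) (A.Z $ (m - i)))"
    by (rule P.const_fps_mult_nth)
  also have "\<dots> = A.Z $ m + (if m = n then scale_prod (c * ((q2 q * inverse q) ^ n + (q2 q * q) ^ n)) (A.Z $ 0) else 0)"
  proof -
    have expand: "?f = 1 + fps_const c * ?S ^ n + fps_const c * ?T ^ n + fps_const (c * c) * (?S ^ n * ?T ^ n)"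
      by (simp add: algebra_simps fps_const_mult[symmetric] del: fps_const_mult)
    have f: "?f $ i = (if i = 0 then 1 else if i = n then c * ((q2 q * inverse q) ^ n + (q2 q * q) ^ n) else 0)" if "i \<le> n" for i
    proof -
      have "(?S ^ n * ?T ^ n) $ i = 0" using P.power_mult_power_nth_below[OF S0, of i n n] that n by simp
      moreover have "?S ^ n $ i = (if i = n then (q2 q * inverse q) ^ n else 0)" "?T ^ n $ i = (if i = n then (q2 q * q) ^ n else 0)"
        using that lead startsby_zero_power_prefix[OF S0(1), of n] startsby_zero_power_prefix[OF S0(2), of n] by auto
      ultimately show ?thesis unfolding expand using n by (simp add: distrib_left)
    qed
    have "(\<Sum>i\<le>m. scale_prod (?f $ i) (A.Z $ (m - i)))
      = (\<Sum>i\<le>m. (if i = 0 then A.Z $ m else 0) + (if i = n then scale_prod (c * ((q2 q * inverse q) ^ n + (q2 q * q) ^ n)) (A.Z $ (m - n)) else 0))"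
      by (rule sum.cong[OF refl]) (use f m n in auto)
    also have "\<dots> = A.Z $ m + (if m = n then scale_prod (c * ((q2 q * inverse q) ^ n + (q2 q * q) ^ n)) (A.Z $ 0) else 0)"
      using m by (auto simp: sum.distrib)
    finally show ?thesis .
  qed
  also have "A.Z $ 0 = scale_prod ((q2 q)\<^sup>2) e"
  proof -
    let ?\<kappa> = "- (q - inverse q) * (q2 q)\<^sup>2"
    have "e * e = e" by (rule e_mult) (rule P.subalg_onD(1)[OF subalg_on_B])
    then have "A.Z $ 0 = scale_prod (inverse ((q\<^sup>2 - inverse q ^ 2)\<^sup>2) * (?\<kappa> * ?\<kappa>)) e"
      unfolding A.Z_nth_0 g0_eq by simp
    also have "?\<kappa> * ?\<kappa> = - rho q * (q2 q)\<^sup>2"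
      unfolding A.rho_eq by (simp add: power2_eq_square algebra_simps)
    also have "inverse ((q\<^sup>2 - inverse q ^ 2)\<^sup>2) = inverse (- rho q)" unfolding A.rho_eq' by simp
    also have "inverse (- rho q) * (- rho q * (q2 q)\<^sup>2) = (q2 q)\<^sup>2" using A.rho_nonzero by simp
    finally show ?thesis .
  qed
  finally have "cls q (twist_hom q c n (inverse (q2 q ^ m) \<bullet> Z_series q $ m)) = scale_prod (inverse (q2 q ^ m)) (A.Z $ m +
      (if m = n then scale_prod (c * ((q2 q * inverse q) ^ n + (q2 q * q) ^ n)) (scale_prod ((q2 q)\<^sup>2) e) else 0))"
    by (simp only: twist_hom_simps C.hom_scale)
  moreover have "inverse (q2 q ^ n) * (c * ((q2 q * inverse q) ^ n + (q2 q * q) ^ n)) * (q2 q)\<^sup>2 = c * ((inverse q ^ n + q ^ n) * (q2 q)\<^sup>2)"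
  proof -
    have "(q2 q * inverse q) ^ n + (q2 q * q) ^ n = q2 q ^ n * (inverse q ^ n + q ^ n)"
      by (simp add: power_mult_distrib distrib_left)
    then show ?thesis using A.q2_nonzero by (simp add: mult_ac)
  qed
  ultimately show ?thesis
    unfolding z_def[of m] \<sigma>_cls[OF n] unfolding C.hom_scale cls_Z by (simp add: P.scale_right_distrib mult.assoc)
qed

end

section \<open>Independence of the central elements\<close>

context good_parameter begin

primrec Z_upto :: "nat \<Rightarrow> 'f Aq_prod set" where
  "Z_upto 0 = range (\<lambda>c. scale_prod c e)"
| "Z_upto (Suc n) = P.adjoin (Z_upto n) (z (Suc n))"

lemma e_idem: "e * e = e" by (rule e_mult) (rule P.subalg_onD(1)[OF subalg_on_B])

lemma adjoin_subset_B: "Y \<subseteq> B \<Longrightarrow> P.adjoin Y (z n) \<subseteq> B"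
proof
  fix x assume "Y \<subseteq> B" "x \<in> P.adjoin Y (z n)"
  from this(2,1) show "x \<in> B"
    by induction (auto intro!: P.subalg_onD(2,3)[OF subalg_on_B] z_in_B)
qed

lemma Z_upto_props: "P.subalg_on e (Z_upto n) \<and> Z_upto n \<subseteq> B"
proof (induction n)
  case 0
  have "P.subalg_on e (Z_upto 0)"
    unfolding P.subalg_on_def
  proof (intro conjI ballI allI)
    show "e \<in> Z_upto 0" using P.scale_one[of e] by (metis Z_upto.simps(1) rangeI)
    fix x y assume "x \<in> Z_upto 0" "y \<in> Z_upto 0"
    then obtain a b where "x = scale_prod a e" "y = scale_prod b e" by auto
    then have "x + y = scale_prod (a + b) e" "x * y = scale_prod (b * a) e"
      by (simp_all add: P.scale_left_distrib e_idem)
    then show "x + y \<in> Z_upto 0" "x * y \<in> Z_upto 0" by auto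
  qed auto
  then show ?case using P.subalg_onD(1,4)[OF subalg_on_B] by auto
next
  case (Suc n)
  then have "Z_upto (Suc n) \<subseteq> B" using adjoin_subset_B by simp
  moreover have "P.subalg_on e (Z_upto (Suc n))"
    unfolding Z_upto.simps
  proof (rule P.subalg_on_adjoin)
    fix y assume "y \<in> P.adjoin (Z_upto n) (z (Suc n))"
    then have "y \<in> B" using adjoin_subset_B[of "Z_upto n" "Suc n"] Suc by blast
    then show "z (Suc n) * y = y * z (Suc n)" by (rule z_central)
  qed (use Suc in simp)
  ultimately show ?case by simp
qed

lemmas subalg_on_Z_upto = Z_upto_props[THEN conjunct1]
lemma Z_upto_mono: "m \<le> n \<Longrightarrow> Z_upto m \<subseteq> Z_upto n"
  by (induction n rule: dec_induct) (auto intro: P.adjoin.base)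

lemma z_in_Z_upto: "n \<ge> 1 \<Longrightarrow> z n \<in> Z_upto n"
proof (cases n)
  case (Suc m)
  have "0 + e * z (Suc m) \<in> Z_upto (Suc m)"
    unfolding Z_upto.simps by (intro P.adjoin.step P.adjoin.base P.subalg_onD(1,5)[OF subalg_on_Z_upto])
  then show ?thesis using Suc by (simp add: e_mult z_in_B)
qed simp

definition Z_all where "Z_all = (\<Union>n. Z_upto n)"

lemma subalg_on_Z_all: "P.subalg_on e Z_all"
  unfolding P.subalg_on_def
proof (intro conjI ballI allI)
  show "e \<in> Z_all" using P.subalg_onD(1)[OF subalg_on_Z_upto] by (auto simp: Z_all_def)
  fix x y assume "x \<in> Z_all" "y \<in> Z_all"
  then obtain m n where "x \<in> Z_upto m" "y \<in> Z_upto n" by (auto simp: Z_all_def)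
  then have xy: "x \<in> Z_upto (max m n)" "y \<in> Z_upto (max m n)"
    using Z_upto_mono[of m "max m n"] Z_upto_mono[of n "max m n"] by auto
  have "x + y \<in> Z_upto (max m n)" "x * y \<in> Z_upto (max m n)" by (rule P.subalg_onD(2,3)[OF subalg_on_Z_upto] xy)+
  then show "x + y \<in> Z_all" "x * y \<in> Z_all" by (auto simp: Z_all_def)
next
  fix c x assume "x \<in> Z_all"
  then show "scale_prod c x \<in> Z_all" using P.subalg_onD(4)[OF subalg_on_Z_upto] by (auto simp: Z_all_def)
qed

text \<open>
  These will be the coefficients of polynomials in \<open>z n\<close>, which the twists of order \<open>n\<close> translate.
\<close>

definition Fixed where "Fixed n = {x \<in> B. \<forall>c. \<sigma> c n x = x}"

lemma subalg_on_Fixed: "n \<ge> 1 \<Longrightarrow> P.subalg_on e (Fixed n)"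
  unfolding P.subalg_on_def Fixed_def using P.subalg_onD(1-4)[OF subalg_on_B] by (auto simp: \<sigma>_hom)

lemma Z_upto_Fixed: "m < n \<Longrightarrow> Z_upto m \<subseteq> Fixed n"
proof (induction m)
  case 0
  then show ?case using P.subalg_onD(1,4)[OF subalg_on_Fixed[of n]] by auto
next
  case (Suc m)
  then have IH: "Z_upto m \<subseteq> Fixed n" and n: "n \<ge> 1" by simp_all
  have z: "z (Suc m) \<in> Fixed n" using \<sigma>_Z[OF n, of "Suc m"] Suc.prems z_in_B by (simp add: Fixed_def)
  show ?case
  proof
    fix x assume "x \<in> Z_upto (Suc m)"
    then have "x \<in> P.adjoin (Z_upto m) (z (Suc m))" by simp
    then show "x \<in> Fixed n"
      by induction (use IH z P.subalg_onD(2,3)[OF subalg_on_Fixed[OF n]] in auto)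
  qed
qed

text \<open>
  The endomorphisms \<open>\<sigma>\<close> fix the coefficients and translate \<open>z n\<close> by arbitrary scalars, so the polynomial
  vanishes at all translates of \<open>z n\<close>.
\<close>

lemma transcendental:
  assumes n: "n \<ge> 1" and p: "\<And>j. p j \<in> Fixed n" and zero: "(\<Sum>j\<le>N. p j * z n ^ j) = 0" and j: "j \<le> N"
  shows "p j = 0"
proof -
  let ?k = "(inverse q ^ n + q ^ n) * (q2 q)\<^sup>2"
  have k: "?k \<noteq> 0" using q_powers_nonzero[OF n] A.q2_nonzero by simp
  have pB: "x * z n ^ i \<in> B" if "x \<in> B" for x i
    by (induction i) (use that z_in_B P.subalg_onD(3)[OF subalg_on_B] in \<open>auto simp: power_Suc2 mult.assoc[symmetric] simp del: power_Suc\<close>)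
  have image: "\<sigma> c n (x * z n ^ i) = x * (z n + scale_prod (c * ?k) 1) ^ i" if "x \<in> Fixed n" for c x i
  proof (induction i)
    case 0
    then show ?case using that by (simp add: Fixed_def)
  next
    case (Suc i)
    have x: "x \<in> B" using that by (simp add: Fixed_def)
    define Y where "Y = x * z n ^ i"
    have Y: "Y \<in> B" unfolding Y_def by (rule pB[OF x])
    have "x * z n ^ Suc i = Y * z n" by (simp add: Y_def power_Suc2 mult.assoc del: power_Suc)
    then have "\<sigma> c n (x * z n ^ Suc i) = \<sigma> c n Y * \<sigma> c n (z n)" by (simp only: \<sigma>_hom[OF n Y z_in_B])
    also have "\<sigma> c n (z n) = z n + scale_prod (c * ?k) e" using \<sigma>_Z[OF n, of n] by simp
    also have "\<sigma> c n Y * (z n + scale_prod (c * ?k) e) = \<sigma> c n Y * (z n + scale_prod (c * ?k) 1)"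
      using e_mult(2)[OF \<sigma>_hom(5)[OF n Y Y]] by (simp add: distrib_left)
    finally show ?case using Suc by (simp add: Y_def power_Suc2 mult.assoc del: power_Suc)
  qed
  have zero': "(\<Sum>j\<le>N. p j * (z n + scale_prod c 1) ^ j) = 0" for c
  proof -
    have sum: "\<sigma> a n (\<Sum>j\<in>J. p j * z n ^ j) = (\<Sum>j\<in>J. \<sigma> a n (p j * z n ^ j)) \<and> (\<Sum>j\<in>J. p j * z n ^ j) \<in> B" if "finite J" for J a
      using that
    proof (induction J)
      case empty
      have "\<sigma> a n (scale_prod 0 e) = scale_prod 0 (\<sigma> a n e)" by (rule \<sigma>_hom[OF n]) (rule P.subalg_onD(1)[OF subalg_on_B])+
      then show ?case using P.subalg_onD(5)[OF subalg_on_B] by simp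
    next
      case (insert i J)
      have "p i * z n ^ i \<in> B" using p[of i] by (intro pB) (simp add: Fixed_def)
      then show ?case using insert \<sigma>_hom(1)[OF n] P.subalg_onD(2)[OF subalg_on_B] by simp
    qed
    have "\<sigma> (c / ?k) n (\<Sum>j\<le>N. p j * z n ^ j) = (\<Sum>j\<le>N. p j * (z n + scale_prod (c / ?k * ?k) 1) ^ j)"
      using sum[of "{..N}"] image[OF p] by simp
    moreover have "\<sigma> (c / ?k) n 0 = 0" using sum[of "{}"] by simp
    moreover have "c / ?k * ?k = c" using k by simp
    ultimately show ?thesis unfolding zero by metis
  qed
  show ?thesis
    by (rule P.polynomial_zero[OF _ _ zero' j]) (use good in auto)
qed

text \<open>
  If the \<open>\<zeta> i\<close> are polynomials in \<open>z (Suc n)\<close> with coefficients \<open>y i j\<close>, then \<open>\<Sum> \<beta> i * \<zeta> i\<close> is a polynomial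
  whose coefficients \<open>\<Sum> \<beta> i * y i j\<close> are fixed, hence zero; the induction hypothesis applies to them.
\<close>

lemma independent_over_Z_upto:
  assumes I: "finite I" and \<beta>: "\<And>i n. i \<in> I \<Longrightarrow> n \<ge> 1 \<Longrightarrow> \<beta> i \<in> Fixed n"
    and indep: "\<And>c i. (\<Sum>i\<in>I. scale_prod (c i) (\<beta> i)) = 0 \<Longrightarrow> i \<in> I \<Longrightarrow> c i = 0"
    and \<zeta>: "\<And>i. i \<in> I \<Longrightarrow> \<zeta> i \<in> Z_upto n" and zero: "(\<Sum>i\<in>I. \<beta> i * \<zeta> i) = 0" and i: "i \<in> I"
  shows "\<zeta> i = 0"
  using \<zeta> zero i
proof (induction n arbitrary: \<zeta> i)
  case 0
  then have "\<forall>i\<in>I. \<exists>c. \<zeta> i = scale_prod c e" by auto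
  then obtain c where c: "\<And>i. i \<in> I \<Longrightarrow> \<zeta> i = scale_prod (c i) e" by metis
  have B: "\<beta> i \<in> B" if "i \<in> I" for i using \<beta>[OF that, of 1] by (simp add: Fixed_def)
  have "(\<Sum>i\<in>I. scale_prod (c i) (\<beta> i)) = (\<Sum>i\<in>I. \<beta> i * \<zeta> i)"
    by (rule sum.cong) (simp_all add: c e_mult B)
  then have "c i = 0" using indep 0 by metis
  then show ?case using c 0 by simp
next
  case (Suc n)
  let ?z = "z (Suc n)"
  have "\<exists>N y. (\<forall>j. y j \<in> Z_upto n) \<and> (\<forall>j>N. y j = 0) \<and> \<zeta> i = (\<Sum>j\<le>N. y j * ?z ^ j)" if "i \<in> I" for i
  proof -
    have "\<zeta> i \<in> P.adjoin (Z_upto n) ?z" using Suc.prems(1)[OF that] by simp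
    from P.adjoin_sum[OF this P.subalg_onD(5)[OF subalg_on_Z_upto]] show ?thesis by metis
  qed
  then have "\<forall>i\<in>I. \<exists>Ny. (\<forall>j. snd Ny j \<in> Z_upto n) \<and> (\<forall>j>fst Ny. snd Ny j = 0) \<and> \<zeta> i = (\<Sum>j\<le>fst Ny. snd Ny j * ?z ^ j)"
    by simp
  from bchoice[OF this] obtain Ny where Ny: "\<forall>i\<in>I. (\<forall>j. snd (Ny i) j \<in> Z_upto n) \<and> (\<forall>j>fst (Ny i). snd (Ny i) j = 0)
      \<and> \<zeta> i = (\<Sum>j\<le>fst (Ny i). snd (Ny i) j * ?z ^ j)" ..
  define y where "y i = snd (Ny i)" for i
  define N where "N = (\<Sum>i\<in>I. fst (Ny i))"
  have y: "y i j \<in> Z_upto n" if "i \<in> I" for i j using Ny that by (simp add: y_def)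
  have z\<zeta>: "\<zeta> i = (\<Sum>j\<le>N. y i j * ?z ^ j)" if "i \<in> I" for i
  proof -
    have "fst (Ny i) \<le> N" unfolding N_def by (rule member_le_sum) (use that I in auto)
    then have "(\<Sum>j\<le>fst (Ny i). y i j * ?z ^ j) = (\<Sum>j\<le>N. y i j * ?z ^ j)"
      by (intro sum.mono_neutral_left) (use Ny that in \<open>auto simp: y_def\<close>)
    then show ?thesis using Ny that by (simp add: y_def)
  qed
  define p where "p j = (\<Sum>i\<in>I. \<beta> i * y i j)" for j
  have p: "p j \<in> Fixed (Suc n)" for j
    unfolding p_def
  proof (rule P.subalg_onD(7)[OF subalg_on_Fixed])
    fix i assume "i \<in> I"
    then show "\<beta> i * y i j \<in> Fixed (Suc n)"
      using \<beta> y Z_upto_Fixed[of n "Suc n"] by (intro P.subalg_onD(3)[OF subalg_on_Fixed]) auto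
  qed simp
  have "(\<Sum>j\<le>N. p j * ?z ^ j) = (\<Sum>i\<in>I. \<beta> i * \<zeta> i)"
  proof -
    have "(\<Sum>j\<le>N. p j * ?z ^ j) = (\<Sum>j\<le>N. \<Sum>i\<in>I. \<beta> i * (y i j * ?z ^ j))"
      by (simp add: p_def sum_distrib_right mult.assoc)
    also have "\<dots> = (\<Sum>i\<in>I. \<Sum>j\<le>N. \<beta> i * (y i j * ?z ^ j))" by (rule sum.swap)
    also have "\<dots> = (\<Sum>i\<in>I. \<beta> i * \<zeta> i)" by (rule sum.cong) (simp_all add: z\<zeta> sum_distrib_left)
    finally show ?thesis .
  qed
  then have zero: "(\<Sum>j\<le>N. p j * ?z ^ j) = 0" using Suc.prems(2) by simp
  have "p j = 0" if "j \<le> N" for j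
    by (rule transcendental[OF _ p zero that]) simp
  then have "y i j = 0" if "i \<in> I" "j \<le> N" for i j
    using Suc.IH[of "\<lambda>i. y i j" i] y that by (simp add: p_def)
  then show ?case using z\<zeta>[OF Suc.prems(3)] Suc.prems(3) by simp
qed

end

section \<open>The kernel of the multiplication map\<close>

lemma subalgI:
  assumes "F_algebra A" and "B \<subseteq> carrier A" "\<one>\<^bsub>A\<^esub> \<in> B"
    and "\<And>x y. x \<in> B \<Longrightarrow> y \<in> B \<Longrightarrow> x \<oplus>\<^bsub>A\<^esub> y \<in> B" "\<And>x y. x \<in> B \<Longrightarrow> y \<in> B \<Longrightarrow> x \<otimes>\<^bsub>A\<^esub> y \<in> B"
    and "\<And>c x. x \<in> B \<Longrightarrow> c \<odot>\<^bsub>A\<^esub> x \<in> B"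
  shows "subalg A B"
proof -
  interpret F_algebra A by fact
  have "\<ominus>\<^bsub>A\<^esub> x = (- 1) \<odot>\<^bsub>A\<^esub> x" if "x \<in> carrier A" for x
  proof (rule minus_equality)
    have "(- 1) \<odot>\<^bsub>A\<^esub> x \<oplus>\<^bsub>A\<^esub> 1 \<odot>\<^bsub>A\<^esub> x = (- 1 + 1) \<odot>\<^bsub>A\<^esub> x" using that by (rule smult_l_distr[symmetric])
    also have "\<dots> = \<zero>\<^bsub>A\<^esub>"
    proof -
      have "0 \<odot>\<^bsub>A\<^esub> x \<oplus>\<^bsub>A\<^esub> 0 \<odot>\<^bsub>A\<^esub> x = 0 \<odot>\<^bsub>A\<^esub> x" using smult_l_distr[OF that, of 0 0] by simp
      then show ?thesis using smult_closed[OF that, of 0] by (simp add: add.l_cancel_one')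
    qed
    finally show "(- 1) \<odot>\<^bsub>A\<^esub> x \<oplus>\<^bsub>A\<^esub> x = \<zero>\<^bsub>A\<^esub>" using that by (simp add: smult_one)
  qed (simp_all add: that smult_closed)
  then have "\<ominus>\<^bsub>A\<^esub> x \<in> B" if "x \<in> B" for x using assms(2,6) that by (metis subsetD)
  then have "subring B A" by (intro subringI) (use assms in auto)
  then show ?thesis using assms(6) by (simp add: subalg_def)
qed

lemma subalg_hull:
  assumes A: "F_algebra A" and S: "S \<subseteq> carrier A"
  shows "subalg A (subalg A hull S)"
proof -
  interpret F_algebra A by fact
  have "subalg A (carrier A)" by (rule subalgI[OF A]) (simp_all add: smult_closed)
  then have sub: "subalg A hull S \<subseteq> carrier A" by (rule hull_minimal[OF S])
  have H: "x \<in> subalg A hull S \<longleftrightarrow> (\<forall>T. subalg A T \<and> S \<subseteq> T \<longrightarrow> x \<in> T)" for x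
    by (auto simp: hull_def)
  show ?thesis
  proof (rule subalgI[OF A sub])
    show "\<one>\<^bsub>A\<^esub> \<in> subalg A hull S" by (auto simp: H subalg_def dest: subringE(3))
  qed (simp_all only: H subalg_def, auto dest: subringE(6,7))
qed

lemma subalgD:
  assumes "subalg A B"
  shows "B \<subseteq> carrier A" "\<one>\<^bsub>A\<^esub> \<in> B" "x \<in> B \<Longrightarrow> y \<in> B \<Longrightarrow> x \<oplus>\<^bsub>A\<^esub> y \<in> B" "x \<in> B \<Longrightarrow> y \<in> B \<Longrightarrow> x \<otimes>\<^bsub>A\<^esub> y \<in> B"
    "x \<in> B \<Longrightarrow> c \<odot>\<^bsub>A\<^esub> x \<in> B"
  using assms unfolding subalg_def by (auto dest: subringE(1,3,6,7))

lemma inc_scale: "x \<in> carrier (Aq q) \<Longrightarrow> inc q (c \<odot>\<^bsub>Aq q\<^esub> x) = scale_prod c (inc q x)"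
  by (rule inc_simps(3))

lemmas inc_hom = inc_simps(1,2) inc_scale

context good_parameter begin

abbreviation "\<iota> \<equiv> inc q"

lemma inc_image: "\<iota> ` carrier (Aq q) = B"
  by (auto simp: B_def cls_def Aq_simps)

lemma \<iota>_in_B: "x \<in> carrier (Aq q) \<Longrightarrow> \<iota> x \<in> B" using inc_image by blast

lemma \<iota>_one: "\<iota> \<one>\<^bsub>Aq q\<^esub> = e" by (simp add: Aq_simps e_def cls_def)

text \<open>
  This transfers membership in generated subalgebras from the record of the algebra to the product ring.
\<close>

lemma hull_in_subalg_on:
  assumes U: "P.subalg_on e U" and S: "S \<subseteq> carrier (Aq q)" "\<iota> ` S \<subseteq> U" and x: "x \<in> subalg (Aq q) hull S"
  shows "\<iota> x \<in> U"
proof -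
  have "subalg (Aq q) {x \<in> carrier (Aq q). \<iota> x \<in> U}"
  proof (rule subalgI[OF F_algebra_Aq])
    interpret A: F_algebra "Aq q" by (rule F_algebra_Aq)
    show "\<one>\<^bsub>Aq q\<^esub> \<in> {x \<in> carrier (Aq q). \<iota> x \<in> U}" using P.subalg_onD(1)[OF U] by (simp add: \<iota>_one)
  qed (use P.subalg_onD(2-4)[OF U] in \<open>auto simp: inc_hom Aq_rules Aq_smult\<close>)
  then have "subalg (Aq q) hull S \<subseteq> {x \<in> carrier (Aq q). \<iota> x \<in> U}"
    by (rule hull_minimal[rotated]) (use S in auto)
  then show ?thesis using x by auto
qed

abbreviation "WA \<equiv> W01_alg q"
abbreviation "ZA \<equiv> Z_alg q"

lemma alg_ops [simp]:
  "x \<otimes>\<^bsub>WA\<^esub> y = x \<otimes>\<^bsub>Aq q\<^esub> y" "x \<oplus>\<^bsub>WA\<^esub> y = x \<oplus>\<^bsub>Aq q\<^esub> y" "\<one>\<^bsub>WA\<^esub> = \<one>\<^bsub>Aq q\<^esub>" "c \<odot>\<^bsub>WA\<^esub> x = c \<odot>\<^bsub>Aq q\<^esub> x"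
  "x \<otimes>\<^bsub>ZA\<^esub> y = x \<otimes>\<^bsub>Aq q\<^esub> y" "x \<oplus>\<^bsub>ZA\<^esub> y = x \<oplus>\<^bsub>Aq q\<^esub> y" "\<one>\<^bsub>ZA\<^esub> = \<one>\<^bsub>Aq q\<^esub>" "c \<odot>\<^bsub>ZA\<^esub> x = c \<odot>\<^bsub>Aq q\<^esub> x"
  by (simp_all add: W01_alg_def Z_alg_def subalg_generated_def)

lemma carriers: "carrier WA = subalg (Aq q) hull {to_Aq q (W 0), to_Aq q (W 1)}"
  "carrier ZA = subalg (Aq q) hull {Z_elem q n | n. n \<ge> 1}"
  by (simp_all add: W01_alg_def Z_alg_def subalg_generated_def)

lemma to_Aq_carrier: "to_Aq q x \<in> carrier (Aq q)" by (simp add: Aq_simps)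

lemma \<iota>_Z_elem: "\<iota> (Z_elem q n) = z n" by (simp add: Z_elem_def z_def cls_def)

lemma subalg_WA: "subalg (Aq q) (carrier WA)" and subalg_ZA: "subalg (Aq q) (carrier ZA)"
  unfolding carriers by (rule subalg_hull[OF F_algebra_Aq]; auto simp: Z_elem_def to_Aq_carrier)+

lemmas WA = subalgD[OF subalg_WA] and ZA = subalgD[OF subalg_ZA]

lemma WA_Fixed: "x \<in> carrier WA \<Longrightarrow> n \<ge> 1 \<Longrightarrow> \<iota> x \<in> Fixed n"
  unfolding carriers
proof (erule hull_in_subalg_on[OF subalg_on_Fixed, rotated 3])
  assume n: "n \<ge> 1"
  have "\<iota> (to_Aq q (W 0)) = w 0" "\<iota> (to_Aq q (W 1)) = v 0" by (simp_all add: cls_def)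
  then show "\<iota> ` {to_Aq q (W 0), to_Aq q (W 1)} \<subseteq> Fixed n"
    using \<sigma>_W01[OF n] letters_in_B(1)[of 0] letters_in_B(2)[of 0] by (simp add: Fixed_def)
qed (simp_all add: to_Aq_carrier)

lemma ZA_Z_all: "x \<in> carrier ZA \<Longrightarrow> \<iota> x \<in> Z_all"
  unfolding carriers
proof (erule hull_in_subalg_on[OF subalg_on_Z_all, rotated 2])
  show "{Z_elem q n | n. n \<ge> 1} \<subseteq> carrier (Aq q)" by (auto simp: Z_elem_def to_Aq_carrier)
  show "\<iota> ` {Z_elem q n | n. n \<ge> 1} \<subseteq> Z_all"
  proof -
    have "z n \<in> Z_all" if "n \<ge> 1" for n using z_in_Z_upto[OF that] by (auto simp: Z_all_def)
    then show ?thesis by (auto simp: \<iota>_Z_elem)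
  qed
qed

lemma ZA_central:
  assumes x: "x \<in> carrier ZA" and y: "y \<in> B"
  shows "\<iota> x * y = y * \<iota> x"
proof -
  let ?U = "{x \<in> B. \<forall>y\<in>B. x * y = y * x}"
  have U: "P.subalg_on e ?U"
    unfolding P.subalg_on_def
  proof (intro conjI ballI allI)
    show "e \<in> ?U" using P.subalg_onD(1)[OF subalg_on_B] by (simp add: e_mult)
    fix x y assume "x \<in> ?U" "y \<in> ?U"
    then have xB: "x \<in> B" "y \<in> B" and xy: "\<forall>b\<in>B. x * b = b * x" "\<forall>b\<in>B. y * b = b * y"
      by blast+
    have xb: "x * b = b * x" and yb: "y * b = b * y" if "b \<in> B" for b
      using xy that by blast+
    have "(x + y) * b = b * (x + y)" if "b \<in> B" for b
      unfolding distrib_left distrib_right xb[OF that] yb[OF that] ..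
    moreover have "x * y * b = b * (x * y)" if b: "b \<in> B" for b
    proof -
      have "x * y * b = x * b * y" by (simp only: mult.assoc yb[OF b])
      then show ?thesis by (simp only: xb[OF b] mult.assoc)
    qed
    moreover have "x + y \<in> B" "x * y \<in> B" by (intro P.subalg_onD[OF subalg_on_B] xB)+
    ultimately show "x + y \<in> ?U" "x * y \<in> ?U" by blast+
  next
    fix x c assume x: "x \<in> ?U"
    then show "scale_prod c x \<in> ?U" using P.subalg_onD(4)[OF subalg_on_B] by simp
  qed
  have gens: "{Z_elem q n | n. n \<ge> 1} \<subseteq> carrier (Aq q)" by (auto simp: Z_elem_def to_Aq_carrier)
  have "\<iota> ` {Z_elem q n | n. n \<ge> 1} \<subseteq> ?U"
  proof
    fix a assume "a \<in> \<iota> ` {Z_elem q n | n. n \<ge> 1}"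
    then obtain n where "a = z n" by (auto simp: \<iota>_Z_elem)
    then show "a \<in> ?U" using z_central[of _ n] z_in_B[of n] by simp
  qed
  from hull_in_subalg_on[OF U gens this] x have "\<iota> x \<in> ?U" unfolding carriers by blast
  then show ?thesis using y by simp
qed

lemma independent_over_ZA:
  assumes I: "finite I" and \<beta>: "\<And>i. i \<in> I \<Longrightarrow> \<beta> i \<in> carrier WA"
    and indep: "\<And>c i. (\<Sum>i\<in>I. scale_prod (c i) (\<iota> (\<beta> i))) = 0 \<Longrightarrow> i \<in> I \<Longrightarrow> c i = 0"
    and \<zeta>: "\<And>i. i \<in> I \<Longrightarrow> \<zeta> i \<in> carrier ZA" and zero: "(\<Sum>i\<in>I. \<iota> (\<beta> i) * \<iota> (\<zeta> i)) = 0" and i: "i \<in> I"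
  shows "\<iota> (\<zeta> i) = 0"
proof -
  have "\<forall>i\<in>I. \<exists>n. \<iota> (\<zeta> i) \<in> Z_upto n" using ZA_Z_all \<zeta> by (auto simp: Z_all_def)
  from bchoice[OF this] obtain N where N: "\<forall>i\<in>I. \<iota> (\<zeta> i) \<in> Z_upto (N i)" ..
  have "\<iota> (\<zeta> i) \<in> Z_upto (\<Sum>i\<in>I. N i)" if "i \<in> I" for i
  proof -
    have "N i \<le> (\<Sum>i\<in>I. N i)" by (rule member_le_sum) (use that I in auto)
    then show ?thesis using Z_upto_mono N that by blast
  qed
  then show ?thesis
    by (intro independent_over_Z_upto[OF I _ _ _ zero i]) (use \<beta> WA_Fixed indep in auto)
qed

abbreviation "rels \<equiv> bilinearity_relators WA ZA"
abbreviation "R \<equiv> fsupp.span rels"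
abbreviation "PA \<equiv> pair_alg WA ZA"

text \<open>
  The multiplication map on the free vector space from which the tensor product is formed.
\<close>

definition \<mu> where "\<mu> p = (\<Sum>k\<in>Poly_Mapping.keys p. scale_prod (Poly_Mapping.lookup p k) (\<iota> (fst k) * \<iota> (snd k)))"

lemma \<mu>_superset:
  assumes "finite S" "Poly_Mapping.keys p \<subseteq> S"
  shows "\<mu> p = (\<Sum>k\<in>S. scale_prod (Poly_Mapping.lookup p k) (\<iota> (fst k) * \<iota> (snd k)))"
  unfolding \<mu>_def by (rule sum.mono_neutral_left) (use assms in \<open>auto simp: in_keys_iff\<close>)

lemma \<mu>_add: "\<mu> (x + y) = \<mu> x + \<mu> y"
proof -
  let ?S = "Poly_Mapping.keys x \<union> Poly_Mapping.keys y"
  have "Poly_Mapping.keys (x + y) \<subseteq> ?S" by (rule Poly_Mapping.keys_add)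
  then show ?thesis
    by (simp add: \<mu>_superset[of ?S] lookup_add P.scale_left_distrib sum.distrib)
qed

lemma \<mu>_scale: "\<mu> (c \<bullet> x) = scale_prod c (\<mu> x)"
proof -
  have "Poly_Mapping.keys (c \<bullet> x) \<subseteq> Poly_Mapping.keys x" by (auto simp: in_keys_iff)
  then show ?thesis
    by (simp add: \<mu>_superset[of "Poly_Mapping.keys x"] P.scale_sum_right)
qed

lemma \<mu>_single: "\<mu> (Poly_Mapping.single (a, b) c) = scale_prod c (\<iota> a * \<iota> b)"
  by (simp add: \<mu>_superset[of "{(a, b)}"])

lemma \<mu>_0: "\<mu> 0 = 0" by (simp add: \<mu>_def)
lemma \<mu>_diff: "\<mu> (x - y) = \<mu> x - \<mu> y"
  using \<mu>_add[of "x - y" y] by (simp add: algebra_simps)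
lemma \<mu>_sum: "\<mu> (sum F I) = (\<Sum>i\<in>I. \<mu> (F i))"
  by (induction I rule: infinite_finite_induct) (simp_all add: \<mu>_0 \<mu>_add)

lemma WA_carrier: "x \<in> carrier WA \<Longrightarrow> x \<in> carrier (Aq q)" and ZA_carrier: "x \<in> carrier ZA \<Longrightarrow> x \<in> carrier (Aq q)"
  using WA(1) ZA(1) by auto

lemma \<mu>_R: "p \<in> R \<Longrightarrow> \<mu> p = 0"
proof (induction rule: fsupp.span_induct_alt)
  case base
  show ?case by (rule \<mu>_0)
next
  case (step c x y)
  have "\<mu> x = 0" using step(1)
    by cases (simp_all add: \<mu>_diff \<mu>_add \<mu>_scale \<mu>_single inc_hom WA_carrier ZA_carrier distrib_left distrib_right)
  then show ?case using step by (simp add: \<mu>_add \<mu>_scale)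
qed

lemma R_carrier: "p \<in> R \<Longrightarrow> p \<in> carrier PA"
proof (induction rule: fsupp.span_induct_alt)
  case base
  show ?case by (simp add: pair_alg_def)
next
  case (step c x y)
  have "Poly_Mapping.keys x \<subseteq> carrier WA \<times> carrier ZA" using step(1)
    by cases (auto simp: in_keys_iff lookup_add lookup_minus lookup_single when_def WA ZA split: if_splits)
  moreover have "Poly_Mapping.keys (c \<bullet> x + y) \<subseteq> Poly_Mapping.keys x \<union> Poly_Mapping.keys y"
    by (auto simp: in_keys_iff lookup_add)
  ultimately show ?case using step(2) by (auto simp: pair_alg_def)
qed

text \<open>
  If the image of \<open>a\<close> is a linear combination of the images of the \<open>\<beta> i\<close>, then \<open>a \<otimes> b\<close> is the sum of the
  \<open>\<beta> i \<otimes> d i b\<close>. Induction on the index set, with \<open>a - d k \<beta> k\<close> in place of \<open>a\<close>, avoids finite sums in the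
  record of the algebra.
\<close>

lemma tensor_sum:
  assumes "finite I" "\<And>i. i \<in> I \<Longrightarrow> \<beta> i \<in> carrier WA" "a \<in> carrier WA" "b \<in> carrier ZA"
    and "\<iota> a = (\<Sum>i\<in>I. scale_prod (d i) (\<iota> (\<beta> i)))"
  shows "Poly_Mapping.single (a, b) 1 - (\<Sum>i\<in>I. Poly_Mapping.single (\<beta> i, d i \<odot>\<^bsub>Aq q\<^esub> b) 1) \<in> R"
  using assms
proof (induction I arbitrary: a)
  case empty
  have "0 \<odot>\<^bsub>Aq q\<^esub> a \<in> carrier (Aq q)" "a \<in> carrier (Aq q)" using empty.prems WA_carrier Aq_smult(1) by auto
  moreover have "\<iota> (0 \<odot>\<^bsub>Aq q\<^esub> a) = \<iota> a" using empty.prems by (simp add: inc_hom WA_carrier)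
  ultimately have "0 \<odot>\<^bsub>Aq q\<^esub> a = a" using inc_simps(4) by metis
  moreover have "Poly_Mapping.single (0 \<odot>\<^bsub>WA\<^esub> a, b) 1 - 0 \<bullet> Poly_Mapping.single (a, b) 1 \<in> R"
    by (intro fsupp.span_base bilinearity_relators.smult_left empty.prems)
  ultimately show ?case by simp
next
  case (insert k I)
  define a' where "a' = a \<oplus>\<^bsub>Aq q\<^esub> ((- d k) \<odot>\<^bsub>Aq q\<^esub> \<beta> k)"
  have \<beta>k: "\<beta> k \<in> carrier WA" "d k \<odot>\<^bsub>Aq q\<^esub> \<beta> k \<in> carrier WA" "(- d k) \<odot>\<^bsub>Aq q\<^esub> \<beta> k \<in> carrier WA"
    using insert.prems WA(5) by auto
  have a': "a' \<in> carrier WA" unfolding a'_def by (intro WA insert.prems \<beta>k)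
  have \<iota>a': "\<iota> a' = (\<Sum>i\<in>I. scale_prod (d i) (\<iota> (\<beta> i)))"
    using insert by (simp add: a'_def inc_hom WA_carrier \<beta>k)
  have "\<iota> (a' \<oplus>\<^bsub>Aq q\<^esub> (d k \<odot>\<^bsub>Aq q\<^esub> \<beta> k)) = \<iota> a"
    using insert.hyps by (simp add: inc_hom WA_carrier a' \<beta>k \<iota>a' insert.prems add.commute)
  moreover have "a' \<oplus>\<^bsub>Aq q\<^esub> (d k \<odot>\<^bsub>Aq q\<^esub> \<beta> k) \<in> carrier WA" by (intro WA a' \<beta>k)
  ultimately have a: "a' \<oplus>\<^bsub>Aq q\<^esub> (d k \<odot>\<^bsub>Aq q\<^esub> \<beta> k) = a"
    using inc_simps(4) WA_carrier insert.prems(2) by metis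
  have 1: "Poly_Mapping.single (a' \<oplus>\<^bsub>WA\<^esub> (d k \<odot>\<^bsub>Aq q\<^esub> \<beta> k), b) 1
      - (Poly_Mapping.single (a', b) 1 + Poly_Mapping.single (d k \<odot>\<^bsub>Aq q\<^esub> \<beta> k, b) 1) \<in> R"
    by (intro fsupp.span_base bilinearity_relators.add_left a' \<beta>k insert.prems)
  have 2: "Poly_Mapping.single (d k \<odot>\<^bsub>WA\<^esub> \<beta> k, b) 1 - d k \<bullet> Poly_Mapping.single (\<beta> k, b) 1 \<in> R"
    by (intro fsupp.span_base bilinearity_relators.smult_left \<beta>k insert.prems)
  have 3: "Poly_Mapping.single (\<beta> k, d k \<odot>\<^bsub>ZA\<^esub> b) 1 - d k \<bullet> Poly_Mapping.single (\<beta> k, b) 1 \<in> R"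
    by (intro fsupp.span_base bilinearity_relators.smult_right \<beta>k insert.prems)
  have 4: "Poly_Mapping.single (a', b) 1 - (\<Sum>i\<in>I. Poly_Mapping.single (\<beta> i, d i \<odot>\<^bsub>Aq q\<^esub> b) 1) \<in> R"
    by (rule insert.IH) (use insert.prems a' \<iota>a' in auto)
  from fsupp.span_add[OF fsupp.span_add[OF 1 fsupp.span_diff[OF 2 3]] 4] show ?case
    using insert.hyps by (simp add: a algebra_simps)
qed

lemma tensor_expand:
  assumes "p \<in> carrier PA"
  shows "\<exists>(I :: nat set) \<beta> \<zeta>. finite I \<and> (\<forall>i\<in>I. \<beta> i \<in> carrier WA \<and> \<zeta> i \<in> carrier ZA)
     \<and> p - (\<Sum>i\<in>I. Poly_Mapping.single (\<beta> i, \<zeta> i) 1) \<in> R"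
proof -
  obtain k m where k: "bij_betw k {..<m :: nat} (Poly_Mapping.keys p)"
    using ex_bij_betw_nat_finite[OF finite_keys[of p]] unfolding lessThan_atLeast0 by blast
  have kc: "fst (k i) \<in> carrier WA" "snd (k i) \<in> carrier ZA" if "i < m" for i
    using bij_betw_apply[OF k, of i] that assms by (auto simp: pair_alg_def)
  have "p = (\<Sum>l\<in>Poly_Mapping.keys p. Poly_Mapping.lookup p l \<bullet> Poly_Mapping.single l 1)"
    by (rule poly_mapping_eqI) (simp add: lookup_sum lookup_single when_def in_keys_iff if_distrib cong: if_cong)
  also have "\<dots> = (\<Sum>i<m. Poly_Mapping.lookup p (k i) \<bullet> Poly_Mapping.single (k i) 1)"
    by (rule sum.reindex_bij_betw[OF k, symmetric])
  finally have p: "p = (\<Sum>i<m. Poly_Mapping.lookup p (k i) \<bullet> Poly_Mapping.single (k i) 1)" .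
  have "(\<Sum>i<m. Poly_Mapping.single (fst (k i), Poly_Mapping.lookup p (k i) \<odot>\<^bsub>ZA\<^esub> snd (k i)) 1
      - Poly_Mapping.lookup p (k i) \<bullet> Poly_Mapping.single (fst (k i), snd (k i)) 1) \<in> R"
    by (intro fsupp.span_sum fsupp.span_base bilinearity_relators.smult_right kc) auto
  from fsupp.span_neg[OF this] have "p - (\<Sum>i<m. Poly_Mapping.single (fst (k i), Poly_Mapping.lookup p (k i) \<odot>\<^bsub>ZA\<^esub> snd (k i)) 1) \<in> R"
    by (simp add: sum_subtractf p[symmetric])
  then show ?thesis
    by (intro exI[of _ "{..<m}"] exI[of _ "\<lambda>i. fst (k i)"] exI[of _ "\<lambda>i. Poly_Mapping.lookup p (k i) \<odot>\<^bsub>ZA\<^esub> snd (k i)"])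
      (use kc ZA(5) in auto)
qed

text \<open>
  As long as the left factors are linearly dependent, one of the summands can be absorbed in the others.
\<close>

lemma tensor_independent:
  fixes I :: "nat set"
  assumes "finite I" "\<forall>i\<in>I. \<beta> i \<in> carrier WA \<and> \<zeta> i \<in> carrier ZA"
    "p - (\<Sum>i\<in>I. Poly_Mapping.single (\<beta> i, \<zeta> i) 1) \<in> R"
  shows "\<exists>(I :: nat set) \<beta> \<zeta>. finite I \<and> (\<forall>i\<in>I. \<beta> i \<in> carrier WA \<and> \<zeta> i \<in> carrier ZA)
     \<and> p - (\<Sum>i\<in>I. Poly_Mapping.single (\<beta> i, \<zeta> i) 1) \<in> R
     \<and> (\<forall>c. (\<Sum>i\<in>I. scale_prod (c i) (\<iota> (\<beta> i))) = 0 \<longrightarrow> (\<forall>i\<in>I. c i = 0))"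
  using assms
proof (induction "card I" arbitrary: I \<zeta> rule: less_induct)
  case less
  show ?case
  proof (cases "\<forall>c. (\<Sum>i\<in>I. scale_prod (c i) (\<iota> (\<beta> i))) = 0 \<longrightarrow> (\<forall>i\<in>I. c i = 0)")
    case True
    then show ?thesis using less.prems by blast
  next
    case False
    then obtain c k where c: "(\<Sum>i\<in>I. scale_prod (c i) (\<iota> (\<beta> i))) = 0" and k: "k \<in> I" "c k \<noteq> 0" by auto
    define J where "J = I - {k}"
    have J: "finite J" "J \<subseteq> I" "card J < card I" "I = insert k J" "k \<notin> J"
      using less.prems(1) k card_Diff1_less[OF less.prems(1) k(1)] by (auto simp: J_def)
    define d where "d i = - (c i / c k)" for i
    have "(\<Sum>i\<in>J. scale_prod (c i) (\<iota> (\<beta> i))) = - scale_prod (c k) (\<iota> (\<beta> k))"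
      using c J by (simp add: eq_neg_iff_add_eq_0 add.commute)
    then have "scale_prod (- (1 / c k)) (\<Sum>i\<in>J. scale_prod (c i) (\<iota> (\<beta> i))) = \<iota> (\<beta> k)"
      using k by simp
    then have \<iota>k: "\<iota> (\<beta> k) = (\<Sum>i\<in>J. scale_prod (d i) (\<iota> (\<beta> i)))"
      by (simp add: d_def P.scale_sum_right)
    have 1: "Poly_Mapping.single (\<beta> k, \<zeta> k) 1 - (\<Sum>i\<in>J. Poly_Mapping.single (\<beta> i, d i \<odot>\<^bsub>Aq q\<^esub> \<zeta> k) 1) \<in> R"
      by (rule tensor_sum[OF J(1) _ _ _ \<iota>k]) (use less.prems k J in auto)
    define \<zeta>' where "\<zeta>' i = \<zeta> i \<oplus>\<^bsub>Aq q\<^esub> (d i \<odot>\<^bsub>Aq q\<^esub> \<zeta> k)" for i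
    have \<zeta>': "\<zeta>' i \<in> carrier ZA" if "i \<in> J" for i
      unfolding \<zeta>'_def using less.prems k J that by (intro ZA) auto
    have 2: "(\<Sum>i\<in>J. Poly_Mapping.single (\<beta> i, \<zeta> i \<oplus>\<^bsub>ZA\<^esub> (d i \<odot>\<^bsub>Aq q\<^esub> \<zeta> k)) 1
       - (Poly_Mapping.single (\<beta> i, \<zeta> i) 1 + Poly_Mapping.single (\<beta> i, d i \<odot>\<^bsub>Aq q\<^esub> \<zeta> k) 1)) \<in> R"
      by (intro fsupp.span_sum fsupp.span_base bilinearity_relators.add_right) (use less.prems k J ZA in auto)
    have red: "p - (\<Sum>i\<in>J. Poly_Mapping.single (\<beta> i, \<zeta>' i) 1) \<in> R"
      using fsupp.span_diff[OF fsupp.span_add[OF less.prems(3) 1] 2] J(1,5)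
      unfolding J(4) by (simp add: sum_subtractf sum.distrib \<zeta>'_def algebra_simps)
    have "\<forall>i\<in>J. \<beta> i \<in> carrier WA \<and> \<zeta>' i \<in> carrier ZA"
      using less.prems(2) J(2) \<zeta>' by auto
    from less.hyps[OF J(3,1) this red] show ?thesis .
  qed
qed

lemma \<mu>_kernel:
  assumes "p \<in> carrier PA" "\<mu> p = 0"
  shows "p \<in> R"
proof -
  from tensor_expand[OF assms(1)] obtain I0 :: "nat set" and \<beta>0 \<zeta>0 where
    "finite I0" "\<forall>i\<in>I0. \<beta>0 i \<in> carrier WA \<and> \<zeta>0 i \<in> carrier ZA" "p - (\<Sum>i\<in>I0. Poly_Mapping.single (\<beta>0 i, \<zeta>0 i) 1) \<in> R"
    by blast
  from tensor_independent[OF this] obtain I :: "nat set" and \<beta> \<zeta> where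
    I: "finite I" and c: "\<forall>i\<in>I. \<beta> i \<in> carrier WA \<and> \<zeta> i \<in> carrier ZA"
    and p: "p - (\<Sum>i\<in>I. Poly_Mapping.single (\<beta> i, \<zeta> i) 1) \<in> R"
    and ind: "\<forall>c. (\<Sum>i\<in>I. scale_prod (c i) (\<iota> (\<beta> i))) = 0 \<longrightarrow> (\<forall>i\<in>I. c i = 0)"
    by blast
  from \<mu>_R[OF p] have "(\<Sum>i\<in>I. \<iota> (\<beta> i) * \<iota> (\<zeta> i)) = 0"
    using assms(2) by (simp add: \<mu>_diff \<mu>_sum \<mu>_single)
  then have \<iota>\<zeta>: "\<iota> (\<zeta> i) = 0" if "i \<in> I" for i
    using independent_over_ZA[OF I, of \<beta> \<zeta> i] c ind that by blast
  have "Poly_Mapping.single (\<beta> i, \<zeta> i) 1 \<in> R" if i: "i \<in> I" for i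
  proof -
    have "\<zeta> i \<in> carrier (Aq q)" using c i ZA_carrier by blast
    moreover have "0 \<odot>\<^bsub>Aq q\<^esub> \<zeta> i \<in> carrier (Aq q)" using calculation Aq_smult(1) by blast
    ultimately have z: "0 \<odot>\<^bsub>Aq q\<^esub> \<zeta> i = \<zeta> i"
      using inc_simps(4)[of "0 \<odot>\<^bsub>Aq q\<^esub> \<zeta> i" q "\<zeta> i"] \<iota>\<zeta>[OF i] by (simp add: inc_hom)
    have "Poly_Mapping.single (\<beta> i, 0 \<odot>\<^bsub>ZA\<^esub> \<zeta> i) 1 - 0 \<bullet> Poly_Mapping.single (\<beta> i, \<zeta> i) 1 \<in> R"
      by (intro fsupp.span_base bilinearity_relators.smult_right) (use c i in auto)
    then show ?thesis by (simp add: z)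
  qed
  then have "(\<Sum>i\<in>I. Poly_Mapping.single (\<beta> i, \<zeta> i) 1) \<in> R" by (rule fsupp.span_sum)
  from fsupp.span_add[OF p this] show ?thesis by simp
qed

end

section \<open>The isomorphism\<close>

context good_parameter begin

lemma carrier_PA: "p \<in> carrier PA \<longleftrightarrow> Poly_Mapping.keys p \<subseteq> carrier WA \<times> carrier ZA"
  by (simp add: pair_alg_def)

lemma carrier_PA_single: "a \<in> carrier WA \<Longrightarrow> b \<in> carrier ZA \<Longrightarrow> Poly_Mapping.single (a, b) c \<in> carrier PA"
  by (auto simp: carrier_PA)

lemma carrier_PA_add: "x \<in> carrier PA \<Longrightarrow> y \<in> carrier PA \<Longrightarrow> x + y \<in> carrier PA"
  using Poly_Mapping.keys_add[of x y] by (auto simp: carrier_PA)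

lemma carrier_PA_scale: "x \<in> carrier PA \<Longrightarrow> c \<bullet> x \<in> carrier PA"
  by (auto simp: carrier_PA in_keys_iff)

lemma carrier_PA_diff: "x \<in> carrier PA \<Longrightarrow> y \<in> carrier PA \<Longrightarrow> x - y \<in> carrier PA"
  using carrier_PA_add[of x "(- 1) \<bullet> y"] carrier_PA_scale[of y "- 1"] by simp

lemma carrier_PA_sum: "(\<And>i. i \<in> I \<Longrightarrow> F i \<in> carrier PA) \<Longrightarrow> sum F I \<in> carrier PA"
proof -
  have "0 \<in> carrier PA" by (simp add: carrier_PA)
  then show "(\<And>i. i \<in> I \<Longrightarrow> F i \<in> carrier PA) \<Longrightarrow> sum F I \<in> carrier PA"
    by (induction I rule: infinite_finite_induct) (simp_all add: carrier_PA_add)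
qed

lemma PA_mult_eq:
  "x \<otimes>\<^bsub>PA\<^esub> y = (\<Sum>k\<in>Poly_Mapping.keys x. \<Sum>l\<in>Poly_Mapping.keys y.
     Poly_Mapping.single (fst k \<otimes>\<^bsub>Aq q\<^esub> fst l, snd k \<otimes>\<^bsub>Aq q\<^esub> snd l) (Poly_Mapping.lookup x k * Poly_Mapping.lookup y l))"
  by (simp add: pair_alg_def case_prod_beta)

lemma carrier_PA_mult: "x \<in> carrier PA \<Longrightarrow> y \<in> carrier PA \<Longrightarrow> x \<otimes>\<^bsub>PA\<^esub> y \<in> carrier PA"
  unfolding PA_mult_eq
  by (intro carrier_PA_sum carrier_PA_single WA ZA) (auto simp: carrier_PA)

lemma \<mu>_mult:
  assumes x: "x \<in> carrier PA" and y: "y \<in> carrier PA"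
  shows "\<mu> (x \<otimes>\<^bsub>PA\<^esub> y) = \<mu> x * \<mu> y"
proof -
  have "\<mu> (x \<otimes>\<^bsub>PA\<^esub> y) = (\<Sum>k\<in>Poly_Mapping.keys x. \<Sum>l\<in>Poly_Mapping.keys y.
      scale_prod (Poly_Mapping.lookup x k) (\<iota> (fst k) * \<iota> (snd k)) * scale_prod (Poly_Mapping.lookup y l) (\<iota> (fst l) * \<iota> (snd l)))"
    unfolding PA_mult_eq \<mu>_sum \<mu>_single
  proof (intro sum.cong refl)
    fix k l assume "k \<in> Poly_Mapping.keys x" "l \<in> Poly_Mapping.keys y"
    then have kl: "fst k \<in> carrier (Aq q)" "snd k \<in> carrier ZA" "fst l \<in> carrier (Aq q)" "snd l \<in> carrier (Aq q)" "snd k \<in> carrier (Aq q)"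
      using x y WA_carrier ZA_carrier by (auto simp: carrier_PA)
    have "\<iota> (fst k) * \<iota> (fst l) * (\<iota> (snd k) * \<iota> (snd l)) = \<iota> (fst k) * (\<iota> (snd k) * \<iota> (fst l)) * \<iota> (snd l)"
      unfolding ZA_central[OF kl(2) \<iota>_in_B[OF kl(3)]] by (simp only: mult.assoc)
    then show "scale_prod (Poly_Mapping.lookup x k * Poly_Mapping.lookup y l) (\<iota> (fst k \<otimes>\<^bsub>Aq q\<^esub> fst l) * \<iota> (snd k \<otimes>\<^bsub>Aq q\<^esub> snd l))
      = scale_prod (Poly_Mapping.lookup x k) (\<iota> (fst k) * \<iota> (snd k)) * scale_prod (Poly_Mapping.lookup y l) (\<iota> (fst l) * \<iota> (snd l))"
      using kl by (simp add: inc_hom mult.assoc mult.commute[of "Poly_Mapping.lookup x k"])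
  qed
  then show ?thesis by (simp only: \<mu>_def sum_product)
qed

text \<open>
  The image is a subalgebra, as the right factors are central, and it contains the generators of
  \<open>W01_Z_generate\<close>.
\<close>

lemma \<mu>_image: "\<mu> ` carrier PA = B"
proof
  have "\<mu> x \<in> B" if "x \<in> carrier PA" for x
    unfolding \<mu>_def
    by (intro P.subalg_onD(7,4,3)[OF subalg_on_B] \<iota>_in_B WA_carrier ZA_carrier) (use that in \<open>auto simp: carrier_PA\<close>)
  then show "\<mu> ` carrier PA \<subseteq> B" by auto
  have one: "\<iota> \<one>\<^bsub>Aq q\<^esub> = e" by (rule \<iota>_one)
  have img: "\<iota> a * \<iota> b \<in> \<mu> ` carrier PA" if "a \<in> carrier WA" "b \<in> carrier ZA" for a b
    by (rule image_eqI[OF _ carrier_PA_single[OF that, of 1]]) (simp add: \<mu>_single)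
  have U: "P.subalg_on e (\<mu> ` carrier PA)"
    unfolding P.subalg_on_def
  proof (intro conjI ballI allI)
    show "e \<in> \<mu> ` carrier PA" using img[OF WA(2) ZA(2)] by (simp add: one e_idem)
    fix x y assume "x \<in> \<mu> ` carrier PA" "y \<in> \<mu> ` carrier PA"
    then obtain x' y' where "x' \<in> carrier PA" "y' \<in> carrier PA" "x = \<mu> x'" "y = \<mu> y'" by auto
    then show "x + y \<in> \<mu> ` carrier PA" "x * y \<in> \<mu> ` carrier PA"
      using carrier_PA_add carrier_PA_mult by (auto simp: \<mu>_add[symmetric] \<mu>_mult[symmetric])
  next
    fix c x assume "x \<in> \<mu> ` carrier PA"
    then show "scale_prod c x \<in> \<mu> ` carrier PA"
      using carrier_PA_scale by (auto simp: \<mu>_scale[symmetric])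
  qed
  have gens: "to_Aq q (W 0) \<in> carrier WA" "to_Aq q (W 1) \<in> carrier WA" "n \<ge> 1 \<Longrightarrow> Z_elem q n \<in> carrier ZA" for n
    unfolding carriers using hull_subset[of "{to_Aq q (W 0), to_Aq q (W 1)}" "subalg (Aq q)"]
      hull_subset[of "{Z_elem q n | n. n \<ge> 1}" "subalg (Aq q)"] by auto
  have \<iota>w: "\<iota> (to_Aq q (W 0)) = w 0" "\<iota> (to_Aq q (W 1)) = v 0" by (simp_all add: cls_def)
  show "B \<subseteq> \<mu> ` carrier PA"
  proof (rule W01_Z_generate[OF U])
    show "w 0 \<in> \<mu> ` carrier PA" using img[OF gens(1) ZA(2)] letters_in_B(1)[of 0] by (simp only: \<iota>w one e_mult)
    show "v 0 \<in> \<mu> ` carrier PA" using img[OF gens(2) ZA(2)] letters_in_B(2)[of 0] by (simp only: \<iota>w one e_mult)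
    show "z n \<in> \<mu> ` carrier PA" if "n \<ge> 1" for n
      using img[OF WA(2) gens(3)[OF that]] z_in_B by (simp only: \<iota>_Z_elem one e_mult)
  qed
qed

text \<open>
  The cosets that make up the tensor product are the fibres of the multiplication map (\<open>coset_eq_fibre\<close>).
  Therefore the operations on cosets, which are defined as unions, can be read off from values of \<open>\<mu>\<close>.
\<close>

definition fibre where "fibre c = {x \<in> carrier PA. \<mu> x = c}"

lemma coset_eq_fibre:
  assumes "x \<in> carrier PA"
  shows "R +>\<^bsub>PA\<^esub> x = fibre (\<mu> x)"
proof -
  have "R +>\<^bsub>PA\<^esub> x = (\<lambda>r. r + x) ` R"
    by (auto simp: a_r_coset_def' pair_alg_def)
  also have "\<dots> = fibre (\<mu> x)"
  proof
    show "(\<lambda>r. r + x) ` R \<subseteq> fibre (\<mu> x)"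
      using assms R_carrier \<mu>_R carrier_PA_add by (auto simp: fibre_def \<mu>_add)
    show "fibre (\<mu> x) \<subseteq> (\<lambda>r. r + x) ` R"
    proof
      fix y assume "y \<in> fibre (\<mu> x)"
      then have "y - x \<in> R" using assms by (intro \<mu>_kernel carrier_PA_diff) (auto simp: fibre_def \<mu>_diff)
      then show "y \<in> (\<lambda>r. r + x) ` R" by (rule image_eqI[rotated]) simp
    qed
  qed
  finally show ?thesis .
qed

lemma fibre_nonempty: "c \<in> B \<Longrightarrow> fibre c \<noteq> {}"
  unfolding \<mu>_image[symmetric] by (auto simp: fibre_def)

lemma \<mu>_fibre: "c \<in> B \<Longrightarrow> \<mu> ` fibre c = {c}"
  using fibre_nonempty[of c] by (auto simp: fibre_def)

abbreviation "TA \<equiv> tensor_alg WA ZA"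

lemma TA_carrier: "carrier TA = fibre ` B"
proof -
  have "carrier TA = (\<lambda>x. R +>\<^bsub>PA\<^esub> x) ` carrier PA"
    by (auto simp: tensor_alg_def alg_quot_def FactRing_def A_RCOSETS_def')
  also have "\<dots> = fibre ` \<mu> ` carrier PA" by (auto simp: coset_eq_fibre image_image)
  finally show ?thesis by (simp only: \<mu>_image)
qed

lemma fibre_add: "a \<in> B \<Longrightarrow> b \<in> B \<Longrightarrow> fibre a \<oplus>\<^bsub>TA\<^esub> fibre b = fibre (a + b)"
proof -
  assume a: "a \<in> B" and b: "b \<in> B"
  obtain x where x: "x \<in> carrier PA" "\<mu> x = a" using a unfolding \<mu>_image[symmetric] by auto
  have "fibre a \<oplus>\<^bsub>TA\<^esub> fibre b = (\<Union>x\<in>fibre a. \<Union>y\<in>fibre b. {x + y})"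
    by (simp add: tensor_alg_def alg_quot_def FactRing_def set_add_def' pair_alg_def)
  also have "\<dots> = fibre (a + b)"
  proof
    show "(\<Union>x\<in>fibre a. \<Union>y\<in>fibre b. {x + y}) \<subseteq> fibre (a + b)"
      using carrier_PA_add by (auto simp: fibre_def \<mu>_add)
    show "fibre (a + b) \<subseteq> (\<Union>x\<in>fibre a. \<Union>y\<in>fibre b. {x + y})"
    proof
      fix y assume "y \<in> fibre (a + b)"
      then have "y - x \<in> fibre b" "x \<in> fibre a" using x carrier_PA_diff by (auto simp: fibre_def \<mu>_diff)
      moreover have "y = x + (y - x)" by simp
      ultimately show "y \<in> (\<Union>x\<in>fibre a. \<Union>y\<in>fibre b. {x + y})" by blast
    qed
  qed
  finally show ?thesis .
qed

lemma fibre_mult: "a \<in> B \<Longrightarrow> b \<in> B \<Longrightarrow> fibre a \<otimes>\<^bsub>TA\<^esub> fibre b = fibre (a * b)"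
proof -
  assume a: "a \<in> B" and b: "b \<in> B"
  have "fibre a \<otimes>\<^bsub>TA\<^esub> fibre b = (\<Union>x\<in>fibre a. \<Union>y\<in>fibre b. R +>\<^bsub>PA\<^esub> (x \<otimes>\<^bsub>PA\<^esub> y))"
    by (simp add: tensor_alg_def alg_quot_def FactRing_def rcoset_mult_def)
  also have "\<dots> = (\<Union>x\<in>fibre a. \<Union>y\<in>fibre b. fibre (a * b))"
    by (intro SUP_cong refl) (auto simp: fibre_def coset_eq_fibre[unfolded fibre_def] carrier_PA_mult \<mu>_mult)
  also have "\<dots> = fibre (a * b)" using fibre_nonempty[OF a] fibre_nonempty[OF b] by simp
  finally show ?thesis .
qed

lemma fibre_one: "\<one>\<^bsub>TA\<^esub> = fibre e"
proof -
  have "\<one>\<^bsub>TA\<^esub> = R +>\<^bsub>PA\<^esub> Poly_Mapping.single (\<one>\<^bsub>Aq q\<^esub>, \<one>\<^bsub>Aq q\<^esub>) 1"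
    by (simp add: tensor_alg_def alg_quot_def FactRing_def pair_alg_def)
  then show ?thesis
    using WA(2) ZA(2) by (simp add: coset_eq_fibre carrier_PA_single \<mu>_single \<iota>_one e_idem)
qed

lemma fibre_scale: "a \<in> B \<Longrightarrow> c \<odot>\<^bsub>TA\<^esub> fibre a = fibre (scale_prod c a)"
proof -
  assume a: "a \<in> B"
  have "c \<odot>\<^bsub>TA\<^esub> fibre a = (\<Union>x\<in>fibre a. R +>\<^bsub>PA\<^esub> (c \<bullet> x))"
    by (simp add: tensor_alg_def alg_quot_def pair_alg_def)
  also have "\<dots> = (\<Union>x\<in>fibre a. fibre (scale_prod c a))"
    by (intro SUP_cong refl) (auto simp: fibre_def coset_eq_fibre[unfolded fibre_def] carrier_PA_scale \<mu>_scale)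
  also have "\<dots> = fibre (scale_prod c a)" using fibre_nonempty[OF a] by simp
  finally show ?thesis .
qed

definition \<Phi> where "\<Phi> X = inv_into (carrier (Aq q)) \<iota> (the_elem (\<mu> ` X))"

lemma \<Phi>_fibre: "a \<in> carrier (Aq q) \<Longrightarrow> \<Phi> (fibre (\<iota> a)) = a"
  by (simp add: \<Phi>_def \<mu>_fibre \<iota>_in_B inv_into_f_f inj_on_def inc_simps(4))

lemma TA_cases:
  assumes "X \<in> carrier TA"
  obtains a where "a \<in> carrier (Aq q)" "X = fibre (\<iota> a)"
  using assms unfolding TA_carrier inc_image[symmetric] by auto

lemma \<Phi>_alg_iso: "\<Phi> \<in> alg_iso TA (Aq q)"
proof -
  have "\<Phi> \<in> ring_hom TA (Aq q)"
  proof (rule ring_hom_memI)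
    fix X Y assume "X \<in> carrier TA" "Y \<in> carrier TA"
    then obtain a b where ab: "a \<in> carrier (Aq q)" "b \<in> carrier (Aq q)" and X: "X = fibre (\<iota> a)" "Y = fibre (\<iota> b)"
      by (meson TA_cases)
    show "\<Phi> (X \<otimes>\<^bsub>TA\<^esub> Y) = \<Phi> X \<otimes>\<^bsub>Aq q\<^esub> \<Phi> Y"
      using ab Aq_rules(5)[OF ab] by (simp add: X fibre_mult \<iota>_in_B inc_hom[symmetric] \<Phi>_fibre)
    show "\<Phi> (X \<oplus>\<^bsub>TA\<^esub> Y) = \<Phi> X \<oplus>\<^bsub>Aq q\<^esub> \<Phi> Y"
      using ab Aq_rules(1)[OF ab] by (simp add: X fibre_add \<iota>_in_B inc_hom[symmetric] \<Phi>_fibre)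
  next
    show "\<Phi> X \<in> carrier (Aq q)" if "X \<in> carrier TA" for X using that by (rule TA_cases) (simp add: \<Phi>_fibre)
    show "\<Phi> \<one>\<^bsub>TA\<^esub> = \<one>\<^bsub>Aq q\<^esub>"
      unfolding fibre_one \<iota>_one[symmetric] by (rule \<Phi>_fibre) (simp add: Aq_simps)
  qed
  moreover have "bij_betw \<Phi> (carrier TA) (carrier (Aq q))"
    by (rule bij_betw_byWitness[of _ "\<lambda>a. fibre (\<iota> a)"])
      (auto simp: \<Phi>_fibre TA_carrier inc_image[symmetric])
  moreover have "\<Phi> (c \<odot>\<^bsub>TA\<^esub> X) = c \<odot>\<^bsub>Aq q\<^esub> \<Phi> X" if "X \<in> carrier TA" for c X
    using that
  proof (rule TA_cases)
    fix a assume a: "a \<in> carrier (Aq q)" and X: "X = fibre (\<iota> a)"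
    have "c \<odot>\<^bsub>Aq q\<^esub> a \<in> carrier (Aq q)" using a by (rule Aq_smult)
    then show ?thesis using a by (simp add: X fibre_scale \<iota>_in_B inc_hom[symmetric] \<Phi>_fibre)
  qed
  ultimately show ?thesis by (simp add: alg_iso_def ring_iso_def)
qed

lemma \<Phi>_pure_tensor:
  assumes "a \<in> carrier WA" "b \<in> carrier ZA"
  shows "\<Phi> (pure_tensor WA ZA a b) = a \<otimes>\<^bsub>Aq q\<^esub> b"
proof -
  have ab: "a \<in> carrier (Aq q)" "b \<in> carrier (Aq q)" using assms WA_carrier ZA_carrier by auto
  have "pure_tensor WA ZA a b = fibre (\<iota> (a \<otimes>\<^bsub>Aq q\<^esub> b))"
    using assms ab by (simp add: pure_tensor_def coset_eq_fibre carrier_PA_single \<mu>_single inc_hom)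
  then show ?thesis using Aq_rules(5)[OF ab] by (simp add: \<Phi>_fibre)
qed

end

theorem theorem10p4:
  fixes q :: "'f::field"
  assumes "q \<noteq> 0"
    and "\<And>n::nat. n \<ge> 1 \<Longrightarrow> q ^ n \<noteq> 1"
  shows "\<exists>\<mu> \<in> alg_iso (tensor_alg (W01_alg q) (Z_alg q)) (Aq q).
           \<forall>w \<in> carrier (W01_alg q). \<forall>z \<in> carrier (Z_alg q).
             \<mu> (pure_tensor (W01_alg q) (Z_alg q) w z) = w \<otimes>\<^bsub>Aq q\<^esub> z"
proof -
  interpret good_parameter q by unfold_locales (use assms in auto)
  show ?thesis using \<Phi>_alg_iso \<Phi>_pure_tensor by blast
qed

end
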